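(* Let $\Omega\subset\mathbb{R}^n$, $n\ge2$, be a bounded connected domain with Lipschitz boundary, let $p\ge 2$ be fixed, let $\sigma:\overline\Omega\times[0,+\infty)\to\mathbb{R}$ satisfy hypotheses (H1)–(H5) listed in the context, and let $f\in X_\diamond$. Then the Gâteaux derivative of $\mathbb{F}_\sigma\circ\mathbb{U}_\sigma:X_\diamond\to\mathbb{R}$ at $f$ exists and equals $\Lambda_\sigma(f)$, i.e. $$\mathrm{d}(\mathbb{F}_\sigma\circ\mathbb{U}_\sigma)(f;\varphi)=(\mathbb{F}_\sigma\circ\mathbb{U}_\sigma)'(f)\varphi=\langle\Lambda_\sigma(f),\varphi\rangle\qquad\forall\varphi\in X_\diamond.$$
   Context: Hypotheses on $\sigma:\overline\Omega\times[0,+\infty)\to\mathbb{R}$, for fixed $p\ge2$: (H1) $x\mapsto\sigma(x,E)$ is measurable on $\overline\Omega$ for every $E\ge0$. (H2) $E\in(0,+\infty)\mapsto\sigma(x,E)E$ is strictly increasing for a.e. $x\in\overline\Omega$. (H3) $E\mapsto\sigma(x,E)$ is continuous on $[0,+\infty)$ for a.e. $x\in\overline\Omega$. (H4) There exist positive constants $\overline\sigma\ge\underline\sigma$ and $E_0>0$ such that $\underline\sigma\,(E/E_0)^{p-2}\le\sigma(x,E)\le\overline\sigma\max\{1,(E/E_0)^{p-2}\}$ for a.e. $x\in\overline\Omega$ and all $E>0$. (H5) There exists $c>0$ such that $(\sigma(x,|\mathbf{E}_2|)\mathbf{E}_2-\sigma(x,|\mathbf{E}_1|)\mathbf{E}_1)\cdot(\mathbf{E}_2-\mathbf{E}_1)\ge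 c|\mathbf{E}_2-\mathbf{E}_1|^p$ for a.e. $x\in\overline\Omega$ and all $\mathbf{E}_1,\mathbf{E}_2\in\mathbb{R}^n$. Boundary data: $W^{1,p}_0(\Omega)$ is the closure of $C^1_0(\Omega)$ in the $W^{1,p}$-norm. $X=W^{1,p}(\Omega)/W^{1,p}_0(\Omega)$ is the trace space, and $X_\diamond$ is the set of elements of $X$ whose trace has zero average on $\partial\Omega$ with respect to the $(n-1)$-dimensional Hausdorff measure; $X_\diamond'$ is its dual. One writes $f\in X_\diamond$ also for a representative $f\in W^{1,p}(\Omega)$ of a class, and $u|_{\partial\Omega}=f$ means $u-f\in W^{1,p}_0(\Omega)$. Dirichlet Energy: $\mathbb{F}_\sigma(u)=\int_\Omega Q_\sigma(x,|\nabla u(x)|)\,dx$ for $u\in W^{1,p}(\Omega)$, with $Q_\sigma(x,E)=\int_0^E\sigma(x,\xi)\xi\,d\xi$. For $f\in X_\diamond$, $u^f$ denotes the unique minimizer of $\mathbb{F}_\sigma$ over $\{u\in W^{1,p}(\Omega): u|_{\partial\Omega}=f\}$, equivalently the weak solution of $\operatorname{div}(\sigma(x,|\nabla u|)\nabla u)=0$ in $\Omega$, $u=f$ on $\partial\Omega$. The operator $\mathbb{U}_\sigma:X_\diamond\to W^{1,p}(\Omega)$ is $\mathbb{U}_\sigma(f)=u^f$. Dirichlet-to-Neumann (DtN) operator $\Lambda_\sigma:X_\diamond\to X_\diamond'$: $\Lambda_\sigma(f)=\sigma(x,|\nabla u^f|)\,\partial_n u^f|_{\partial\Omega}$, i.e.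 $\langle\Lambda_\sigma(f),\varphi\rangle=\int_{\partial\Omega}\varphi\,\sigma(x,|\nabla u^f|)\,\partial_n u^f\,dS$, understood in the weak sense as $\langle\Lambda_\sigma(f),\varphi\rangle=\int_\Omega\sigma(x,|\nabla u^f(x)|)\nabla u^f(x)\cdot\nabla\varphi(x)\,dx$ (independent of the representative of $\varphi$). Gâteaux derivative: for a functional $\mathbb{G}$ on a normed space, $\mathrm{d}\mathbb{G}(f;\varphi)=\lim_{\varepsilon\to0}\frac{\mathbb{G}(f+\varepsilon\varphi)-\mathbb{G}(f)}{\varepsilon}$; $\mathbb{G}$ is Gâteaux differentiable at $f$ if this limit exists for all $\varphi$ and defines a bounded linear functional $\varphi\mapsto\mathbb{G}'(f)\varphi$. *)

theory Defs
  imports "HOL-Analysis.Analysis"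
begin

section \<open>Domains with Lipschitz boundary\<close>

text \<open>Near every boundary point, in suitable orthonormal coordinates whose last axis is
  \<open>e\<close>, the set is the strict epigraph of a Lipschitz function \<open>g\<close> of the component
  \<open>x - (x \<bullet> e) *\<^sub>R e\<close> orthogonal to \<open>e\<close>.\<close>

definition lipschitz_boundary :: "(real^'n) set \<Rightarrow> bool" where
  "lipschitz_boundary \<Omega> \<longleftrightarrow>
     (\<forall>z\<in>frontier \<Omega>. \<exists>r>0. \<exists>e g L. norm e = 1 \<and> L-lipschitz_on {y. y \<bullet> e = 0} g \<and>
        \<Omega> \<inter> ball z r = {x \<in> ball z r. g (x - (x \<bullet> e) *\<^sub>R e) < x \<bullet> e})"

definition lipschitz_domain :: "(real^'n) set \<Rightarrow> bool" where
  "lipschitz_domain \<Omega> \<longleftrightarrow>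
     open \<Omega> \<and> connected \<Omega> \<and> bounded \<Omega> \<and> \<Omega> \<noteq> {} \<and> lipschitz_boundary \<Omega>"


section \<open>Hausdorff measure\<close>

text \<open>The condition \<open>bounded (C i)\<close> is needed because \<open>diameter\<close> is only meaningful for
  bounded sets. As \<open>0 powr 0 = 0\<close>, the definition is only meant for \<open>s > 0\<close>.\<close>

definition hausdorff_content :: "nat \<Rightarrow> real \<Rightarrow> 'a::metric_space set \<Rightarrow> ennreal" where
  "hausdorff_content s \<delta> A =
     (INF C \<in> {C :: nat \<Rightarrow> 'a set. (\<forall>i. bounded (C i) \<and> diameter (C i) \<le> \<delta>) \<and> A \<subseteq> (\<Union>i. C i)}.
        \<Sum>i. ennreal (unit_ball_vol (real s) * (diameter (C i) / 2) powr real s))"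

definition hausdorff_outer :: "nat \<Rightarrow> 'a::metric_space set \<Rightarrow> ennreal" where
  "hausdorff_outer s A = (SUP \<delta>\<in>{0<..}. hausdorff_content s \<delta> A)"

definition hausdorff_measure :: "nat \<Rightarrow> 'a::metric_space measure" where
  "hausdorff_measure s = measure_of UNIV (sets borel) (hausdorff_outer s)"

definition surface_measure :: "(real^'n) set \<Rightarrow> (real^'n) measure" where
  "surface_measure \<Omega> = restrict_space (hausdorff_measure (CARD('n) - 1)) (frontier \<Omega>)"


section \<open>Sobolev spaces\<close>

text \<open>Elements of Lebesgue and Sobolev spaces over \<open>\<Omega>\<close> are represented by functions on the whole
  space; only their values almost everywhere on \<open>\<Omega>\<close> matter.\<close>

definition Lp_on :: "real \<Rightarrow> 'a measure \<Rightarrow> ('a \<Rightarrow> 'b::{real_normed_vector, second_countable_topology}) set" where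
  "Lp_on p M = {u. u \<in> borel_measurable M \<and> integrable M (\<lambda>x. norm (u x) powr p)}"

definition C1_fun :: "(real^'n \<Rightarrow> real) set" where
  "C1_fun = {\<phi>. \<exists>g. continuous_on UNIV g \<and> (\<forall>x. GDERIV \<phi> x :> g x)}"

definition C1_0 :: "(real^'n) set \<Rightarrow> (real^'n \<Rightarrow> real) set" where
  "C1_0 \<Omega> = {\<phi> \<in> C1_fun. compact (closure {x. \<phi> x \<noteq> 0}) \<and> closure {x. \<phi> x \<noteq> 0} \<subseteq> \<Omega>}"

definition locally_integrable_on ::
  "(real^'n) set \<Rightarrow> (real^'n \<Rightarrow> 'b::{banach, second_countable_topology}) \<Rightarrow> bool" where
  "locally_integrable_on \<Omega> u \<longleftrightarrow> (\<forall>K. compact K \<and> K \<subseteq> \<Omega> \<longrightarrow> integrable (lebesgue_on K) u)"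

definition has_weak_grad ::
  "(real^'n) set \<Rightarrow> (real^'n \<Rightarrow> real) \<Rightarrow> (real^'n \<Rightarrow> real^'n) \<Rightarrow> bool" where
  "has_weak_grad \<Omega> u w \<longleftrightarrow>
     locally_integrable_on \<Omega> u \<and> locally_integrable_on \<Omega> w \<and>
     (\<forall>\<phi>\<in>C1_0 \<Omega>. \<forall>g. (\<forall>x. GDERIV \<phi> x :> g x) \<longrightarrow>
        (LINT x|lebesgue_on \<Omega>. u x *\<^sub>R g x) = - (LINT x|lebesgue_on \<Omega>. \<phi> x *\<^sub>R w x))"

text \<open>The weak gradient is unique up to null sets of \<open>\<Omega>\<close>; an arbitrary version is chosen.\<close>

definition weak_grad :: "(real^'n) set \<Rightarrow> (real^'n \<Rightarrow> real) \<Rightarrow> real^'n \<Rightarrow> real^'n" where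
  "weak_grad \<Omega> u = (SOME w. has_weak_grad \<Omega> u w)"

definition W1p :: "(real^'n) set \<Rightarrow> real \<Rightarrow> (real^'n \<Rightarrow> real) set" where
  "W1p \<Omega> p = {u \<in> Lp_on p (lebesgue_on \<Omega>).
                 \<exists>w. has_weak_grad \<Omega> u w \<and> w \<in> Lp_on p (lebesgue_on \<Omega>)}"

definition W1p_norm :: "(real^'n) set \<Rightarrow> real \<Rightarrow> (real^'n \<Rightarrow> real) \<Rightarrow> real" where
  "W1p_norm \<Omega> p u =
     ((LINT x|lebesgue_on \<Omega>. \<bar>u x\<bar> powr p) +
      (LINT x|lebesgue_on \<Omega>. norm (weak_grad \<Omega> u x) powr p)) powr (1 / p)"

definition W1p_0 :: "(real^'n) set \<Rightarrow> real \<Rightarrow> (real^'n \<Rightarrow> real) set" where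
  "W1p_0 \<Omega> p = {u \<in> W1p \<Omega> p. \<exists>\<phi>. (\<forall>k::nat. \<phi> k \<in> C1_0 \<Omega>) \<and>
                   (\<lambda>k. W1p_norm \<Omega> p (\<lambda>x. u x - \<phi> k x)) \<longlonglongrightarrow> 0}"


section \<open>Traces and the spaces of boundary data\<close>

text \<open>The trace operator is the continuous extension, from the \<open>W\<^sup>1\<^sup>,\<^sup>p\<close>-norm to the
  \<open>L\<^sup>p\<close>-norm on the boundary, of the restriction to \<open>frontier \<Omega>\<close> of functions
  that are \<open>C\<^sup>1\<close> up to the boundary.\<close>

definition has_trace ::
  "(real^'n) set \<Rightarrow> real \<Rightarrow> (real^'n \<Rightarrow> real) \<Rightarrow> (real^'n \<Rightarrow> real) \<Rightarrow> bool" where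
  "has_trace \<Omega> p u g \<longleftrightarrow>
     u \<in> W1p \<Omega> p \<and> g \<in> Lp_on p (surface_measure \<Omega>) \<and>
     (\<exists>v. (\<forall>k::nat. v k \<in> C1_fun) \<and>
          (\<lambda>k. W1p_norm \<Omega> p (\<lambda>x. u x - v k x)) \<longlonglongrightarrow> 0 \<and>
          (\<lambda>k. \<integral>\<^sup>+x. ennreal (\<bar>v k x - g x\<bar> powr p) \<partial>surface_measure \<Omega>) \<longlonglongrightarrow> 0)"

definition zero_average_trace :: "(real^'n) set \<Rightarrow> real \<Rightarrow> (real^'n \<Rightarrow> real) \<Rightarrow> bool" where
  "zero_average_trace \<Omega> p u \<longleftrightarrow>
     (\<exists>g. has_trace \<Omega> p u g \<and> has_bochner_integral (surface_measure \<Omega>) g 0)"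

text \<open>The class of \<open>f\<close> in \<open>W\<^sup>1\<^sup>,\<^sup>p / W\<^sub>0\<^sup>1\<^sup>,\<^sup>p\<close>, which is also the set of all admissible \<open>u\<close>
  with boundary values \<open>f\<close>.\<close>

definition trace_class :: "(real^'n) set \<Rightarrow> real \<Rightarrow> (real^'n \<Rightarrow> real) \<Rightarrow> (real^'n \<Rightarrow> real) set" where
  "trace_class \<Omega> p f = {u \<in> W1p \<Omega> p. (\<lambda>x. u x - f x) \<in> W1p_0 \<Omega> p}"

definition trace_space :: "(real^'n) set \<Rightarrow> real \<Rightarrow> (real^'n \<Rightarrow> real) set set" where
  "trace_space \<Omega> p = trace_class \<Omega> p ` W1p \<Omega> p"

definition trace_space_diamond :: "(real^'n) set \<Rightarrow> real \<Rightarrow> (real^'n \<Rightarrow> real) set set" where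
  "trace_space_diamond \<Omega> p = {c \<in> trace_space \<Omega> p. \<exists>f\<in>c. zero_average_trace \<Omega> p f}"

definition trace_add ::
  "(real^'n \<Rightarrow> real) set \<Rightarrow> (real^'n \<Rightarrow> real) set \<Rightarrow> (real^'n \<Rightarrow> real) set" where
  "trace_add c d = {(\<lambda>x. u x + v x) | u v. u \<in> c \<and> v \<in> d}"

text \<open>The summand \<open>w\<close> makes the multiple by \<open>0\<close> the zero class, and not just \<open>{0}\<close>.\<close>

definition trace_scale ::
  "(real^'n) set \<Rightarrow> real \<Rightarrow> real \<Rightarrow> (real^'n \<Rightarrow> real) set \<Rightarrow> (real^'n \<Rightarrow> real) set" where
  "trace_scale \<Omega> p a c = {(\<lambda>x. a * u x + w x) | u w. u \<in> c \<and> w \<in> W1p_0 \<Omega> p}"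

definition trace_norm :: "(real^'n) set \<Rightarrow> real \<Rightarrow> (real^'n \<Rightarrow> real) set \<Rightarrow> real" where
  "trace_norm \<Omega> p c = (INF u\<in>c. W1p_norm \<Omega> p u)"


section \<open>Dirichlet energy and Dirichlet-to-Neumann operator\<close>

definition Q_density :: "('a \<Rightarrow> real \<Rightarrow> real) \<Rightarrow> 'a \<Rightarrow> real \<Rightarrow> real" where
  "Q_density \<sigma> x E = integral {0..E} (\<lambda>\<xi>. \<sigma> x \<xi> * \<xi>)"

definition dirichlet_energy ::
  "(real^'n) set \<Rightarrow> (real^'n \<Rightarrow> real \<Rightarrow> real) \<Rightarrow> (real^'n \<Rightarrow> real) \<Rightarrow> real" where
  "dirichlet_energy \<Omega> \<sigma> u = (LINT x|lebesgue_on \<Omega>. Q_density \<sigma> x (norm (weak_grad \<Omega> u x)))"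

text \<open>The minimizer of the energy in the class \<open>c\<close>, unique up to null sets of \<open>\<Omega>\<close>.\<close>

definition energy_minimizer ::
  "(real^'n) set \<Rightarrow> (real^'n \<Rightarrow> real \<Rightarrow> real) \<Rightarrow> (real^'n \<Rightarrow> real) set \<Rightarrow> real^'n \<Rightarrow> real" where
  "energy_minimizer \<Omega> \<sigma> c =
     (SOME u. u \<in> c \<and> (\<forall>v\<in>c. dirichlet_energy \<Omega> \<sigma> u \<le> dirichlet_energy \<Omega> \<sigma> v))"

text \<open>The pairing of \<open>\<Lambda>\<^sub>\<sigma>(c)\<close> with \<open>d\<close>; the value does not depend on the representative
  \<open>\<phi>\<close> of \<open>d\<close>.\<close>

definition DtN ::
  "(real^'n) set \<Rightarrow> (real^'n \<Rightarrow> real \<Rightarrow> real) \<Rightarrow>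
   (real^'n \<Rightarrow> real) set \<Rightarrow> (real^'n \<Rightarrow> real) set \<Rightarrow> real" where
  "DtN \<Omega> \<sigma> c d =
     (let Du = weak_grad \<Omega> (energy_minimizer \<Omega> \<sigma> c); \<phi> = (SOME \<phi>. \<phi> \<in> d)
      in LINT x|lebesgue_on \<Omega>. \<sigma> x (norm (Du x)) * (Du x \<bullet> weak_grad \<Omega> \<phi> x))"


section \<open>Gateaux derivative\<close>

text \<open>For a functional \<open>G\<close> on a normed space with carrier \<open>V\<close> and the given operations:
  all directional derivatives at \<open>f\<close> exist, and they are the values of the bounded
  linear functional \<open>D\<close>.\<close>

definition has_gateaux_derivative ::
  "'v set \<Rightarrow> ('v \<Rightarrow> 'v \<Rightarrow> 'v) \<Rightarrow> (real \<Rightarrow> 'v \<Rightarrow> 'v) \<Rightarrow> ('v \<Rightarrow> real) \<Rightarrow>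
   ('v \<Rightarrow> real) \<Rightarrow> 'v \<Rightarrow> ('v \<Rightarrow> real) \<Rightarrow> bool" where
  "has_gateaux_derivative V plus_V scale_V norm_V G f D \<longleftrightarrow>
     (\<forall>\<phi>\<in>V. ((\<lambda>\<epsilon>. (G (plus_V f (scale_V \<epsilon> \<phi>)) - G f) / \<epsilon>) \<longlongrightarrow> D \<phi>) (at 0)) \<and>
     (\<forall>\<phi>\<in>V. \<forall>\<psi>\<in>V. D (plus_V \<phi> \<psi>) = D \<phi> + D \<psi>) \<and>
     (\<forall>a. \<forall>\<phi>\<in>V. D (scale_V a \<phi>) = a * D \<phi>) \<and>
     (\<exists>C. \<forall>\<phi>\<in>V. \<bar>D \<phi>\<bar> \<le> C * norm_V \<phi>)"

end

theory Submission
  imports Defs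
begin

text \<open>Write \<open>A(x, a) = \<sigma>(x, \<bar>a\<bar>) a\<close> for the flux, so that \<open>A(x, a)\<close> is the gradient of the convex function
  \<open>a \<mapsto> Q(x, \<bar>a\<bar>)\<close>, let \<open>F\<close> be the energy, and let \<open>u\<close> and \<open>u\<^sub>\<epsilon>\<close> be the minimizers with boundary values
  \<open>f\<close> and \<open>f + \<epsilon> \<phi>\<close>. The difference \<open>F(u\<^sub>\<epsilon>) - F(u)\<close> is squeezed from both sides by convexity.

  From below, the subgradient inequality at \<open>u\<close> bounds it by the integral of
  \<open>A(x, \<nabla>u) \<bullet> (\<nabla>u\<^sub>\<epsilon> - \<nabla>u)\<close>. As \<open>u\<^sub>\<epsilon> - u - \<epsilon> \<phi>\<close> vanishes on the boundary, the Euler-Lagrange equation of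
  \<open>u\<close> turns this into \<open>\<epsilon>\<close> times the integral of \<open>A(x, \<nabla>u) \<bullet> \<nabla>\<phi>\<close>, which is the pairing of the
  Dirichlet-to-Neumann operator. From above, \<open>u + \<epsilon> \<phi>\<close> competes with \<open>u\<^sub>\<epsilon>\<close>, and the subgradient
  inequality at \<open>u + \<epsilon> \<phi>\<close> gives \<open>\<epsilon>\<close> times the integral of \<open>A(x, \<nabla>u + \<epsilon> \<nabla>\<phi>) \<bullet> \<nabla>\<phi>\<close>. The growth condition allows
  dominated convergence, so after division by \<open>\<epsilon>\<close> both bounds have the same limit
  (\<open>energy_minimizer_derivative\<close>). The same upper
  bound with a test function vanishing on the boundary proves the Euler-Lagrange equation.

  The minimizer is a choice, so its existence is part of the proof (\<open>minimizer_exists\<close>). Strong monotonicity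
  of the flux yields a quantitative midpoint convexity of the energy, which makes the gradients of a minimizing
  sequence Cauchy in \<open>L\<^sup>p\<close>; the Poincare inequality and the completeness of \<open>L\<^sup>p\<close> provide a limit in the
  same boundary class (\<open>coset_complete\<close>), and Fatou's lemma bounds its energy.

  Weak gradients are choices as well; that they are linear almost everywhere rests on their uniqueness, that is, on
  the fundamental lemma of the calculus of variations (\<open>AE_eq_0_of_C1_integrals\<close>). Integration by parts
  against \<open>C\<^sup>1\<close> functions, which also gives the Poincare inequality, comes from the translation invariance of Lebesgue
  measure (\<open>integral_gradient_eq_0\<close>).\<close>

section \<open>Functions with integrable p-th power\<close>

lemma powr_add_le:
  fixes a b p :: real
  assumes "0 \<le> a" "0 \<le> b" "0 \<le> p"
  shows "(a + b) powr p \<le> 2 powr p * (a powr p + b powr p)"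
proof -
  have "(a + b) powr p \<le> (2 * max a b) powr p"
    using assms by (intro powr_mono2) auto
  also have "\<dots> = 2 powr p * max a b powr p"
    using assms by (simp add: powr_mult)
  also have "\<dots> \<le> 2 powr p * (a powr p + b powr p)"
    by (intro mult_left_mono) (auto simp: max_def)
  finally show ?thesis .
qed

lemma norm_add_powr_le:
  fixes a b :: "'b::real_normed_vector"
  assumes "0 \<le> p"
  shows "norm (a + b) powr p \<le> 2 powr p * (norm a powr p + norm b powr p)"
proof -
  have "norm (a + b) powr p \<le> (norm a + norm b) powr p"
    using assms by (intro powr_mono2) (auto simp: norm_triangle_ineq)
  also have "\<dots> \<le> 2 powr p * (norm a powr p + norm b powr p)"
    using assms by (intro powr_add_le) auto
  finally show ?thesis .
qed

lemma Lp_on_measurable [measurable_dest]: "u \<in> Lp_on p M \<Longrightarrow> u \<in> borel_measurable M"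
  and Lp_on_integrable: "u \<in> Lp_on p M \<Longrightarrow> integrable M (\<lambda>x. norm (u x) powr p)"
  by (auto simp: Lp_on_def)

lemma Lp_on_add:
  fixes u v :: "'a \<Rightarrow> 'b::{banach, second_countable_topology}"
  assumes u: "u \<in> Lp_on p M" and v: "v \<in> Lp_on p M" and p: "0 \<le> p"
  shows "(\<lambda>x. u x + v x) \<in> Lp_on p M"
    and "(LINT x|M. norm (u x + v x) powr p)
           \<le> 2 powr p * ((LINT x|M. norm (u x) powr p) + (LINT x|M. norm (v x) powr p))"
proof -
  note [measurable] = Lp_on_measurable[OF u] Lp_on_measurable[OF v]
  note [simp] = Lp_on_integrable[OF u] Lp_on_integrable[OF v]
  have int: "integrable M (\<lambda>x. norm (u x + v x) powr p)"
    by (rule Bochner_Integration.integrable_bound[where f="\<lambda>x. 2 powr p * (norm (u x) powr p + norm (v x) powr p)"])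
      (use norm_add_powr_le[OF p] in auto)
  then show "(\<lambda>x. u x + v x) \<in> Lp_on p M"
    by (simp add: Lp_on_def)
  have "(LINT x|M. norm (u x + v x) powr p)
      \<le> (LINT x|M. 2 powr p * (norm (u x) powr p + norm (v x) powr p))"
    using int norm_add_powr_le[OF p] by (intro integral_mono) auto
  also have "\<dots> = 2 powr p * ((LINT x|M. norm (u x) powr p) + (LINT x|M. norm (v x) powr p))"
    by simp
  finally show "(LINT x|M. norm (u x + v x) powr p)
           \<le> 2 powr p * ((LINT x|M. norm (u x) powr p) + (LINT x|M. norm (v x) powr p))" .
qed

lemma Lp_on_scaleR:
  fixes u :: "'a \<Rightarrow> 'b::{banach, second_countable_topology}"
  assumes u: "u \<in> Lp_on p M"
  shows "(\<lambda>x. c *\<^sub>R u x) \<in> Lp_on p M"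
    and "(LINT x|M. norm (c *\<^sub>R u x) powr p) = \<bar>c\<bar> powr p * (LINT x|M. norm (u x) powr p)"
  using u by (auto simp: Lp_on_def powr_mult)

lemma Lp_on_diff:
  fixes u v :: "'a \<Rightarrow> 'b::{banach, second_countable_topology}"
  assumes u: "u \<in> Lp_on p M" and v: "v \<in> Lp_on p M" and p: "0 \<le> p"
  shows "(\<lambda>x. u x - v x) \<in> Lp_on p M"
  using Lp_on_add(1)[OF u Lp_on_scaleR(1)[OF v, of "-1"] p] by simp

text \<open>A subsequence whose successive differences have p-th power integrals below
  \<open>2\<^sup>-\<^sup>k 2\<^sup>-\<^sup>k\<^sup>p\<close> satisfies \<open>\<bar>u\<^sub>k\<^sub>+\<^sub>1 - u\<^sub>k\<bar> \<le> 2\<^sup>-\<^sup>k\<close> from some index on at almost every point, so it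
  converges almost everywhere. Fatou's lemma turns its limit into the limit of the whole
  sequence.\<close>

lemma Lp_on_complete:
  fixes u :: "nat \<Rightarrow> 'a \<Rightarrow> 'b::{banach, second_countable_topology}"
  assumes p: "0 < p" and u: "\<And>k. u k \<in> Lp_on p M"
    and Cauchy: "\<And>e. 0 < e \<Longrightarrow> \<exists>N. \<forall>k\<ge>N. \<forall>l\<ge>N. (LINT x|M. norm (u k x - u l x) powr p) < e"
  obtains v r where "v \<in> Lp_on p M" "(\<lambda>k. LINT x|M. norm (u k x - v x) powr p) \<longlonglongrightarrow> 0"
    "strict_mono (r :: nat \<Rightarrow> nat)" "AE x in M. (\<lambda>k. u (r k) x) \<longlonglongrightarrow> v x"
proof -
  note [measurable] = Lp_on_measurable[OF u]
  have diff_Lp: "(\<lambda>x. u k x - u l x) \<in> Lp_on p M" for k l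
    using Lp_on_diff[OF u u] p by simp
  note diff_int [simp] = Lp_on_integrable[OF diff_Lp]
  \<comment> \<open>After multiplication by \<open>(2 ^ k) powr p\<close> these bounds are still summable.\<close>
  define e where "e k = (1/2) ^ k / (2 ^ k) powr p" for k :: nat
  have e_pos: "0 < e k" for k
    by (simp add: e_def)
  have "\<exists>r. \<forall>k. (\<forall>i\<ge>r k. \<forall>j\<ge>r k. (LINT x|M. norm (u i x - u j x) powr p) < e k) \<and> r k < r (Suc k)"
  proof (rule dependent_nat_choice)
    show "\<exists>n. \<forall>i\<ge>n. \<forall>j\<ge>n. (LINT x|M. norm (u i x - u j x) powr p) < e 0"
      using Cauchy[OF e_pos] by blast
  next
    fix n k
    obtain N where N: "\<forall>i\<ge>N. \<forall>j\<ge>N. (LINT x|M. norm (u i x - u j x) powr p) < e (Suc k)"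
      using Cauchy[OF e_pos] by blast
    show "\<exists>m. (\<forall>i\<ge>m. \<forall>j\<ge>m. (LINT x|M. norm (u i x - u j x) powr p) < e (Suc k)) \<and> n < m"
      by (rule exI[of _ "max N (Suc n)"]) (use N in auto)
  qed
  then obtain r where r: "\<And>k i j. r k \<le> i \<Longrightarrow> r k \<le> j \<Longrightarrow> (LINT x|M. norm (u i x - u j x) powr p) < e k"
    and rSuc: "\<And>k. r k < r (Suc k)" by blast
  have mono: "strict_mono r"
    using rSuc by (simp add: strict_mono_Suc_iff)
  define d where "d k x = u (r (Suc k)) x - u (r k) x" for k x
  define g where "g k x = (2 ^ k) powr p * norm (d k x) powr p" for k x
  have [measurable]: "d k \<in> borel_measurable M" "g k \<in> borel_measurable M" for k
    unfolding d_def g_def by measurable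
  have g_int: "integrable M (g k)" for k
    unfolding g_def d_def by simp
  have g_le: "(LINT x|M. g k x) \<le> (1/2) ^ k" for k
  proof -
    have "(LINT x|M. norm (d k x) powr p) \<le> e k"
      unfolding d_def using r[of k "r (Suc k)" "r k"] rSuc[of k] by simp
    then have "(2 ^ k) powr p * (LINT x|M. norm (d k x) powr p) \<le> (2 ^ k) powr p * e k"
      by (intro mult_left_mono) auto
    then show ?thesis
      by (simp add: g_def[abs_def] e_def)
  qed
  have g_nn: "(\<integral>\<^sup>+x. ennreal (g k x) \<partial>M) \<le> ennreal ((1/2) ^ k)" for k
  proof (subst nn_integral_eq_integral)
    show "AE x in M. 0 \<le> g k x"
      by (simp add: g_def)
  qed (use g_int g_le in \<open>auto intro: ennreal_leI\<close>)
  have "(\<integral>\<^sup>+x. (\<Sum>k. ennreal (g k x)) \<partial>M) = (\<Sum>k. \<integral>\<^sup>+x. ennreal (g k x) \<partial>M)"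
    by (intro nn_integral_suminf) auto
  also have "\<dots> \<le> (\<Sum>k. ennreal ((1/2) ^ k))"
    using g_nn by (intro suminf_le) auto
  also have "\<dots> < \<infinity>"
    using summable_geometric[of "1/2::real"]
    by (subst suminf_ennreal2) auto
  finally have "AE x in M. (\<Sum>k. ennreal (g k x)) \<noteq> \<infinity>"
    by (intro nn_integral_noteq_infinite) auto
  then have conv: "AE x in M. convergent (\<lambda>k. u (r k) x)"
  proof eventually_elim
    case (elim x)
    have "summable (\<lambda>k. g k x)"
      using elim by (intro summable_suminf_not_top) (auto simp: g_def)
    then have "(\<lambda>k. g k x) \<longlonglongrightarrow> 0"
      by (rule summable_LIMSEQ_zero)
    then have "\<forall>\<^sub>F k in sequentially. g k x < 1"
      by (rule order_tendstoD) simp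
    then have "\<forall>\<^sub>F k in sequentially. norm (d k x) \<le> (1/2) ^ k"
    proof eventually_elim
      case (elim k)
      have "(2 ^ k * norm (d k x)) powr p < 1"
        using elim by (simp add: g_def powr_mult)
      then have "2 ^ k * norm (d k x) \<le> 1"
        using powr_less_mono2[OF p, of 1 "2 ^ k * norm (d k x)"] by fastforce
      then show ?case
        by (simp add: field_simps power_one_over)
    qed
    then have "summable (\<lambda>k. d k x)"
      by (rule summable_comparison_test_ev) (rule summable_geometric, simp)
    then have "convergent (\<lambda>n. \<Sum>k<n. d k x)"
      by (simp add: summable_iff_convergent)
    moreover have "(\<Sum>k<n. d k x) = u (r n) x - u (r 0) x" for n
      unfolding d_def using sum_lessThan_telescope[of "\<lambda>k. u (r k) x" n] by simp
    ultimately have "convergent (\<lambda>n. u (r n) x - u (r 0) x)"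
      by simp
    then show "convergent (\<lambda>k. u (r k) x)"
      by (simp only: convergent_diff_const_right_iff)
  qed
  define v where "v x = lim (\<lambda>k. u (r k) x)" for x
  have [measurable]: "v \<in> borel_measurable M"
    unfolding v_def by measurable
  have lim: "AE x in M. (\<lambda>k. u (r k) x) \<longlonglongrightarrow> v x"
    using conv unfolding v_def by eventually_elim (simp add: convergent_LIMSEQ_iff)
  have nn: "(\<integral>\<^sup>+x. ennreal (norm (u k x - v x) powr p) \<partial>M) \<le> ennreal \<delta>"
    if N: "\<forall>k\<ge>N. \<forall>l\<ge>N. (LINT x|M. norm (u k x - u l x) powr p) < \<delta>" and k: "k \<ge> N"
    for k N and \<delta> :: real
  proof -
    have "(\<integral>\<^sup>+x. ennreal (norm (u k x - v x) powr p) \<partial>M)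
        = (\<integral>\<^sup>+x. liminf (\<lambda>j. ennreal (norm (u k x - u (r j) x) powr p)) \<partial>M)"
    proof (rule nn_integral_cong_AE, use lim in eventually_elim)
      case (elim x)
      have "(\<lambda>j. ennreal (norm (u k x - u (r j) x) powr p)) \<longlonglongrightarrow> ennreal (norm (u k x - v x) powr p)"
        using p elim by (intro tendsto_ennrealI tendsto_powr' tendsto_intros) auto
      then show ?case
        by (rule lim_imp_Liminf[OF sequentially_bot, symmetric])
    qed
    also have "\<dots> \<le> liminf (\<lambda>j. \<integral>\<^sup>+x. ennreal (norm (u k x - u (r j) x) powr p) \<partial>M)"
      by (intro nn_integral_liminf) auto
    also have "\<dots> \<le> ennreal \<delta>"
    proof (rule Liminf_le)
      show "\<forall>\<^sub>F j in sequentially. (\<integral>\<^sup>+x. ennreal (norm (u k x - u (r j) x) powr p) \<partial>M) \<le> ennreal \<delta>"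
      proof (rule eventually_sequentiallyI)
        fix j assume "N \<le> j"
        then have "N \<le> r j"
          using seq_suble[OF mono, of j] by simp
        then have "(LINT x|M. norm (u k x - u (r j) x) powr p) \<le> \<delta>"
          using N k by (simp add: less_imp_le)
        then show "(\<integral>\<^sup>+x. ennreal (norm (u k x - u (r j) x) powr p) \<partial>M) \<le> ennreal \<delta>"
          by (subst nn_integral_eq_integral) (auto intro: ennreal_leI)
      qed
    qed simp
    finally show ?thesis .
  qed
  obtain N where N: "\<forall>k\<ge>N. \<forall>l\<ge>N. (LINT x|M. norm (u k x - u l x) powr p) < 1"
    using Cauchy[of 1] by auto
  have "(\<integral>\<^sup>+x. ennreal (norm (u N x - v x) powr p) \<partial>M) < \<infinity>"
    using nn[OF N order.refl] by (rule order.strict_trans1) simp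
  then have "(\<lambda>x. u N x - v x) \<in> Lp_on p M"
    unfolding Lp_on_def by (auto intro!: integrableI_nonneg)
  from Lp_on_diff[OF u[of N] this] p have v: "v \<in> Lp_on p M"
    by simp
  moreover have "(\<lambda>k. LINT x|M. norm (u k x - v x) powr p) \<longlonglongrightarrow> 0"
  proof (rule LIMSEQ_I)
    fix e :: real assume "0 < e"
    then obtain N where N: "\<forall>k\<ge>N. \<forall>l\<ge>N. (LINT x|M. norm (u k x - u l x) powr p) < e / 2"
      using Cauchy[of "e/2"] by auto
    have "norm ((LINT x|M. norm (u k x - v x) powr p) - 0) < e" if "k \<ge> N" for k
    proof -
      have "integrable M (\<lambda>x. norm (u k x - v x) powr p)"
        using Lp_on_integrable[OF Lp_on_diff[OF u v]] p by simp
      then have "ennreal (LINT x|M. norm (u k x - v x) powr p) \<le> ennreal (e / 2)"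
        using nn[OF N that] by (subst nn_integral_eq_integral[symmetric]) auto
      then show ?thesis
        using \<open>0 < e\<close> by (auto simp: ennreal_le_iff)
    qed
    then show "\<exists>N. \<forall>k\<ge>N. norm ((LINT x|M. norm (u k x - v x) powr p) - 0) < e"
      by blast
  qed
  ultimately show ?thesis
    using that mono lim by blast
qed

lemma le_add_powr:
  fixes t \<delta> p :: real
  assumes "0 \<le> t" "0 < \<delta>" "1 \<le> p"
  shows "t \<le> \<delta> + \<delta> powr (1 - p) * t powr p"
proof (cases "t \<le> \<delta>")
  case True
  then show ?thesis by (simp add: add_increasing2)
next
  case False
  then have "t = t powr (1 - p) * t powr p"
    using assms by (simp flip: powr_add)
  also have "\<dots> \<le> \<delta> powr (1 - p) * t powr p"
    using False assms by (intro mult_right_mono powr_mono2') auto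
  finally show ?thesis
    using assms by simp
qed

lemma Lp_on_imp_integrable:
  fixes u :: "'a \<Rightarrow> 'b::{banach, second_countable_topology}"
  assumes "finite_measure M" and u: "u \<in> Lp_on p M" and p: "1 \<le> p"
  shows "integrable M u"
proof -
  interpret finite_measure M by fact
  note [measurable] = Lp_on_measurable[OF u]
  show ?thesis
    by (rule Bochner_Integration.integrable_bound[where f="\<lambda>x. 1 + norm (u x) powr p"])
      (use le_add_powr[OF norm_ge_zero _ p, of 1] Lp_on_integrable[OF u] in auto)
qed

lemma Lp_tendsto_imp_L1_tendsto:
  fixes d :: "nat \<Rightarrow> 'a \<Rightarrow> 'b::{banach, second_countable_topology}"
  assumes "finite_measure M" and d: "\<And>k. d k \<in> Lp_on p M" and p: "1 \<le> p"
    and lim: "(\<lambda>k. LINT x|M. norm (d k x) powr p) \<longlonglongrightarrow> 0"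
  shows "(\<lambda>k. LINT x|M. norm (d k x)) \<longlonglongrightarrow> 0"
proof -
  interpret finite_measure M by fact
  have bound: "(LINT x|M. norm (d k x)) \<le> \<delta> * measure M (space M) + \<delta> powr (1 - p) * (LINT x|M. norm (d k x) powr p)"
    if "0 < \<delta>" for k \<delta>
  proof -
    have "(LINT x|M. norm (d k x)) \<le> (LINT x|M. \<delta> + \<delta> powr (1 - p) * norm (d k x) powr p)"
      using Lp_on_imp_integrable[OF assms(1) d p] Lp_on_integrable[OF d] le_add_powr[OF norm_ge_zero that p]
      by (intro integral_mono) auto
    also have "\<dots> = \<delta> * measure M (space M) + \<delta> powr (1 - p) * (LINT x|M. norm (d k x) powr p)"
      using Lp_on_integrable[OF d] by simp
    finally show ?thesis .
  qed
  show ?thesis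
  proof (rule LIMSEQ_I)
    fix e :: real assume e: "0 < e"
    define \<delta> where "\<delta> = e / (2 * (measure M (space M) + 1))"
    have \<delta>: "0 < \<delta>" using e by (auto simp: \<delta>_def intro!: divide_pos_pos add_nonneg_pos)
    have le: "\<delta> * measure M (space M) \<le> e / 2"
    proof -
      have "\<delta> * measure M (space M) \<le> \<delta> * (measure M (space M) + 1)"
        using \<delta> by simp
      also have "\<dots> = e / 2"
        using measure_nonneg[of M "space M"] by (simp add: \<delta>_def add_nonneg_eq_0_iff field_simps)
      finally show ?thesis .
    qed
    have "(\<lambda>k. \<delta> powr (1 - p) * (LINT x|M. norm (d k x) powr p)) \<longlonglongrightarrow> 0"
      using tendsto_mult_left[OF lim, of "\<delta> powr (1 - p)"] by simp
    then have "\<forall>\<^sub>F k in sequentially. \<delta> powr (1 - p) * (LINT x|M. norm (d k x) powr p) < e / 2"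
      using e by (intro order_tendstoD) auto
    then obtain N where N: "\<And>k. k \<ge> N \<Longrightarrow> \<delta> powr (1 - p) * (LINT x|M. norm (d k x) powr p) < e / 2"
      by (auto simp: eventually_sequentially)
    have "norm ((LINT x|M. norm (d k x)) - 0) < e" if "k \<ge> N" for k
      using bound[OF \<delta>, of k] N[OF that] le by simp
    then show "\<exists>N. \<forall>k\<ge>N. norm ((LINT x|M. norm (d k x)) - 0) < e" by blast
  qed
qed


section \<open>Continuously differentiable functions\<close>

lemma GDERIV_unique:
  assumes "GDERIV f x :> a" "GDERIV f x :> b"
  shows "a = b"
proof -
  have "(\<lambda>h. h \<bullet> a) = (\<lambda>h. h \<bullet> b)"
    using assms unfolding gderiv_def by (rule has_derivative_unique)
  then have "\<And>h. h \<bullet> a = h \<bullet> b"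
    by (rule fun_cong)
  then show ?thesis
    using vector_eq_ldot[of a b] by simp
qed

lemma C1_funE:
  assumes "\<phi> \<in> C1_fun"
  obtains g where "continuous_on UNIV g" "\<And>x. GDERIV \<phi> x :> g x"
  using assms by (auto simp: C1_fun_def)

lemma C1_funI: "continuous_on UNIV g \<Longrightarrow> (\<And>x. GDERIV \<phi> x :> g x) \<Longrightarrow> \<phi> \<in> C1_fun"
  by (auto simp: C1_fun_def)

lemma GDERIV_continuous:
  assumes "\<And>x. GDERIV \<phi> x :> g x"
  shows "continuous_on UNIV \<phi>"
  using assms unfolding gderiv_def
  by (intro continuous_at_imp_continuous_on ballI) (rule has_derivative_continuous)

lemma C1_fun_continuous: "\<phi> \<in> C1_fun \<Longrightarrow> continuous_on UNIV \<phi>"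
  by (metis C1_funE GDERIV_continuous)

lemma C1_fun_const: "(\<lambda>x. c) \<in> C1_fun"
  by (rule C1_funI[of "\<lambda>x. 0"]) (auto simp: GDERIV_const)

lemma C1_fun_add:
  assumes "\<phi> \<in> C1_fun" "\<psi> \<in> C1_fun"
  shows "(\<lambda>x. \<phi> x + \<psi> x) \<in> C1_fun"
proof -
  obtain f where f: "continuous_on UNIV f" "\<And>x. GDERIV \<phi> x :> f x"
    by (rule C1_funE[OF assms(1)]) (rule that)
  obtain g where g: "continuous_on UNIV g" "\<And>x. GDERIV \<psi> x :> g x"
    by (rule C1_funE[OF assms(2)]) (rule that)
  show ?thesis
    by (rule C1_funI[OF continuous_on_add[OF f(1) g(1)] GDERIV_add[OF f(2) g(2)]])
qed

lemma C1_fun_mult: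
  assumes "\<phi> \<in> C1_fun" "\<psi> \<in> C1_fun"
  shows "(\<lambda>x. \<phi> x * \<psi> x) \<in> C1_fun"
proof -
  obtain f where f: "continuous_on UNIV f" "\<And>x. GDERIV \<phi> x :> f x"
    by (rule C1_funE[OF assms(1)]) (rule that)
  obtain g where g: "continuous_on UNIV g" "\<And>x. GDERIV \<psi> x :> g x"
    by (rule C1_funE[OF assms(2)]) (rule that)
  show ?thesis
  proof (rule C1_funI[OF _ GDERIV_mult[OF f(2) g(2)]])
    show "continuous_on UNIV (\<lambda>x. \<phi> x *\<^sub>R g x + \<psi> x *\<^sub>R f x)"
      using f(1) g(1) C1_fun_continuous[OF assms(1)] C1_fun_continuous[OF assms(2)]
      by (intro continuous_intros)
  qed
qed

lemma C1_fun_prod: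
  assumes "finite I" "\<And>i. i \<in> I \<Longrightarrow> \<phi> i \<in> C1_fun"
  shows "(\<lambda>x. \<Prod>i\<in>I. \<phi> i x) \<in> C1_fun"
  using assms by (induction I rule: finite_induct) (auto intro: C1_fun_const C1_fun_mult)

lemma C1_fun_compose:
  assumes "\<phi> \<in> C1_fun" and h: "\<And>t. DERIV h t :> h' t" and h': "continuous_on UNIV h'"
  shows "(\<lambda>x. h (\<phi> x)) \<in> C1_fun"
proof -
  obtain g where g: "continuous_on UNIV g" "\<And>x. GDERIV \<phi> x :> g x"
    by (rule C1_funE[OF assms(1)]) (rule that)
  show ?thesis
  proof (rule C1_funI)
    show "GDERIV (\<lambda>x. h (\<phi> x)) x :> h' (\<phi> x) *\<^sub>R g x" for x
      by (rule GDERIV_DERIV_compose[OF g(2) h])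
    show "continuous_on UNIV (\<lambda>x. h' (\<phi> x) *\<^sub>R g x)"
      using C1_fun_continuous[OF assms(1)] g(1)
      by (intro continuous_on_scaleR continuous_on_compose2[OF h']) auto
  qed
qed

lemma GDERIV_inner_left: "GDERIV (\<lambda>x. x \<bullet> e) x :> e"
  unfolding gderiv_def by (auto intro!: derivative_eq_intros)

lemma C1_fun_inner: "(\<lambda>x. x \<bullet> e) \<in> C1_fun"
  by (rule C1_funI[of "\<lambda>x. e"]) (auto simp: GDERIV_inner_left)

lemma DERIV_pos_part_powr:
  fixes p :: real
  assumes p: "1 < p"
  shows "DERIV (\<lambda>t. max 0 t powr p) t :> p * max 0 t powr (p - 1)"
proof -
  consider "t < 0" | "t = 0" | "t > 0" by linarith
  then show ?thesis
  proof cases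
    case 1
    have "DERIV (\<lambda>t. 0) t :> p * max 0 t powr (p - 1)"
      using 1 p by simp
    then show ?thesis
      by (rule has_field_derivative_transform_within_open[of _ _ _ "{..<0}"]) (use 1 in \<open>auto simp: max_def\<close>)
  next
    case 2
    have "((\<lambda>h. max 0 h powr p / h) \<longlongrightarrow> 0) (at 0)"
    proof (rule Lim_null_comparison)
      show "\<forall>\<^sub>F h in at (0::real). norm (max 0 h powr p / h) \<le> \<bar>h\<bar> powr (p - 1)"
      proof (rule always_eventually, rule allI)
        fix h :: real
        show "norm (max 0 h powr p / h) \<le> \<bar>h\<bar> powr (p - 1)"
        proof (cases "h > 0")
          case True
          then show ?thesis by (simp add: powr_diff)
        next
          case False
          then have "max 0 h = 0" by simp
          then show ?thesis by simp
        qed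
      qed
      have "((\<lambda>h::real. \<bar>h\<bar> powr (p - 1)) \<longlongrightarrow> \<bar>0\<bar> powr (p - 1)) (at 0)"
        using p by (intro tendsto_powr' tendsto_intros) auto
      then show "((\<lambda>h::real. \<bar>h\<bar> powr (p - 1)) \<longlongrightarrow> 0) (at 0)"
        using p by simp
    qed
    then show ?thesis
      using 2 p by (simp add: DERIV_def)
  next
    case 3
    have "DERIV (\<lambda>t. t powr p) t :> p * t powr (p - 1)"
      using 3 by (rule has_real_derivative_powr)
    then have "DERIV (\<lambda>t. t powr p) t :> p * max 0 t powr (p - 1)"
      using 3 by simp
    then show ?thesis
      by (rule has_field_derivative_transform_within_open[of _ _ _ "{0<..}"]) (use 3 in auto)
  qed
qed

lemma continuous_on_pos_part_powr:
  fixes f :: "'a::topological_space \<Rightarrow> real"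
  assumes "0 < q" "continuous_on S f"
  shows "continuous_on S (\<lambda>t. max 0 (f t) powr q)"
  using assms by (intro continuous_on_powr' continuous_intros) auto

lemma continuous_on_norm_powr:
  fixes f :: "'a::topological_space \<Rightarrow> 'b::real_normed_vector"
  assumes "0 < q" "continuous_on S f"
  shows "continuous_on S (\<lambda>t. norm (f t) powr q)"
  using assms by (intro continuous_on_powr' continuous_intros) auto

text \<open>Positive parts make the derivative of \<open>\<bar>t\<bar> powr p\<close> an expression whose continuity at \<open>0\<close> is
  evident.\<close>

lemma abs_powr_eq_pos_parts: "\<bar>t\<bar> powr p = max 0 t powr p + max 0 (- t) powr p" for t p :: real
  by (cases "t \<ge> 0") (auto simp: max_def)

lemma DERIV_abs_powr:
  fixes p :: real
  assumes p: "1 < p"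
  shows "DERIV (\<lambda>t. \<bar>t\<bar> powr p) t :> p * (max 0 t powr (p - 1) - max 0 (- t) powr (p - 1))"
proof -
  have "DERIV (\<lambda>t. max 0 (- t) powr p) t :> p * max 0 (- t) powr (p - 1) * (- 1)"
    by (rule DERIV_chain2[OF DERIV_pos_part_powr[OF p]]) (auto intro!: derivative_eq_intros)
  from DERIV_add[OF DERIV_pos_part_powr[OF p] this] show ?thesis
    by (simp add: abs_powr_eq_pos_parts algebra_simps)
qed

text \<open>The square of the positive part of an affine function is C1, and a product of such squares is positive
  exactly where all the inequalities that define the box are strict.\<close>

lemma box_bump:
  fixes a b :: "real^'n"
  obtains \<psi> where "\<psi> \<in> C1_fun" "\<And>x. 0 \<le> \<psi> x" "{x. \<psi> x \<noteq> 0} = box a b"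
proof
  define \<psi> where "\<psi> x = (\<Prod>i\<in>Basis. max 0 ((x - a) \<bullet> i) powr 2 * max 0 ((b - x) \<bullet> i) powr 2)"
    for x :: "real^'n"
  have pp: "(\<lambda>x. max 0 (f x) powr 2) \<in> C1_fun" if "f \<in> C1_fun" for f :: "real^'n \<Rightarrow> real"
  proof (rule C1_fun_compose[OF that DERIV_pos_part_powr])
    show "continuous_on UNIV (\<lambda>t::real. 2 * max 0 t powr (2 - 1))"
      by (intro continuous_intros continuous_on_pos_part_powr) auto
  qed simp
  have 1: "(\<lambda>x. (x - a) \<bullet> i) \<in> C1_fun" for i
    using C1_fun_add[OF C1_fun_inner C1_fun_const[of "- (a \<bullet> i)"], of i]
    by (simp add: inner_diff_left)
  have 2: "(\<lambda>x. (b - x) \<bullet> i) \<in> C1_fun" for i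
    using C1_fun_add[OF C1_fun_inner C1_fun_const[of "b \<bullet> i"], of "- i"]
    by (simp add: inner_diff_left)
  show "\<psi> \<in> C1_fun"
    unfolding \<psi>_def by (intro C1_fun_prod C1_fun_mult pp 1 2) auto
  show "0 \<le> \<psi> x" for x
    unfolding \<psi>_def by (intro prod_nonneg) auto
  show "{x. \<psi> x \<noteq> 0} = box a b"
    by (auto simp: \<psi>_def box_def inner_diff_left max_def not_le)
qed


section \<open>Integration by parts against compactly supported functions\<close>

lemma integrable_continuous_compact_support:
  fixes h :: "'a::euclidean_space \<Rightarrow> 'b::{banach, second_countable_topology}"
  assumes "continuous_on UNIV h" "compact K" "\<And>x. x \<notin> K \<Longrightarrow> h x = 0"
  shows "integrable lborel h"
proof -
  have "integrable lborel (\<lambda>x. indicator K x *\<^sub>R h x)"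
    using assms(1,2) by (intro borel_integrable_compact) (auto intro: continuous_on_subset)
  moreover have "(\<lambda>x. indicator K x *\<^sub>R h x) = h"
    using assms(3) by (auto simp: indicator_def)
  ultimately show ?thesis by simp
qed

lemma continuous_compact_support_bounded:
  fixes h :: "'a::euclidean_space \<Rightarrow> 'b::real_normed_vector"
  assumes "continuous_on UNIV h" "compact K" "\<And>x. x \<notin> K \<Longrightarrow> h x = 0"
  obtains B where "0 < B" "\<And>x. norm (h x) \<le> B"
proof -
  have "bounded (h ` K)"
    using assms(1,2) by (intro compact_imp_bounded compact_continuous_image) (auto intro: continuous_on_subset)
  then obtain B where B: "0 < B" "\<And>x. x \<in> K \<Longrightarrow> norm (h x) \<le> B"
    by (auto simp: bounded_pos)
  have "norm (h x) \<le> B" for x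
    using B assms(3)[of x] by (cases "x \<in> K") auto
  with B(1) show ?thesis using that by blast
qed

lemma lborel_integral_translation:
  fixes h :: "'a::euclidean_space \<Rightarrow> 'b::{banach, second_countable_topology}"
  assumes [measurable]: "h \<in> borel_measurable borel"
  shows "(LINT x|lborel. h (x + c)) = (LINT x|lborel. h x)"
    and "integrable lborel h \<Longrightarrow> integrable lborel (\<lambda>x. h (x + c))"
proof -
  have "(LINT x|lborel. h x) = (LINT x|distr lborel borel ((+) c). h x)"
    by (simp add: lborel_distr_plus)
  also have "\<dots> = (LINT x|lborel. h (c + x))"
    by (rule integral_distr) auto
  finally show "(LINT x|lborel. h (x + c)) = (LINT x|lborel. h x)"
    by (simp add: add.commute)
  assume "integrable lborel h"
  then have "integrable (distr lborel borel ((+) c)) h"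
    by (simp add: lborel_distr_plus)
  then have "integrable lborel (\<lambda>x. h (c + x))"
    by (subst (asm) integrable_distr_eq) auto
  then show "integrable lborel (\<lambda>x. h (x + c))"
    by (simp add: add.commute)
qed

text \<open>The complement of a closed set is a neighbourhood of each of its points, so the function is locally
  constant there.\<close>

lemma GDERIV_zero_off_support:
  assumes "closed K" "\<And>x. x \<notin> K \<Longrightarrow> \<phi> x = 0" "x \<notin> K" "GDERIV \<phi> x :> g"
  shows "g = 0"
proof -
  have "GDERIV \<phi> x :> 0"
    unfolding gderiv_def
    by (rule has_derivative_transform_within_open[of "\<lambda>x. 0" _ _ _ "- K"]) (use assms in auto)
  with assms(4) show ?thesis by (rule GDERIV_unique)
qed

text \<open>Translation invariance makes the integrals of all difference quotients of a compactly
  supported function vanish, and the quotients converge dominatedly to a directional derivative.\<close>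

lemma integral_gradient_eq_0:
  fixes \<phi> :: "'a::euclidean_space \<Rightarrow> real"
  assumes g: "continuous_on UNIV g" "\<And>x. GDERIV \<phi> x :> g x"
    and K: "compact K" "\<And>x. x \<notin> K \<Longrightarrow> \<phi> x = 0"
  shows "(LINT x|lborel. g x) = 0"
proof -
  have g0: "g x = 0" if "x \<notin> K" for x
    using GDERIV_zero_off_support[OF compact_imp_closed[OF K(1)] K(2) that g(2)] .
  have cont: "continuous_on UNIV \<phi>"
    using g(2) by (rule GDERIV_continuous)
  obtain B where B: "0 < B" "\<And>x. norm (g x) \<le> B"
    using continuous_compact_support_bounded[OF g(1) K(1) g0] by blast
  have g_int: "integrable lborel g"
    using integrable_continuous_compact_support[OF g(1) K(1) g0] .
  have \<phi>_int: "integrable lborel \<phi>"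
    using integrable_continuous_compact_support[OF cont K] .
  have [measurable]: "\<phi> \<in> borel_measurable borel" "g \<in> borel_measurable borel"
    using cont g(1) by (auto intro: borel_measurable_continuous_onI)
  have lip: "\<bar>\<phi> x - \<phi> y\<bar> \<le> B * norm (x - y)" for x y
  proof -
    have "norm (\<phi> x - \<phi> y) \<le> B * norm (x - y)"
    proof (rule differentiable_bound[where S=UNIV])
      show "(\<phi> has_derivative (\<lambda>h. h \<bullet> g x)) (at x)" for x
        using g(2) by (simp add: gderiv_def)
      show "onorm (\<lambda>h. h \<bullet> g x) \<le> B" for x
      proof (rule onorm_le)
        fix h
        have "norm (h \<bullet> g x) \<le> norm h * norm (g x)"
          by (simp add: Cauchy_Schwarz_ineq2)
        also have "\<dots> \<le> norm h * B"
          by (intro mult_left_mono B) auto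
        finally show "norm (h \<bullet> g x) \<le> B * norm h" by (simp add: mult.commute)
      qed
    qed auto
    then show ?thesis by simp
  qed
  obtain R where R: "\<And>x. x \<in> K \<Longrightarrow> norm x \<le> R"
    using compact_imp_bounded[OF K(1)] by (auto simp: bounded_iff)
  have "(LINT x|lborel. g x \<bullet> e) = 0" for e
  proof -
    define t where "t k = 1 / real (Suc k)" for k
    have t: "0 < t k" "t k \<le> 1" for k
      by (auto simp: t_def)
    have t0: "t \<longlonglongrightarrow> 0"
      unfolding t_def by (rule LIMSEQ_Suc[OF lim_1_over_n])
    have "(\<lambda>k. LINT x|lborel. (\<phi> (x + t k *\<^sub>R e) - \<phi> x) / t k) \<longlonglongrightarrow> (LINT x|lborel. g x \<bullet> e)"
    proof (rule integral_dominated_convergence[where w="\<lambda>x. B * norm e * indicator (cball 0 (R + norm e)) x"])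
      show "integrable lborel (\<lambda>x::'a. B * norm e * indicator (cball 0 (R + norm e)) x)"
        by (intro integrable_mult_right integrable_real_indicator) (use emeasure_bounded_finite[OF bounded_cball] in auto)
      show "AE x in lborel. (\<lambda>k. (\<phi> (x + t k *\<^sub>R e) - \<phi> x) / t k) \<longlonglongrightarrow> g x \<bullet> e"
      proof (rule AE_I2)
        fix x
        have "((\<lambda>s. \<phi> (x + s *\<^sub>R e)) has_derivative (\<lambda>h. (h *\<^sub>R e) \<bullet> g x)) (at 0)"
          by (rule has_derivative_compose[of "\<lambda>s. x + s *\<^sub>R e" _ _ _ \<phi>])
            (use g(2)[of x] in \<open>auto intro!: derivative_eq_intros simp: gderiv_def\<close>)
        then have "DERIV (\<lambda>s. \<phi> (x + s *\<^sub>R e)) 0 :> g x \<bullet> e"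
          unfolding has_field_derivative_def by (simp add: inner_commute mult_commute_abs)
        then have "((\<lambda>s. (\<phi> (x + s *\<^sub>R e) - \<phi> x) / s) \<longlongrightarrow> g x \<bullet> e) (at 0)"
          by (simp add: DERIV_def)
        then show "(\<lambda>k. (\<phi> (x + t k *\<^sub>R e) - \<phi> x) / t k) \<longlonglongrightarrow> g x \<bullet> e"
          by (rule filterlim_compose) (use t t0 in \<open>auto simp: filterlim_at less_imp_neq[symmetric]\<close>)
      qed
      show "AE x in lborel. norm ((\<phi> (x + t k *\<^sub>R e) - \<phi> x) / t k)
              \<le> B * norm e * indicator (cball 0 (R + norm e)) x" for k
      proof (rule AE_I2)
        fix x
        show "norm ((\<phi> (x + t k *\<^sub>R e) - \<phi> x) / t k)
              \<le> B * norm e * indicator (cball 0 (R + norm e)) x"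
        proof (cases "norm x \<le> R + norm e")
          case True
          have "\<bar>\<phi> (x + t k *\<^sub>R e) - \<phi> x\<bar> \<le> B * norm (t k *\<^sub>R e)"
            using lip[of "x + t k *\<^sub>R e" x] by simp
          then show ?thesis
            using True t[of k] by (simp add: field_simps)
        next
          case False
          have "norm (t k *\<^sub>R e) \<le> norm e"
            using t[of k] by (simp add: mult_left_le_one_le)
          moreover have "norm x \<le> norm (x + t k *\<^sub>R e) + norm (t k *\<^sub>R e)"
            by (metis add_diff_cancel_right' norm_triangle_ineq4)
          ultimately have "\<not> norm (x + t k *\<^sub>R e) \<le> R" "\<not> norm x \<le> R"
            using False norm_ge_zero[of e] by linarith+
          then have "x + t k *\<^sub>R e \<notin> K" "x \<notin> K"
            using R by blast+
          then show ?thesis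
            using K(2) B(1) by simp
        qed
      qed
    qed auto
    moreover have "(LINT x|lborel. (\<phi> (x + t k *\<^sub>R e) - \<phi> x) / t k) = 0" for k
      using lborel_integral_translation[of \<phi> "t k *\<^sub>R e"] \<phi>_int by simp
    ultimately have "(\<lambda>k. 0) \<longlonglongrightarrow> (LINT x|lborel. g x \<bullet> e)"
      by (simp only:)
    then show ?thesis
      by (simp add: LIMSEQ_const_iff)
  qed
  then have "(LINT x|lborel. g x) \<bullet> e = 0" for e
    using integral_inner_left[of e lborel g] g_int by simp
  then show ?thesis
    by (metis inner_eq_zero_iff)
qed

lemma lebesgue_on_eq_lborel:
  fixes h :: "'a::euclidean_space \<Rightarrow> 'b::{banach, second_countable_topology}"
  assumes "h \<in> borel_measurable borel" "\<And>x. x \<notin> \<Omega> \<Longrightarrow> h x = 0" "\<Omega> \<in> sets lebesgue"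
  shows "(LINT x|lebesgue_on \<Omega>. h x) = (LINT x|lborel. h x)"
    and "integrable lborel h \<Longrightarrow> integrable (lebesgue_on \<Omega>) h"
proof -
  have eq: "(\<lambda>x. indicator \<Omega> x *\<^sub>R h x) = h"
    using assms(2) by (auto simp: indicator_def)
  show "(LINT x|lebesgue_on \<Omega>. h x) = (LINT x|lborel. h x)"
    using assms by (simp add: integral_restrict_space eq integral_completion)
  show "integrable lborel h \<Longrightarrow> integrable (lebesgue_on \<Omega>) h"
    using assms by (simp add: integrable_restrict_space eq integrable_completion)
qed

lemma C1_0E:
  assumes "\<phi> \<in> C1_0 \<Omega>"
  obtains g K where "continuous_on UNIV g" "\<And>x. GDERIV \<phi> x :> g x" "continuous_on UNIV \<phi>"
    "compact K" "K \<subseteq> \<Omega>" "\<And>x. x \<notin> K \<Longrightarrow> \<phi> x = 0" "\<And>x. x \<notin> K \<Longrightarrow> g x = 0"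
proof -
  obtain g where g: "continuous_on UNIV g" "\<And>x. GDERIV \<phi> x :> g x"
    by (rule C1_funE[of \<phi>]) (use assms in \<open>simp add: C1_0_def\<close>, rule that)
  define K where "K = closure {x. \<phi> x \<noteq> 0}"
  have K: "compact K" "K \<subseteq> \<Omega>"
    using assms by (auto simp: C1_0_def K_def)
  have \<phi>0: "\<phi> x = 0" if "x \<notin> K" for x
    using that closure_subset[of "{x. \<phi> x \<noteq> 0}"] by (auto simp: K_def)
  have "g x = 0" if "x \<notin> K" for x
    using GDERIV_zero_off_support[OF compact_imp_closed[OF K(1)] \<phi>0 that g(2)] .
  then show ?thesis
    using that[OF g GDERIV_continuous[OF g(2)] K \<phi>0] by blast
qed

lemma C1_0_supportE:
  assumes "\<phi> \<in> C1_0 \<Omega>"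
  obtains K where "compact K" "K \<subseteq> \<Omega>" "\<And>x. x \<notin> K \<Longrightarrow> \<phi> x = 0"
  by (rule C1_0E[OF assms]) (rule that)

lemma C1_0I:
  assumes "\<phi> \<in> C1_fun" "compact K" "K \<subseteq> \<Omega>" "\<And>x. x \<notin> K \<Longrightarrow> \<phi> x = 0"
  shows "\<phi> \<in> C1_0 \<Omega>"
proof -
  have "closure {x. \<phi> x \<noteq> 0} \<subseteq> K"
    using assms(2,4) by (intro closure_minimal) (auto intro: compact_imp_closed)
  then show ?thesis
    using assms(1-3) bounded_subset[OF compact_imp_bounded[OF assms(2)], of "{x. \<phi> x \<noteq> 0}"]
      closure_subset[of "{x. \<phi> x \<noteq> 0}"] by (auto simp: C1_0_def)
qed

lemma C1_0_add:
  assumes "\<phi> \<in> C1_0 \<Omega>" "\<psi> \<in> C1_0 \<Omega>"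
  shows "(\<lambda>x. \<phi> x + \<psi> x) \<in> C1_0 \<Omega>"
proof -
  obtain K where "compact K" "K \<subseteq> \<Omega>" "\<And>x. x \<notin> K \<Longrightarrow> \<phi> x = 0"
    by (rule C1_0_supportE[OF assms(1)]) (rule that)
  moreover obtain L where "compact L" "L \<subseteq> \<Omega>" "\<And>x. x \<notin> L \<Longrightarrow> \<psi> x = 0"
    by (rule C1_0_supportE[OF assms(2)]) (rule that)
  moreover have "(\<lambda>x. \<phi> x + \<psi> x) \<in> C1_fun"
    using assms by (auto simp: C1_0_def intro: C1_fun_add)
  ultimately show ?thesis
    by (intro C1_0I[of _ "K \<union> L"]) auto
qed

lemma C1_0_mult:
  assumes "\<phi> \<in> C1_fun" "\<psi> \<in> C1_0 \<Omega>"
  shows "(\<lambda>x. \<phi> x * \<psi> x) \<in> C1_0 \<Omega>"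
proof -
  obtain L where "compact L" "L \<subseteq> \<Omega>" "\<And>x. x \<notin> L \<Longrightarrow> \<psi> x = 0"
    by (rule C1_0_supportE[OF assms(2)]) (rule that)
  moreover have "(\<lambda>x. \<phi> x * \<psi> x) \<in> C1_fun"
    using assms by (auto simp: C1_0_def intro: C1_fun_mult)
  ultimately show ?thesis
    by (intro C1_0I[of _ L]) auto
qed

lemma C1_0_const_mult: "\<psi> \<in> C1_0 \<Omega> \<Longrightarrow> (\<lambda>x. c * \<psi> x) \<in> C1_0 \<Omega>"
  using C1_0_mult[OF C1_fun_const] .

lemma locally_integrable_on_continuous:
  fixes h :: "real^'n \<Rightarrow> 'b::{banach, second_countable_topology}"
  assumes "continuous_on UNIV h"
  shows "locally_integrable_on \<Omega> h"
  unfolding locally_integrable_on_def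
proof (intro allI impI)
  fix K assume "compact K \<and> K \<subseteq> \<Omega>"
  then have K: "compact K" "K \<in> sets lebesgue"
    by (auto intro: lmeasurable_compact fmeasurableD)
  have [measurable]: "h \<in> borel_measurable borel"
    using assms by (rule borel_measurable_continuous_onI)
  have [measurable]: "K \<in> sets borel"
    using K(1) by (intro borel_compact)
  show "integrable (lebesgue_on K) h"
    using K borel_integrable_compact[OF K(1) continuous_on_subset[OF assms]]
    by (simp add: integrable_restrict_space integrable_completion)
qed

text \<open>The product of two test functions is a test function, and its gradient integrates to \<open>0\<close>.\<close>

lemma C1_0_has_weak_grad:
  assumes \<Omega>: "\<Omega> \<in> sets lebesgue" and \<phi>: "\<phi> \<in> C1_0 \<Omega>"
    and g: "continuous_on UNIV g" "\<And>x. GDERIV \<phi> x :> g x"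
  shows "has_weak_grad \<Omega> \<phi> g"
  unfolding has_weak_grad_def
proof (intro conjI ballI allI impI)
  have cont: "continuous_on UNIV \<phi>"
    using g(2) by (rule GDERIV_continuous)
  show "locally_integrable_on \<Omega> \<phi>" "locally_integrable_on \<Omega> g"
    using cont g(1) by (auto intro: locally_integrable_on_continuous)
  fix \<psi> f assume \<psi>: "\<psi> \<in> C1_0 \<Omega>" and f: "\<forall>x. GDERIV \<psi> x :> f x"
  obtain f' K where f': "continuous_on UNIV f'" "\<And>x. GDERIV \<psi> x :> f' x" "continuous_on UNIV \<psi>"
    and K: "compact K" "K \<subseteq> \<Omega>" "\<And>x. x \<notin> K \<Longrightarrow> \<psi> x = 0" "\<And>x. x \<notin> K \<Longrightarrow> f' x = 0"
    by (rule C1_0E[OF \<psi>]) (rule that)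
  have "f = f'"
    using f f'(2) by (auto intro: GDERIV_unique)
  have 1: "continuous_on UNIV (\<lambda>x. \<phi> x *\<^sub>R f' x)" "continuous_on UNIV (\<lambda>x. \<psi> x *\<^sub>R g x)"
    using cont g(1) f' by (auto intro!: continuous_intros)
  have int: "integrable lborel (\<lambda>x. \<phi> x *\<^sub>R f' x)" "integrable lborel (\<lambda>x. \<psi> x *\<^sub>R g x)"
    using 1 K by (auto intro!: integrable_continuous_compact_support)
  have "(LINT x|lborel. \<phi> x *\<^sub>R f' x + \<psi> x *\<^sub>R g x) = 0"
  proof (rule integral_gradient_eq_0[OF _ _ K(1), of _ "\<lambda>x. \<phi> x * \<psi> x"])
    show "continuous_on UNIV (\<lambda>x. \<phi> x *\<^sub>R f' x + \<psi> x *\<^sub>R g x)"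
      using 1 by (rule continuous_on_add)
  qed (auto intro: GDERIV_mult g f' simp: K)
  then have "(LINT x|lborel. \<phi> x *\<^sub>R f' x) = - (LINT x|lborel. \<psi> x *\<^sub>R g x)"
    using int by (simp add: eq_neg_iff_add_eq_0)
  moreover have "(LINT x|lebesgue_on \<Omega>. \<phi> x *\<^sub>R f' x) = (LINT x|lborel. \<phi> x *\<^sub>R f' x)"
    using 1(1) K \<Omega> by (intro lebesgue_on_eq_lborel) (auto intro: borel_measurable_continuous_onI)
  moreover have "(LINT x|lebesgue_on \<Omega>. \<psi> x *\<^sub>R g x) = (LINT x|lborel. \<psi> x *\<^sub>R g x)"
    using 1(2) K \<Omega> by (intro lebesgue_on_eq_lborel) (auto intro: borel_measurable_continuous_onI)
  ultimately show "(LINT x|lebesgue_on \<Omega>. \<phi> x *\<^sub>R f x) = - (LINT x|lebesgue_on \<Omega>. \<psi> x *\<^sub>R g x)"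
    using \<open>f = f'\<close> by simp
qed

lemma continuous_compact_support_Lp_on:
  fixes h :: "real^'n \<Rightarrow> 'b::{banach, second_countable_topology}"
  assumes \<Omega>: "\<Omega> \<in> sets lebesgue" and h: "continuous_on UNIV h" and p: "0 < p"
    and K: "compact K" "K \<subseteq> \<Omega>" "\<And>x. x \<notin> K \<Longrightarrow> h x = 0"
  shows "h \<in> Lp_on p (lebesgue_on \<Omega>)"
proof -
  have c: "continuous_on UNIV (\<lambda>x. norm (h x) powr p)"
    using p h by (rule continuous_on_norm_powr)
  have "integrable (lebesgue_on \<Omega>) (\<lambda>x. norm (h x) powr p)"
    using c K \<Omega> p
    by (intro lebesgue_on_eq_lborel(2) integrable_continuous_compact_support[OF c K(1)])
      (auto intro: borel_measurable_continuous_onI)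
  moreover have "h \<in> borel_measurable (lebesgue_on \<Omega>)"
    using h by (intro measurable_restrict_space1 measurable_completion) (auto intro: borel_measurable_continuous_onI)
  ultimately show ?thesis
    by (simp add: Lp_on_def)
qed

lemma powr_mult_le_Young:
  fixes a b \<delta> p :: real
  assumes "0 \<le> a" "0 \<le> b" "0 < \<delta>" "1 < p"
  shows "a powr (p - 1) * b \<le> \<delta> * a powr p + \<delta> powr (1 - p) * b powr p"
proof (cases "b \<le> \<delta> * a")
  case True
  then have "a powr (p - 1) * b \<le> a powr (p - 1) * (\<delta> * a)"
    by (intro mult_left_mono) auto
  also have "\<dots> = \<delta> * a powr p"
    using assms(1) powr_mult_base[of a "p - 1"] by (simp add: mult_ac)
  finally show ?thesis
    by (simp add: add_increasing2)
next
  case False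
  then have a: "a \<le> b / \<delta>" and b: "0 < b"
    using assms mult_nonneg_nonneg[of \<delta> a] by (simp add: field_simps, linarith)
  have "a powr (p - 1) * b \<le> (b / \<delta>) powr (p - 1) * b"
    using assms a by (intro mult_right_mono powr_mono2) auto
  also have "\<dots> = \<delta> powr (1 - p) * b powr p"
  proof -
    have "\<delta> powr (1 - p) = 1 / \<delta> powr (p - 1)"
      by (metis minus_diff_eq powr_minus_divide)
    then show ?thesis
      using assms b powr_mult_base[of b "p - 1"] by (simp add: powr_divide mult_ac)
  qed
  finally show ?thesis
    using assms by (simp add: add_increasing)
qed

text \<open>Integrating the gradient of \<open>(x \<bullet> e) * \<bar>\<phi> x\<bar> powr p\<close> expresses the integral of
  \<open>\<bar>\<phi>\<bar> powr p\<close> through the gradient of \<open>\<phi>\<close>; Young's inequality then absorbs the power of \<open>\<phi>\<close> into the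
  left-hand side.\<close>

lemma Poincare_C1:
  fixes \<Omega> :: "(real^'n) set"
  assumes \<Omega>: "\<Omega> \<in> sets lebesgue" "\<And>x. x \<in> \<Omega> \<Longrightarrow> norm x \<le> R" and R: "0 < R" and p: "1 < p"
    and \<phi>: "\<phi> \<in> C1_0 \<Omega>" and g: "continuous_on UNIV g" "\<And>x. GDERIV \<phi> x :> g x"
  shows "(LINT x|lebesgue_on \<Omega>. \<bar>\<phi> x\<bar> powr p)
           \<le> (2 * p * R) powr p * (LINT x|lebesgue_on \<Omega>. norm (g x) powr p)"
proof -
  obtain g' K where "continuous_on UNIV g'" "\<And>x. GDERIV \<phi> x :> g' x" and cont: "continuous_on UNIV \<phi>"
    and K: "compact K" "K \<subseteq> \<Omega>" "\<And>x. x \<notin> K \<Longrightarrow> \<phi> x = 0" "\<And>x. x \<notin> K \<Longrightarrow> g' x = 0"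
    by (rule C1_0E[OF \<phi>]) (rule that)
  then have K': "\<And>x. x \<notin> K \<Longrightarrow> g x = 0"
    using GDERIV_unique[OF g(2)] by metis
  define e :: "real^'n" where "e = (SOME i. i \<in> Basis)"
  have "norm e = 1"
    unfolding e_def by (intro norm_Basis SOME_Basis)
  define h' where "h' t = p * (max 0 t powr (p - 1) - max 0 (- t) powr (p - 1))" for t
  have h': "\<bar>h' t\<bar> = p * \<bar>t\<bar> powr (p - 1)" for t
    using p by (cases "t \<ge> 0") (auto simp: h'_def max_def abs_mult)
  have h'_cont: "continuous_on UNIV h'"
    unfolding h'_def using p
    by (intro continuous_on_mult continuous_on_diff continuous_on_pos_part_powr continuous_intros) auto
  define G where "G x = (x \<bullet> e) *\<^sub>R (h' (\<phi> x) *\<^sub>R g x) + \<bar>\<phi> x\<bar> powr p *\<^sub>R e" for x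
  have cp: "continuous_on UNIV (\<lambda>x. \<bar>\<phi> x\<bar> powr p)" "continuous_on UNIV (\<lambda>x. norm (g x) powr p)"
    using p cont g(1) continuous_on_norm_powr[of p UNIV \<phi>] by (auto intro: continuous_on_norm_powr)
  have ch: "continuous_on UNIV (\<lambda>x. h' (\<phi> x))"
    using cont by (intro continuous_on_compose2[OF h'_cont]) auto
  have intp: "integrable lborel (\<lambda>x. \<bar>\<phi> x\<bar> powr p)" "integrable lborel (\<lambda>x. norm (g x) powr p)"
    using cp K K' p by (auto intro!: integrable_continuous_compact_support[where K=K])
  have h0: "h' 0 = 0"
    using p by (simp add: h'_def)
  define T where "T x = (x \<bullet> e) * h' (\<phi> x) * (g x \<bullet> e)" for x
  have T_int: "integrable lborel T"
    unfolding T_def using ch g(1) K'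
    by (intro integrable_continuous_compact_support[OF _ K(1)]) (auto intro!: continuous_intros)
  have G_cont: "continuous_on UNIV G"
    unfolding G_def using cp(1) g(1) ch
    by (intro continuous_on_add continuous_on_scaleR continuous_on_inner continuous_on_id continuous_on_const)
  have "(LINT x|lborel. G x) = 0"
  proof (rule integral_gradient_eq_0[OF G_cont _ K(1)])
    show "GDERIV (\<lambda>x. (x \<bullet> e) * \<bar>\<phi> x\<bar> powr p) x :> G x" for x
      unfolding G_def h'_def
      by (intro GDERIV_mult GDERIV_inner_left GDERIV_DERIV_compose[OF g(2) DERIV_abs_powr[OF p]])
  qed (use p K in auto)
  moreover have "integrable lborel G"
    using K K' p by (intro integrable_continuous_compact_support[OF G_cont K(1)]) (auto simp: G_def)
  ultimately have "(LINT x|lborel. G x \<bullet> e) = 0"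
    by (subst integral_inner_left) auto
  moreover have "G x \<bullet> e = T x + \<bar>\<phi> x\<bar> powr p" for x
    using \<open>norm e = 1\<close> by (simp add: G_def T_def inner_add_left mult_ac norm_eq_1)
  ultimately have "(LINT x|lborel. T x) + (LINT x|lborel. \<bar>\<phi> x\<bar> powr p) = 0"
    using intp T_int by simp
  then have "(LINT x|lborel. \<bar>\<phi> x\<bar> powr p) = (LINT x|lborel. - T x)"
    by simp
  also have "\<dots> \<le> (LINT x|lborel. 1/2 * \<bar>\<phi> x\<bar> powr p + 1/2 * (2 * p * R) powr p * norm (g x) powr p)"
  proof (rule integral_mono)
    fix x
    show "- T x \<le> 1/2 * \<bar>\<phi> x\<bar> powr p + 1/2 * (2 * p * R) powr p * norm (g x) powr p"
    proof (cases "x \<in> K")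
      case False
      then show ?thesis using K' by (simp add: T_def)
    next
      case True
      then have "norm x \<le> R"
        using \<Omega>(2) K(2) by blast
      have "- T x \<le> \<bar>x \<bullet> e\<bar> * \<bar>h' (\<phi> x)\<bar> * \<bar>g x \<bullet> e\<bar>"
        unfolding T_def by (metis abs_ge_minus_self abs_mult)
      also have "\<dots> \<le> R * (p * \<bar>\<phi> x\<bar> powr (p - 1)) * norm (g x)"
      proof (intro mult_mono)
        show "\<bar>x \<bullet> e\<bar> \<le> R"
          using Cauchy_Schwarz_ineq2[of x e] \<open>norm e = 1\<close> \<open>norm x \<le> R\<close> by simp
        show "\<bar>g x \<bullet> e\<bar> \<le> norm (g x)"
          using Cauchy_Schwarz_ineq2[of "g x" e] \<open>norm e = 1\<close> by simp
      qed (use R p h' in auto)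
      also have "\<dots> = p * R * (\<bar>\<phi> x\<bar> powr (p - 1) * norm (g x))"
        by (simp add: mult_ac)
      also have "\<dots> \<le> p * R * (1 / (2 * p * R) * \<bar>\<phi> x\<bar> powr p + (1 / (2 * p * R)) powr (1 - p) * norm (g x) powr p)"
        using R p by (intro mult_left_mono powr_mult_le_Young) auto
      also have "\<dots> = 1/2 * \<bar>\<phi> x\<bar> powr p + 1/2 * (2 * p * R) powr p * norm (g x) powr p"
      proof -
        have "(1 / (2 * p * R)) powr (1 - p) = (2 * p * R) powr (p - 1)"
          using R p by (simp add: powr_def ln_div minus_mult_left[symmetric] left_diff_distrib)
        moreover have "p * R * (2 * p * R) powr (p - 1) = 1/2 * (2 * p * R) powr p"
          using R p powr_mult_base[of "2 * p * R" "p - 1"] by simp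
        ultimately show ?thesis
          using R p by (simp add: distrib_left flip: mult.assoc)
      qed
      finally show ?thesis .
    qed
  qed (use T_int intp in auto)
  also have "\<dots> = 1/2 * (LINT x|lborel. \<bar>\<phi> x\<bar> powr p) + 1/2 * (2 * p * R) powr p * (LINT x|lborel. norm (g x) powr p)"
    using intp by simp
  finally have "(LINT x|lborel. \<bar>\<phi> x\<bar> powr p) \<le> (2 * p * R) powr p * (LINT x|lborel. norm (g x) powr p)"
    by simp
  moreover have "(LINT x|lebesgue_on \<Omega>. \<bar>\<phi> x\<bar> powr p) = (LINT x|lborel. \<bar>\<phi> x\<bar> powr p)"
    using cp(1) K \<Omega> p by (intro lebesgue_on_eq_lborel) (auto intro: borel_measurable_continuous_onI)
  moreover have "(LINT x|lebesgue_on \<Omega>. norm (g x) powr p) = (LINT x|lborel. norm (g x) powr p)"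
    using cp(2) K K' \<Omega> p by (intro lebesgue_on_eq_lborel) (auto intro: borel_measurable_continuous_onI)
  ultimately show ?thesis by simp
qed


section \<open>The fundamental lemma of the calculus of variations\<close>

lemma sigma_finite_lebesgue: "sigma_finite_measure (lebesgue :: 'a::euclidean_space measure)"
proof
  show "\<exists>A. countable A \<and> A \<subseteq> sets (lebesgue :: 'a measure) \<and> \<Union>A = space lebesgue \<and>
          (\<forall>a\<in>A. emeasure lebesgue a \<noteq> \<infinity>)"
  proof (intro exI[of _ "range (\<lambda>n::nat. box (- (real n *\<^sub>R One)) (real n *\<^sub>R One))"] conjI)
    show "\<Union>(range (\<lambda>n::nat. box (- (real n *\<^sub>R One)) (real n *\<^sub>R One))) = space (lebesgue :: 'a measure)"
      by (simp add: UN_box_eq_UNIV)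
  qed auto
qed

text \<open>The functions \<open>1 - 1 / (1 + k \<psi>\<^sup>2)\<close> are C1, take values in the unit interval and converge to
  the indicator of \<open>{\<psi> \<noteq> 0}\<close>. So the integral of \<open>h\<close> vanishes over every box, hence, boxes being
  closed under intersection, over every Borel set.\<close>

lemma AE_eq_0_of_C1_integrals:
  fixes h :: "real^'n \<Rightarrow> 'b::{banach, second_countable_topology}"
  assumes int: "integrable lebesgue h"
    and zero: "\<And>\<psi>. \<psi> \<in> C1_fun \<Longrightarrow> (LINT x|lebesgue. \<psi> x *\<^sub>R h x) = 0"
  shows "AE x in lebesgue. h x = 0"
proof -
  note [measurable] = borel_measurable_integrable[OF int]
  have box: "(LINT x|lebesgue. indicator (box a b) x *\<^sub>R h x) = 0" for a b
  proof -
    obtain \<psi> where \<psi>: "\<psi> \<in> C1_fun" "\<And>x. 0 \<le> \<psi> x" "{x. \<psi> x \<noteq> 0} = box a b"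
      by (rule box_bump[of a b]) (rule that)
    have [measurable]: "\<psi> \<in> borel_measurable borel"
      using C1_fun_continuous[OF \<psi>(1)] by (rule borel_measurable_continuous_onI)
    then have [measurable]: "\<psi> \<in> borel_measurable lebesgue"
      by (simp add: measurable_completion)
    define \<psi>' where "\<psi>' k x = 1 - inverse (1 + real k * (\<psi> x)\<^sup>2)" for k x
    have pos: "1 + real k * t\<^sup>2 > 0" for k t
      by (simp add: add_pos_nonneg)
    have C1: "\<psi>' k \<in> C1_fun" for k
      unfolding \<psi>'_def
    proof (rule C1_fun_compose[OF \<psi>(1)])
      show "DERIV (\<lambda>t. 1 - inverse (1 + real k * t\<^sup>2)) t :> 2 * real k * t * (inverse (1 + real k * t\<^sup>2))\<^sup>2" for t
        using pos[of k t] by (auto intro!: derivative_eq_intros simp: power2_eq_square)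
      show "continuous_on UNIV (\<lambda>t. 2 * real k * t * (inverse (1 + real k * t\<^sup>2))\<^sup>2)"
        using pos[of k] by (intro continuous_intros) (auto simp: less_imp_neq[symmetric])
    qed
    have "(\<lambda>k. LINT x|lebesgue. \<psi>' k x *\<^sub>R h x) \<longlonglongrightarrow> (LINT x|lebesgue. indicator (box a b) x *\<^sub>R h x)"
    proof (rule integral_dominated_convergence[where w="\<lambda>x. norm (h x)"])
      show "AE x in lebesgue. (\<lambda>k. \<psi>' k x *\<^sub>R h x) \<longlonglongrightarrow> indicator (box a b) x *\<^sub>R h x"
      proof (rule AE_I2)
        fix x
        have "(\<lambda>k. \<psi>' k x) \<longlonglongrightarrow> indicator (box a b) x"
        proof (cases "\<psi> x = 0")
          case True
          then have "x \<notin> box a b"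
            using \<psi>(3) by blast
          with True show ?thesis by (simp add: \<psi>'_def)
        next
          case False
          then have "x \<in> box a b"
            using \<psi>(3) by blast
          have "filterlim (\<lambda>k. 1 + real k * (\<psi> x)\<^sup>2) at_top sequentially"
            using False
            by (intro filterlim_tendsto_add_at_top[OF tendsto_const]
                filterlim_at_top_mult_tendsto_pos[OF tendsto_const _ filterlim_real_sequentially]) auto
          then have "(\<lambda>k. inverse (1 + real k * (\<psi> x)\<^sup>2)) \<longlonglongrightarrow> 0"
            by (rule tendsto_inverse_0_at_top)
          then have "(\<lambda>k. 1 - inverse (1 + real k * (\<psi> x)\<^sup>2)) \<longlonglongrightarrow> 1 - 0"
            by (intro tendsto_intros)
          with \<open>x \<in> box a b\<close> show ?thesis
            by (simp add: \<psi>'_def)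
        qed
        then show "(\<lambda>k. \<psi>' k x *\<^sub>R h x) \<longlonglongrightarrow> indicator (box a b) x *\<^sub>R h x"
          by (intro tendsto_intros)
      qed
      show "AE x in lebesgue. norm (\<psi>' k x *\<^sub>R h x) \<le> norm (h x)" for k
      proof (rule AE_I2)
        fix x
        have "inverse (1 + real k * (\<psi> x)\<^sup>2) \<le> 1" "0 \<le> inverse (1 + real k * (\<psi> x)\<^sup>2)"
          using pos[of k "\<psi> x"] by (auto intro!: inverse_le_1_iff[THEN iffD2] simp: less_imp_le)
        then have "\<bar>\<psi>' k x\<bar> \<le> 1"
          by (simp add: \<psi>'_def)
        then show "norm (\<psi>' k x *\<^sub>R h x) \<le> norm (h x)"
          by (simp add: mult_left_le_one_le)
      qed
      show "(\<lambda>x. indicator (box a b) x *\<^sub>R h x) \<in> borel_measurable lebesgue"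
        by (intro borel_measurable_scaleR borel_measurable_indicator) auto
      show "(\<lambda>x. \<psi>' k x *\<^sub>R h x) \<in> borel_measurable lebesgue" for k
        unfolding \<psi>'_def by measurable
    qed (use int in auto)
    moreover have "(LINT x|lebesgue. \<psi>' k x *\<^sub>R h x) = 0" for k
      by (rule zero[OF C1])
    ultimately have "(\<lambda>k::nat. 0) \<longlonglongrightarrow> (LINT x|lebesgue. indicator (box a b) x *\<^sub>R h x)"
      by (simp only:)
    then show ?thesis
      by (simp add: LIMSEQ_const_iff)
  qed
  have tot: "(LINT x|lebesgue. h x) = 0"
    using zero[OF C1_fun_const[of 1]] by simp
  have borel: "set_lebesgue_integral lebesgue A h = 0" if "A \<in> sets borel" for A
  proof -
    have in_sets: "B \<in> sets lebesgue" if "B \<in> sigma_sets UNIV (range (\<lambda>(a, b). box a b))"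
      for B :: "(real^'n) set"
    proof -
      have "B \<in> sets borel"
        using that by (simp add: borel_eq_box)
      then show ?thesis by simp
    qed
    have "Int_stable (range (\<lambda>(a, b). box a b :: (real^'n) set))"
      by (auto simp: Int_stable_def box_Int_box image_iff)
    moreover have "range (\<lambda>(a, b). box a b :: (real^'n) set) \<subseteq> Pow UNIV"
      by simp
    moreover have "A \<in> sigma_sets UNIV (range (\<lambda>(a, b). box a b))"
      using that by (simp add: borel_eq_box)
    ultimately show ?thesis
    proof (induction rule: sigma_sets_induct_disjoint)
      case (basic A)
      then show ?case
        using box by (auto simp: set_lebesgue_integral_def)
    next
      case empty
      show ?case by (simp add: set_lebesgue_integral_def)
    next
      case (compl A)
      have "(\<lambda>x. indicator (UNIV - A) x *\<^sub>R h x) = (\<lambda>x. h x - indicator A x *\<^sub>R h x)"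
        by (auto simp: indicator_def)
      then have "set_lebesgue_integral lebesgue (UNIV - A) h
          = (LINT x|lebesgue. h x) - set_lebesgue_integral lebesgue A h"
        using int integrable_mult_indicator[OF in_sets[OF compl(1)] int]
        by (simp add: set_lebesgue_integral_def)
      with compl tot show ?case by simp
    next
      case (union A)
      have "A i \<in> sets lebesgue" for i
        using union(2) in_sets by auto
      moreover have "set_integrable lebesgue (\<Union>i. A i) h"
        unfolding set_integrable_def using calculation by (intro integrable_mult_indicator int) auto
      ultimately have "set_lebesgue_integral lebesgue (\<Union>i. A i) h = (\<Sum>i. set_lebesgue_integral lebesgue (A i) h)"
        using union(1) by (intro lebesgue_integral_countable_add) (auto simp: disjoint_family_on_def)
      with union(3) show ?case by simp
    qed
  qed
  show ?thesis
  proof (rule sigma_finite_measure.density_zero[OF sigma_finite_lebesgue int])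
    fix A :: "(real^'n) set" assume A: "A \<in> sets lebesgue"
    then obtain S N N' where *: "A = S \<union> N" "N \<subseteq> N'" "N' \<in> null_sets lborel" "S \<in> sets lborel"
      by (rule sets_completionE)
    have "AE x in lborel. x \<notin> N'"
      using *(3) by (rule AE_not_in)
    then have "AE x in lebesgue. x \<notin> N'"
      by (rule AE_completion)
    then have "AE x in lebesgue. indicator A x *\<^sub>R h x = indicator S x *\<^sub>R h x"
      by eventually_elim (use * in \<open>auto simp: indicator_def\<close>)
    then have "set_lebesgue_integral lebesgue A h = set_lebesgue_integral lebesgue S h"
      unfolding set_lebesgue_integral_def using A *(4)
      by (intro integral_cong_AE borel_measurable_scaleR borel_measurable_indicator) auto
    also have "\<dots> = 0"
      using *(4) by (intro borel) simp
    finally show "set_lebesgue_integral lebesgue A h = 0" .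
  qed
qed


section \<open>Weak gradients\<close>

lemma integrable_lebesgue_on_iff:
  fixes f :: "'a::euclidean_space \<Rightarrow> 'b::{banach, second_countable_topology}"
  assumes "S \<in> sets lebesgue"
  shows "integrable (lebesgue_on S) f \<longleftrightarrow> integrable lebesgue (\<lambda>x. indicator S x *\<^sub>R f x)"
  using assms by (simp add: integrable_restrict_space)

lemma integrable_lebesgue_on_mono:
  fixes f :: "'a::euclidean_space \<Rightarrow> 'b::{banach, second_countable_topology}"
  assumes "integrable (lebesgue_on S) f" "T \<subseteq> S" "S \<in> sets lebesgue" "T \<in> sets lebesgue"
  shows "integrable (lebesgue_on T) f"
proof -
  have "integrable lebesgue (\<lambda>x. indicator T x *\<^sub>R indicator S x *\<^sub>R f x)"
    using assms by (intro integrable_mult_indicator[where A=T]) (auto simp: integrable_lebesgue_on_iff)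
  moreover have "(\<lambda>x. indicator T x *\<^sub>R indicator S x *\<^sub>R f x) = (\<lambda>x. indicator T x *\<^sub>R f x)"
    using assms(2) by (intro ext) (auto simp: indicator_def subset_eq)
  ultimately show ?thesis
    using assms(4) by (simp add: integrable_lebesgue_on_iff)
qed

lemma lebesgue_on_measurable_AE:
  fixes f g :: "'a::euclidean_space \<Rightarrow> 'b::euclidean_space"
  assumes "f \<in> borel_measurable (lebesgue_on S)" "AE x in lebesgue_on S. f x = g x" "S \<in> sets lebesgue"
  shows "g \<in> borel_measurable (lebesgue_on S)"
proof -
  have "(\<lambda>x. indicator S x *\<^sub>R f x) \<in> borel_measurable lebesgue"
    using assms by (subst (asm) borel_measurable_restrict_space_iff) (auto simp: mult.commute)
  moreover have "AE x in lebesgue. indicator S x *\<^sub>R f x = indicator S x *\<^sub>R g x"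
    using assms(2,3) by (subst (asm) AE_restrict_space_iff) (auto simp: indicator_def)
  ultimately have "(\<lambda>x. indicator S x *\<^sub>R g x) \<in> borel_measurable lebesgue"
    by (rule borel_measurable_AE)
  then show ?thesis
    using assms(3) by (subst borel_measurable_restrict_space_iff) auto
qed

lemma locally_integrable_on_add:
  "locally_integrable_on \<Omega> u \<Longrightarrow> locally_integrable_on \<Omega> v \<Longrightarrow> locally_integrable_on \<Omega> (\<lambda>x. u x + v x)"
  by (auto simp: locally_integrable_on_def)

lemma locally_integrable_on_scaleR:
  "locally_integrable_on \<Omega> u \<Longrightarrow> locally_integrable_on \<Omega> (\<lambda>x. c *\<^sub>R u x)"
  by (auto simp: locally_integrable_on_def)

lemma locally_integrable_mult:
  fixes w :: "real^'n \<Rightarrow> 'b::{banach, second_countable_topology}" and b :: "real^'n \<Rightarrow> real"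
  assumes w: "locally_integrable_on \<Omega> w" and b: "continuous_on UNIV b"
    and K: "compact K" "K \<subseteq> \<Omega>" "\<And>x. x \<notin> K \<Longrightarrow> b x = 0"
  shows "integrable lebesgue (\<lambda>x. b x *\<^sub>R w x)"
    and "\<Omega> \<in> sets lebesgue \<Longrightarrow> integrable (lebesgue_on \<Omega>) (\<lambda>x. b x *\<^sub>R w x)"
proof -
  have "K \<in> sets lebesgue"
    using K(1) by (auto intro: lmeasurable_compact fmeasurableD)
  then have int: "integrable lebesgue (\<lambda>x. indicator K x *\<^sub>R w x)"
    using w K by (auto simp: locally_integrable_on_def simp flip: integrable_lebesgue_on_iff)
  have [measurable]: "b \<in> borel_measurable lebesgue"
    using b by (intro measurable_completion) (simp add: borel_measurable_continuous_onI)
  obtain B where B: "0 < B" "\<And>x. norm (b x) \<le> B"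
    by (rule continuous_compact_support_bounded[OF b K(1,3)]) (assumption, rule that)
  have "integrable lebesgue (\<lambda>x. b x *\<^sub>R (indicator K x *\<^sub>R w x))"
  proof (rule Bochner_Integration.integrable_bound[where f="\<lambda>x. B *\<^sub>R (indicator K x *\<^sub>R w x)"])
    show "integrable lebesgue (\<lambda>x. B *\<^sub>R (indicator K x *\<^sub>R w x))"
      using int by (rule integrable_scaleR_right)
    show "(\<lambda>x. b x *\<^sub>R (indicator K x *\<^sub>R w x)) \<in> borel_measurable lebesgue"
      using borel_measurable_integrable[OF int] by measurable
    show "AE x in lebesgue. norm (b x *\<^sub>R (indicator K x *\<^sub>R w x)) \<le> norm (B *\<^sub>R (indicator K x *\<^sub>R w x))"
      using B by (intro AE_I2) (auto intro!: mult_right_mono simp: indicator_def)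
  qed
  moreover have "(\<lambda>x. b x *\<^sub>R (indicator K x *\<^sub>R w x)) = (\<lambda>x. b x *\<^sub>R w x)"
  proof (rule ext)
    show "b x *\<^sub>R (indicator K x *\<^sub>R w x) = b x *\<^sub>R w x" for x
      using K(3)[of x] by (cases "x \<in> K") auto
  qed
  ultimately show "integrable lebesgue (\<lambda>x. b x *\<^sub>R w x)"
    by simp
  then show "integrable (lebesgue_on \<Omega>) (\<lambda>x. b x *\<^sub>R w x)" if "\<Omega> \<in> sets lebesgue"
    using integrable_mult_indicator[OF that] that unfolding integrable_lebesgue_on_iff[OF that] by blast
qed

lemma locally_integrable_mult_vector:
  fixes u :: "real^'n \<Rightarrow> real" and g :: "real^'n \<Rightarrow> real^'n"
  assumes u: "locally_integrable_on \<Omega> u" and g: "continuous_on UNIV g"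
    and K: "compact K" "K \<subseteq> \<Omega>" "\<And>x. x \<notin> K \<Longrightarrow> g x = 0" and \<Omega>: "\<Omega> \<in> sets lebesgue"
  shows "integrable (lebesgue_on \<Omega>) (\<lambda>x. u x *\<^sub>R g x)"
proof -
  have "integrable (lebesgue_on \<Omega>) (\<lambda>x. (g x \<bullet> i) *\<^sub>R u x)" for i
    by (rule locally_integrable_mult(2)[OF u _ K(1,2) _ \<Omega>]) (use g K(3) in \<open>auto intro!: continuous_intros\<close>)
  then have "integrable (lebesgue_on \<Omega>) (\<lambda>x. \<Sum>i\<in>Basis. ((g x \<bullet> i) *\<^sub>R u x) *\<^sub>R i)"
    by (intro Bochner_Integration.integrable_sum integrable_scaleR_left)
  moreover have "(\<lambda>x. \<Sum>i\<in>Basis. ((g x \<bullet> i) *\<^sub>R u x) *\<^sub>R i) = (\<lambda>x. u x *\<^sub>R g x)"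
    by (auto simp: euclidean_representation mult.commute[of _ "u _"] simp flip: scaleR_scaleR scaleR_sum_right)
  ultimately show ?thesis by simp
qed

lemma has_weak_gradD:
  assumes "has_weak_grad \<Omega> u w"
  shows "locally_integrable_on \<Omega> u" "locally_integrable_on \<Omega> w"
    "\<And>\<phi> g. \<phi> \<in> C1_0 \<Omega> \<Longrightarrow> (\<And>x. GDERIV \<phi> x :> g x) \<Longrightarrow>
       (LINT x|lebesgue_on \<Omega>. u x *\<^sub>R g x) = - (LINT x|lebesgue_on \<Omega>. \<phi> x *\<^sub>R w x)"
  using assms by (auto simp: has_weak_grad_def)

lemma has_weak_gradI:
  assumes "locally_integrable_on \<Omega> u" "locally_integrable_on \<Omega> w"
    "\<And>\<phi> g K. \<phi> \<in> C1_0 \<Omega> \<Longrightarrow> (\<And>x. GDERIV \<phi> x :> g x) \<Longrightarrow> continuous_on UNIV \<phi> \<Longrightarrow> continuous_on UNIV g \<Longrightarrow>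
       compact K \<Longrightarrow> K \<subseteq> \<Omega> \<Longrightarrow> (\<And>x. x \<notin> K \<Longrightarrow> \<phi> x = 0) \<Longrightarrow> (\<And>x. x \<notin> K \<Longrightarrow> g x = 0) \<Longrightarrow>
       (LINT x|lebesgue_on \<Omega>. u x *\<^sub>R g x) = - (LINT x|lebesgue_on \<Omega>. \<phi> x *\<^sub>R w x)"
  shows "has_weak_grad \<Omega> u w"
  unfolding has_weak_grad_def
proof (intro conjI ballI allI impI assms(1,2))
  fix \<phi> g assume \<phi>: "\<phi> \<in> C1_0 \<Omega>" and g: "\<forall>x. GDERIV \<phi> x :> g x"
  obtain g' K where *: "continuous_on UNIV g'" "\<And>x. GDERIV \<phi> x :> g' x" "continuous_on UNIV \<phi>"
    "compact K" "K \<subseteq> \<Omega>" "\<And>x. x \<notin> K \<Longrightarrow> \<phi> x = 0" "\<And>x. x \<notin> K \<Longrightarrow> g' x = 0"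
    by (rule C1_0E[OF \<phi>]) (rule that)
  have "g = g'"
    using g *(2) by (auto intro: GDERIV_unique)
  then show "(LINT x|lebesgue_on \<Omega>. u x *\<^sub>R g x) = - (LINT x|lebesgue_on \<Omega>. \<phi> x *\<^sub>R w x)"
    using assms(3)[OF \<phi> *(2,3,1,4,5,6,7)] by simp
qed

lemma has_weak_grad_add:
  assumes \<Omega>: "\<Omega> \<in> sets lebesgue" and u: "has_weak_grad \<Omega> u w" and v: "has_weak_grad \<Omega> v z"
  shows "has_weak_grad \<Omega> (\<lambda>x. u x + v x) (\<lambda>x. w x + z x)"
proof (rule has_weak_gradI)
  fix \<phi> g K
  assume \<phi>: "\<phi> \<in> C1_0 \<Omega>" "\<And>x. GDERIV \<phi> x :> g x" and c: "continuous_on UNIV \<phi>" "continuous_on UNIV g"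
    and K: "compact K" "K \<subseteq> \<Omega>" "\<And>x. x \<notin> K \<Longrightarrow> \<phi> x = 0" "\<And>x. x \<notin> K \<Longrightarrow> g x = 0"
  note 1 = locally_integrable_mult_vector[OF has_weak_gradD(1)[OF u] c(2) K(1,2,4) \<Omega>]
    locally_integrable_mult_vector[OF has_weak_gradD(1)[OF v] c(2) K(1,2,4) \<Omega>]
  note 2 = locally_integrable_mult(2)[OF has_weak_gradD(2)[OF u] c(1) K(1,2,3) \<Omega>]
    locally_integrable_mult(2)[OF has_weak_gradD(2)[OF v] c(1) K(1,2,3) \<Omega>]
  show "(LINT x|lebesgue_on \<Omega>. (u x + v x) *\<^sub>R g x) = - (LINT x|lebesgue_on \<Omega>. \<phi> x *\<^sub>R (w x + z x))"
    using 1 2 has_weak_gradD(3)[OF u \<phi>] has_weak_gradD(3)[OF v \<phi>]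
    by (simp add: scaleR_add_left scaleR_add_right)
qed (use u v in \<open>auto dest: has_weak_gradD(1,2) intro: locally_integrable_on_add\<close>)

lemma has_weak_grad_scaleR:
  assumes u: "has_weak_grad \<Omega> u w"
  shows "has_weak_grad \<Omega> (\<lambda>x. c * u x) (\<lambda>x. c *\<^sub>R w x)"
proof (rule has_weak_gradI)
  show "locally_integrable_on \<Omega> (\<lambda>x. c * u x)" "locally_integrable_on \<Omega> (\<lambda>x. c *\<^sub>R w x)"
    using locally_integrable_on_scaleR[OF has_weak_gradD(1)[OF u], of c]
      locally_integrable_on_scaleR[OF has_weak_gradD(2)[OF u], of c] by auto
  fix \<phi> g K
  assume \<phi>: "\<phi> \<in> C1_0 \<Omega>" "\<And>x. GDERIV \<phi> x :> g x"
  have "(LINT x|lebesgue_on \<Omega>. (c * u x) *\<^sub>R g x) = c *\<^sub>R (LINT x|lebesgue_on \<Omega>. u x *\<^sub>R g x)"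
    by (simp flip: scaleR_scaleR)
  moreover have "(LINT x|lebesgue_on \<Omega>. \<phi> x *\<^sub>R c *\<^sub>R w x) = c *\<^sub>R (LINT x|lebesgue_on \<Omega>. \<phi> x *\<^sub>R w x)"
    by (subst integral_scaleR_right[symmetric]) (simp only: scaleR_scaleR mult.commute)
  ultimately show "(LINT x|lebesgue_on \<Omega>. (c * u x) *\<^sub>R g x) = - (LINT x|lebesgue_on \<Omega>. \<phi> x *\<^sub>R c *\<^sub>R w x)"
    using has_weak_gradD(3)[OF u \<phi>] by simp
qed

text \<open>Multiplying the difference of two weak gradients by a bump function of a box with closure in \<open>\<Omega>\<close>
  makes it integrable on the whole space, where arbitrary C1 functions may be tested. Countably many such
  boxes cover \<open>\<Omega>\<close>.\<close>

lemma has_weak_grad_unique: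
  assumes \<Omega>: "open \<Omega>" and w: "has_weak_grad \<Omega> u w" and z: "has_weak_grad \<Omega> u z"
  shows "AE x in lebesgue_on \<Omega>. w x = z x"
proof -
  have \<Omega>': "\<Omega> \<in> sets lebesgue"
    using \<Omega> by (simp add: lebesgue_openin)
  have "has_weak_grad \<Omega> (\<lambda>x. u x + (-1) * u x) (\<lambda>x. w x + (-1) *\<^sub>R z x)"
    by (intro has_weak_grad_add has_weak_grad_scaleR \<Omega>' w z)
  then have d: "has_weak_grad \<Omega> (\<lambda>x. 0) (\<lambda>x. w x - z x)"
    by simp
  have zero: "(LINT x|lebesgue. \<phi> x *\<^sub>R (w x - z x)) = 0" if \<phi>: "\<phi> \<in> C1_0 \<Omega>" for \<phi>
  proof -
    obtain g K where *: "continuous_on UNIV g" "\<And>x. GDERIV \<phi> x :> g x" "continuous_on UNIV \<phi>"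
      "compact K" "K \<subseteq> \<Omega>" "\<And>x. x \<notin> K \<Longrightarrow> \<phi> x = 0" "\<And>x. x \<notin> K \<Longrightarrow> g x = 0"
      by (rule C1_0E[OF \<phi>]) (rule that)
    have "(LINT x|lebesgue_on \<Omega>. \<phi> x *\<^sub>R (w x - z x)) = 0"
      using has_weak_gradD(3)[OF d \<phi> *(2)] by simp
    moreover have "(\<lambda>x. indicator \<Omega> x *\<^sub>R \<phi> x *\<^sub>R (w x - z x)) = (\<lambda>x. \<phi> x *\<^sub>R (w x - z x))"
    proof (rule ext)
      show "indicator \<Omega> x *\<^sub>R \<phi> x *\<^sub>R (w x - z x) = \<phi> x *\<^sub>R (w x - z x)" for x
        using *(5) *(6)[of x] by (cases "x \<in> K") auto
    qed
    ultimately show ?thesis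
      using \<Omega>' by (simp add: integral_restrict_space)
  qed
  define \<F> where "\<F> = {box a b | a b. cbox a b \<subseteq> \<Omega>}"
  have box: "AE x in lebesgue. x \<in> B \<longrightarrow> w x = z x" if "B \<in> \<F>" for B
  proof -
    obtain a b where B: "B = box a b" "cbox a b \<subseteq> \<Omega>"
      using \<open>B \<in> \<F>\<close> by (auto simp: \<F>_def)
    obtain \<beta> where \<beta>: "\<beta> \<in> C1_fun" "\<And>x. 0 \<le> \<beta> x" "{x. \<beta> x \<noteq> 0} = box a b"
      by (rule box_bump[of a b]) (rule that)
    have \<beta>0: "\<beta> \<in> C1_0 \<Omega>"
    proof (rule C1_0I[OF \<beta>(1) compact_cbox B(2)])
      show "\<beta> x = 0" if "x \<notin> cbox a b" for x
        using that \<beta>(3) box_subset_cbox[of a b] by blast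
    qed
    obtain K where K: "compact K" "K \<subseteq> \<Omega>" "\<And>x. x \<notin> K \<Longrightarrow> \<beta> x = 0"
      by (rule C1_0_supportE[OF \<beta>0]) (rule that)
    have "AE x in lebesgue. \<beta> x *\<^sub>R (w x - z x) = 0"
    proof (rule AE_eq_0_of_C1_integrals)
      show "integrable lebesgue (\<lambda>x. \<beta> x *\<^sub>R (w x - z x))"
        using has_weak_gradD(2)[OF d] C1_fun_continuous[OF \<beta>(1)] K by (rule locally_integrable_mult(1))
      show "(LINT x|lebesgue. \<psi> x *\<^sub>R \<beta> x *\<^sub>R (w x - z x)) = 0" if "\<psi> \<in> C1_fun" for \<psi>
        using zero[OF C1_0_mult[OF that \<beta>0]] by simp
    qed
    then show ?thesis
    proof eventually_elim
      case (elim x)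
      then show ?case
        using \<beta>(3) B(1) by (metis (mono_tags, lifting) eq_iff_diff_eq_0 mem_Collect_eq scaleR_eq_0_iff)
    qed
  qed
  have "open S" if "S \<in> \<F>" for S
    using that by (auto simp: \<F>_def)
  then obtain \<G> where \<G>: "\<G> \<subseteq> \<F>" "countable \<G>" "\<Union>\<G> = \<Union>\<F>"
    by (rule Lindelof) (assumption, rule that)
  have "\<Omega> \<subseteq> \<Union>\<F>"
  proof
    fix x assume "x \<in> \<Omega>"
    then obtain a b where "cbox a b \<subseteq> \<Omega>" "x \<in> box a b"
      by (rule open_contains_cbox[OF \<Omega>]) (rule that)
    then show "x \<in> \<Union>\<F>"
      by (auto simp: \<F>_def)
  qed
  have "AE x in lebesgue. \<forall>B\<in>\<G>. x \<in> B \<longrightarrow> w x = z x"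
    using \<G>(1,2) box by (intro AE_ball_countable') auto
  then have "AE x in lebesgue. x \<in> \<Omega> \<longrightarrow> w x = z x"
  proof eventually_elim
    case (elim x)
    show ?case
    proof
      assume "x \<in> \<Omega>"
      then have "x \<in> \<Union>\<G>"
        using \<G>(3) \<open>\<Omega> \<subseteq> \<Union>\<F>\<close> by (simp only: subsetD)
      then show "w x = z x"
        using elim by (elim UnionE) blast
    qed
  qed
  then show ?thesis
    using \<Omega>' by (simp add: AE_restrict_space_iff)
qed

lemma has_weak_grad_weak_grad: "has_weak_grad \<Omega> u w \<Longrightarrow> has_weak_grad \<Omega> u (weak_grad \<Omega> u)"
  unfolding weak_grad_def by (rule someI[where P="has_weak_grad \<Omega> u"])

lemma weak_grad_AE:
  assumes "open \<Omega>" "has_weak_grad \<Omega> u w"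
  shows "AE x in lebesgue_on \<Omega>. weak_grad \<Omega> u x = w x"
  using has_weak_grad_unique[OF assms(1) has_weak_grad_weak_grad[OF assms(2)] assms(2)] .

text \<open>A test function and its gradient are bounded, so both sides of the defining identity are continuous
  in \<open>L\<^sup>1\<close>.\<close>

lemma has_weak_grad_limit:
  assumes \<Omega>: "\<Omega> \<in> sets lebesgue"
    and uk: "\<And>k. has_weak_grad \<Omega> (u k) (w k)"
    and int: "\<And>k. integrable (lebesgue_on \<Omega>) (u k)" "\<And>k. integrable (lebesgue_on \<Omega>) (w k)"
      "integrable (lebesgue_on \<Omega>) v" "integrable (lebesgue_on \<Omega>) z"
    and lim: "(\<lambda>k. LINT x|lebesgue_on \<Omega>. norm (u k x - v x)) \<longlonglongrightarrow> 0"
      "(\<lambda>k. LINT x|lebesgue_on \<Omega>. norm (w k x - z x)) \<longlonglongrightarrow> 0"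
  shows "has_weak_grad \<Omega> v z"
proof (rule has_weak_gradI)
  have K: "K \<in> sets lebesgue" if "compact K" for K :: "(real^'n) set"
    using that by (auto intro: lmeasurable_compact fmeasurableD)
  show lv: "locally_integrable_on \<Omega> v" and lz: "locally_integrable_on \<Omega> z"
    unfolding locally_integrable_on_def
    by (auto intro: integrable_lebesgue_on_mono[OF int(3)] integrable_lebesgue_on_mono[OF int(4)] K \<Omega>)
  fix \<phi> g K
  assume \<phi>: "\<phi> \<in> C1_0 \<Omega>" "\<And>x. GDERIV \<phi> x :> g x" and c: "continuous_on UNIV \<phi>" "continuous_on UNIV g"
    and K: "compact K" "K \<subseteq> \<Omega>" "\<And>x. x \<notin> K \<Longrightarrow> \<phi> x = 0" "\<And>x. x \<notin> K \<Longrightarrow> g x = 0"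
  let ?M = "lebesgue_on \<Omega>"
  have "(\<lambda>k. LINT x|?M. u k x *\<^sub>R g x) \<longlonglongrightarrow> (LINT x|?M. v x *\<^sub>R g x)"
  proof -
    obtain B where B: "0 < B" "\<And>x. norm (g x) \<le> B"
      by (rule continuous_compact_support_bounded[OF c(2) K(1,4)]) (assumption, rule that)
    have i1: "integrable ?M (\<lambda>x. u k x *\<^sub>R g x)" for k
      by (rule locally_integrable_mult_vector[OF has_weak_gradD(1)[OF uk] c(2) K(1,2) K(4) \<Omega>])
    have i2: "integrable ?M (\<lambda>x. v x *\<^sub>R g x)"
      by (rule locally_integrable_mult_vector[OF lv c(2) K(1,2) K(4) \<Omega>])
    have "norm ((LINT x|?M. u k x *\<^sub>R g x) - (LINT x|?M. v x *\<^sub>R g x)) \<le> B * (LINT x|?M. norm (u k x - v x))" for k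
    proof -
      have "norm (LINT x|?M. u k x *\<^sub>R g x - v x *\<^sub>R g x) \<le> (LINT x|?M. B * norm (u k x - v x))"
      proof (rule Bochner_Integration.integral_norm_bound_integral)
        show "norm (u k x *\<^sub>R g x - v x *\<^sub>R g x) \<le> B * norm (u k x - v x)" for x
        proof -
          have "u k x *\<^sub>R g x - v x *\<^sub>R g x = (u k x - v x) *\<^sub>R g x"
            by (rule scaleR_diff_left[symmetric])
          then have "norm (u k x *\<^sub>R g x - v x *\<^sub>R g x) = norm (g x) * norm (u k x - v x)"
            by simp
          also have "\<dots> \<le> B * norm (u k x - v x)"
            by (intro mult_right_mono B) simp
          finally show ?thesis .
        qed
        show "integrable ?M (\<lambda>x. u k x *\<^sub>R g x - v x *\<^sub>R g x)"
          by (intro Bochner_Integration.integrable_diff i1 i2)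
        show "integrable ?M (\<lambda>x. B * norm (u k x - v x))"
          by (intro integrable_mult_right integrable_norm Bochner_Integration.integrable_diff int)
      qed
      then show ?thesis
        by (subst (asm) Bochner_Integration.integral_diff[OF i1 i2]) (simp only: integral_mult_right_zero)
    qed
    moreover have "(\<lambda>k. B * (LINT x|?M. norm (u k x - v x))) \<longlonglongrightarrow> 0"
      using tendsto_mult_left[OF lim(1), of B] by simp
    ultimately have "(\<lambda>k. (LINT x|?M. u k x *\<^sub>R g x) - (LINT x|?M. v x *\<^sub>R g x)) \<longlonglongrightarrow> 0"
      by (rule Lim_null_comparison[OF always_eventually[OF allI]])
    then show ?thesis
      by (rule LIM_zero_cancel)
  qed
  moreover have "(\<lambda>k. LINT x|?M. \<phi> x *\<^sub>R w k x) \<longlonglongrightarrow> (LINT x|?M. \<phi> x *\<^sub>R z x)"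
  proof -
    obtain B where B: "0 < B" "\<And>x. norm (\<phi> x) \<le> B"
      by (rule continuous_compact_support_bounded[OF c(1) K(1,3)]) (assumption, rule that)
    have i1: "integrable ?M (\<lambda>x. \<phi> x *\<^sub>R w k x)" for k
      by (rule locally_integrable_mult(2)[OF has_weak_gradD(2)[OF uk] c(1) K(1,2) K(3) \<Omega>])
    have i2: "integrable ?M (\<lambda>x. \<phi> x *\<^sub>R z x)"
      by (rule locally_integrable_mult(2)[OF lz c(1) K(1,2) K(3) \<Omega>])
    have "norm ((LINT x|?M. \<phi> x *\<^sub>R w k x) - (LINT x|?M. \<phi> x *\<^sub>R z x)) \<le> B * (LINT x|?M. norm (w k x - z x))" for k
    proof -
      have "norm (LINT x|?M. \<phi> x *\<^sub>R w k x - \<phi> x *\<^sub>R z x) \<le> (LINT x|?M. B * norm (w k x - z x))"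
      proof (rule Bochner_Integration.integral_norm_bound_integral)
        show "norm (\<phi> x *\<^sub>R w k x - \<phi> x *\<^sub>R z x) \<le> B * norm (w k x - z x)" for x
        proof -
          have "\<phi> x *\<^sub>R w k x - \<phi> x *\<^sub>R z x = \<phi> x *\<^sub>R (w k x - z x)"
            by (rule scaleR_diff_right[symmetric])
          then have "norm (\<phi> x *\<^sub>R w k x - \<phi> x *\<^sub>R z x) = norm (\<phi> x) * norm (w k x - z x)"
            by simp
          also have "\<dots> \<le> B * norm (w k x - z x)"
            by (intro mult_right_mono B) simp
          finally show ?thesis .
        qed
        show "integrable ?M (\<lambda>x. \<phi> x *\<^sub>R w k x - \<phi> x *\<^sub>R z x)"
          by (intro Bochner_Integration.integrable_diff i1 i2)
        show "integrable ?M (\<lambda>x. B * norm (w k x - z x))"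
          by (intro integrable_mult_right integrable_norm Bochner_Integration.integrable_diff int)
      qed
      then show ?thesis
        by (subst (asm) Bochner_Integration.integral_diff[OF i1 i2]) (simp only: integral_mult_right_zero)
    qed
    moreover have "(\<lambda>k. B * (LINT x|?M. norm (w k x - z x))) \<longlonglongrightarrow> 0"
      using tendsto_mult_left[OF lim(2), of B] by simp
    ultimately have "(\<lambda>k. (LINT x|?M. \<phi> x *\<^sub>R w k x) - (LINT x|?M. \<phi> x *\<^sub>R z x)) \<longlonglongrightarrow> 0"
      by (rule Lim_null_comparison[OF always_eventually[OF allI]])
    then show ?thesis
      by (rule LIM_zero_cancel)
  qed
  then have "(\<lambda>k. - (LINT x|?M. \<phi> x *\<^sub>R w k x)) \<longlonglongrightarrow> - (LINT x|?M. \<phi> x *\<^sub>R z x)"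
    by (rule tendsto_minus)
  ultimately show "(LINT x|?M. v x *\<^sub>R g x) = - (LINT x|?M. \<phi> x *\<^sub>R z x)"
    unfolding has_weak_gradD(3)[OF uk \<phi>] by (rule LIMSEQ_unique)
qed


section \<open>Sobolev spaces on a bounded open set\<close>

locale bounded_open =
  fixes \<Omega> :: "(real^'n) set" and p :: real
  assumes open_\<Omega>: "open \<Omega>" and bounded_\<Omega>: "bounded \<Omega>" and p_ge_2: "2 \<le> p"
begin

abbreviation M where "M \<equiv> lebesgue_on \<Omega>"

abbreviation D :: "(real^'n \<Rightarrow> real) \<Rightarrow> real^'n \<Rightarrow> real^'n" where "D \<equiv> weak_grad \<Omega>"

text \<open>The p-th power of the Sobolev norm. Its triangle inequality with the factor \<open>2 powr p\<close> is
  elementary and serves as well as that of the norm where only smallness matters.\<close>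

definition modular :: "(real^'n \<Rightarrow> real) \<Rightarrow> real" where
  "modular u = (LINT x|M. \<bar>u x\<bar> powr p) + (LINT x|M. norm (D u x) powr p)"

lemma p_pos: "0 < p" "0 \<le> p" "1 \<le> p" "1 < p"
  using p_ge_2 by auto

lemma sets_\<Omega>: "\<Omega> \<in> sets lebesgue"
  using open_\<Omega> by (simp add: lebesgue_openin)

lemma finite_M: "finite_measure M"
  using bounded_\<Omega> sets_\<Omega> by (intro finite_measure_lebesgue_on) (simp add: bounded_set_imp_lmeasurable)

lemma Lp_on_cong_AE:
  fixes f g :: "real^'n \<Rightarrow> 'b::euclidean_space"
  assumes "f \<in> Lp_on p M" "AE x in M. f x = g x"
  shows "g \<in> Lp_on p M"
proof -
  have f: "f \<in> borel_measurable M" "integrable M (\<lambda>x. norm (f x) powr p)"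
    using assms(1) by (auto simp: Lp_on_def)
  have g: "g \<in> borel_measurable M"
    using f(1) assms(2) sets_\<Omega> by (rule lebesgue_on_measurable_AE)
  moreover have "integrable M (\<lambda>x. norm (g x) powr p)"
  proof (rule integrable_cong_AE_imp[OF f(2)])
    show "(\<lambda>x. norm (g x) powr p) \<in> borel_measurable M"
      using g by measurable
    show "AE x in M. norm (f x) powr p = norm (g x) powr p"
      using assms(2) by eventually_elim simp
  qed
  ultimately show ?thesis by (simp add: Lp_on_def)
qed

lemma W1pI:
  assumes "u \<in> Lp_on p M" "has_weak_grad \<Omega> u w" "w \<in> Lp_on p M"
  shows "u \<in> W1p \<Omega> p"
  using assms by (auto simp: W1p_def)

lemma W1pD:
  assumes "u \<in> W1p \<Omega> p"
  shows "u \<in> Lp_on p M" "has_weak_grad \<Omega> u (D u)" "D u \<in> Lp_on p M"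
proof -
  obtain w where w: "has_weak_grad \<Omega> u w" "w \<in> Lp_on p M"
    using assms by (auto simp: W1p_def)
  show "u \<in> Lp_on p M"
    using assms by (auto simp: W1p_def)
  show "has_weak_grad \<Omega> u (D u)"
    using w(1) by (rule has_weak_grad_weak_grad)
  show "D u \<in> Lp_on p M"
  proof (rule Lp_on_cong_AE[OF w(2)])
    show "AE x in M. w x = D u x"
      using weak_grad_AE[OF open_\<Omega> w(1)] by eventually_elim simp
  qed
qed

lemma W1p_D_measurable: "u \<in> W1p \<Omega> p \<Longrightarrow> D u \<in> borel_measurable M"
  using W1pD(3) Lp_on_measurable by blast

lemma W1p_add:
  assumes "u \<in> W1p \<Omega> p" "v \<in> W1p \<Omega> p"
  shows "(\<lambda>x. u x + v x) \<in> W1p \<Omega> p" "AE x in M. D (\<lambda>x. u x + v x) x = D u x + D v x"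
proof -
  have w: "has_weak_grad \<Omega> (\<lambda>x. u x + v x) (\<lambda>x. D u x + D v x)"
    using assms by (intro has_weak_grad_add sets_\<Omega> W1pD)
  show "(\<lambda>x. u x + v x) \<in> W1p \<Omega> p"
    by (rule W1pI[OF Lp_on_add(1)[OF W1pD(1)[OF assms(1)] W1pD(1)[OF assms(2)] p_pos(2)] w
          Lp_on_add(1)[OF W1pD(3)[OF assms(1)] W1pD(3)[OF assms(2)] p_pos(2)]])
  show "AE x in M. D (\<lambda>x. u x + v x) x = D u x + D v x"
    by (rule weak_grad_AE[OF open_\<Omega> w])
qed

lemma W1p_scale:
  assumes "u \<in> W1p \<Omega> p"
  shows "(\<lambda>x. c * u x) \<in> W1p \<Omega> p" "AE x in M. D (\<lambda>x. c * u x) x = c *\<^sub>R D u x"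
proof -
  have w: "has_weak_grad \<Omega> (\<lambda>x. c * u x) (\<lambda>x. c *\<^sub>R D u x)"
    using assms by (intro has_weak_grad_scaleR W1pD)
  show "(\<lambda>x. c * u x) \<in> W1p \<Omega> p"
    by (rule W1pI[OF _ w]) (use Lp_on_scaleR(1)[OF W1pD(1)[OF assms], of c] Lp_on_scaleR(1)[OF W1pD(3)[OF assms], of c] in auto)
  show "AE x in M. D (\<lambda>x. c * u x) x = c *\<^sub>R D u x"
    by (rule weak_grad_AE[OF open_\<Omega> w])
qed

lemma W1p_diff:
  assumes "u \<in> W1p \<Omega> p" "v \<in> W1p \<Omega> p"
  shows "(\<lambda>x. u x - v x) \<in> W1p \<Omega> p" "AE x in M. D (\<lambda>x. u x - v x) x = D u x - D v x"
proof -
  show "(\<lambda>x. u x - v x) \<in> W1p \<Omega> p"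
    using W1p_add(1)[OF assms(1) W1p_scale(1)[OF assms(2), of "-1"]] by simp
  show "AE x in M. D (\<lambda>x. u x - v x) x = D u x - D v x"
    using W1p_add(2)[OF assms(1) W1p_scale(1)[OF assms(2), of "-1"]] W1p_scale(2)[OF assms(2), of "-1"]
    by eventually_elim simp
qed

lemma LINT_norm_powr_cong:
  fixes f g :: "real^'n \<Rightarrow> 'b::euclidean_space"
  assumes "f \<in> borel_measurable M" "AE x in M. f x = g x"
  shows "(LINT x|M. norm (f x) powr p) = (LINT x|M. norm (g x) powr p)"
proof (rule integral_cong_AE)
  note [measurable] = assms(1) lebesgue_on_measurable_AE[OF assms sets_\<Omega>]
  show "(\<lambda>x. norm (f x) powr p) \<in> borel_measurable M" "(\<lambda>x. norm (g x) powr p) \<in> borel_measurable M"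
    by measurable
  show "AE x in M. norm (f x) powr p = norm (g x) powr p"
    using assms(2) by eventually_elim simp
qed

lemma modular_nonneg: "0 \<le> modular u"
  by (simp add: modular_def add_nonneg_nonneg)

lemma W1p_norm_eq: "W1p_norm \<Omega> p u = modular u powr (1 / p)"
  by (simp add: W1p_norm_def modular_def)

lemma modular_add:
  assumes u: "u \<in> W1p \<Omega> p" and v: "v \<in> W1p \<Omega> p"
  shows "modular (\<lambda>x. u x + v x) \<le> 2 powr p * (modular u + modular v)"
proof -
  have "(LINT x|M. norm (D (\<lambda>x. u x + v x) x) powr p) = (LINT x|M. norm (D u x + D v x) powr p)"
    using W1p_add(2)[OF u v] W1p_D_measurable[OF W1p_add(1)[OF u v]]
    by (intro LINT_norm_powr_cong) auto
  also have "\<dots> \<le> 2 powr p * ((LINT x|M. norm (D u x) powr p) + (LINT x|M. norm (D v x) powr p))"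
    using u v p_pos by (intro Lp_on_add W1pD) auto
  finally show ?thesis
    using Lp_on_add(2)[OF W1pD(1)[OF u] W1pD(1)[OF v] p_pos(2)]
    by (simp add: modular_def distrib_left)
qed

lemma modular_scale:
  assumes u: "u \<in> W1p \<Omega> p"
  shows "modular (\<lambda>x. c * u x) = \<bar>c\<bar> powr p * modular u"
proof -
  have "(LINT x|M. norm (D (\<lambda>x. c * u x) x) powr p) = (LINT x|M. norm (c *\<^sub>R D u x) powr p)"
    using W1p_scale(2)[OF u] W1p_D_measurable[OF W1p_scale(1)[OF u]]
    by (intro LINT_norm_powr_cong) auto
  then show ?thesis
    using Lp_on_scaleR(2)[OF W1pD(1)[OF u], of c] Lp_on_scaleR(2)[OF W1pD(3)[OF u], of c]
    by (simp add: modular_def distrib_left abs_mult)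
qed

lemma modular_minus_commute:
  assumes u: "u \<in> W1p \<Omega> p" and v: "v \<in> W1p \<Omega> p"
  shows "modular (\<lambda>x. u x - v x) = modular (\<lambda>x. v x - u x)"
  using modular_scale[OF W1p_diff(1)[OF u v], of "-1"] by simp

lemma C1_0_W1p:
  assumes "\<phi> \<in> C1_0 \<Omega>"
  shows "\<phi> \<in> W1p \<Omega> p"
proof -
  obtain g K where *: "continuous_on UNIV g" "\<And>x. GDERIV \<phi> x :> g x" "continuous_on UNIV \<phi>"
    "compact K" "K \<subseteq> \<Omega>" "\<And>x. x \<notin> K \<Longrightarrow> \<phi> x = 0" "\<And>x. x \<notin> K \<Longrightarrow> g x = 0"
    by (rule C1_0E[OF assms]) (rule that)
  show ?thesis
  proof (rule W1pI)
    show "has_weak_grad \<Omega> \<phi> g"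
      by (rule C1_0_has_weak_grad[OF sets_\<Omega> assms *(1,2)])
    show "\<phi> \<in> Lp_on p M" "g \<in> Lp_on p M"
      using * p_pos by (auto intro!: continuous_compact_support_Lp_on[OF sets_\<Omega> _ _ *(4,5)])
  qed
qed

lemma W1p_norm_tendsto_0_iff:
  "((\<lambda>k. W1p_norm \<Omega> p (u k)) \<longlonglongrightarrow> 0) \<longleftrightarrow> (\<lambda>k. modular (u k)) \<longlonglongrightarrow> 0"
proof
  assume "(\<lambda>k. W1p_norm \<Omega> p (u k)) \<longlonglongrightarrow> 0"
  then have "(\<lambda>k. W1p_norm \<Omega> p (u k) powr p) \<longlonglongrightarrow> 0 powr p"
    using p_pos by (intro tendsto_powr' tendsto_intros) (auto simp: W1p_norm_eq)
  then show "(\<lambda>k. modular (u k)) \<longlonglongrightarrow> 0"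
    using p_pos by (simp add: W1p_norm_eq powr_powr modular_nonneg)
next
  assume "(\<lambda>k. modular (u k)) \<longlonglongrightarrow> 0"
  then have "(\<lambda>k. modular (u k) powr (1 / p)) \<longlonglongrightarrow> 0 powr (1 / p)"
    using p_pos by (intro tendsto_powr' tendsto_intros) (auto simp: modular_nonneg)
  then show "(\<lambda>k. W1p_norm \<Omega> p (u k)) \<longlonglongrightarrow> 0"
    by (simp add: W1p_norm_eq)
qed

text \<open>With approximations for each \<open>e\<close> in place of sequences, sums and limits of elements need no diagonal
  sequences.\<close>

lemma W1p_0_iff:
  "u \<in> W1p_0 \<Omega> p \<longleftrightarrow> u \<in> W1p \<Omega> p \<and> (\<forall>e>0. \<exists>\<phi>\<in>C1_0 \<Omega>. modular (\<lambda>x. u x - \<phi> x) < e)"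
proof (intro iffI conjI allI impI; (elim conjE)?)
  assume u: "u \<in> W1p_0 \<Omega> p"
  then show "u \<in> W1p \<Omega> p"
    by (simp add: W1p_0_def)
  fix e :: real assume "0 < e"
  obtain \<phi> where \<phi>: "\<And>k::nat. \<phi> k \<in> C1_0 \<Omega>" "(\<lambda>k. modular (\<lambda>x. u x - \<phi> k x)) \<longlonglongrightarrow> 0"
    using u by (auto simp: W1p_0_def W1p_norm_tendsto_0_iff)
  from order_tendstoD(2)[OF \<phi>(2) \<open>0 < e\<close>] obtain k where "modular (\<lambda>x. u x - \<phi> k x) < e"
    by (auto simp: eventually_sequentially)
  then show "\<exists>\<phi>\<in>C1_0 \<Omega>. modular (\<lambda>x. u x - \<phi> x) < e"
    using \<phi>(1) by blast
next
  assume u: "u \<in> W1p \<Omega> p" and ap: "\<forall>e>0. \<exists>\<phi>\<in>C1_0 \<Omega>. modular (\<lambda>x. u x - \<phi> x) < e"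
  have "\<forall>k::nat. \<exists>\<phi>. \<phi> \<in> C1_0 \<Omega> \<and> modular (\<lambda>x. u x - \<phi> x) < 1 / real (Suc k)"
    using ap by (metis of_nat_0_less_iff zero_less_Suc zero_less_divide_1_iff)
  then obtain \<phi> where \<phi>: "\<And>k. \<phi> k \<in> C1_0 \<Omega>" "\<And>k. modular (\<lambda>x. u x - \<phi> k x) < 1 / real (Suc k)"
    by metis
  have "(\<lambda>k. modular (\<lambda>x. u x - \<phi> k x)) \<longlonglongrightarrow> 0"
  proof (rule Lim_null_comparison[OF always_eventually])
    show "\<forall>k. norm (modular (\<lambda>x. u x - \<phi> k x)) \<le> 1 / real (Suc k)"
      using \<phi>(2) by (auto simp: modular_nonneg less_imp_le)
    show "(\<lambda>k. 1 / real (Suc k)) \<longlonglongrightarrow> 0"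
      by (rule LIMSEQ_Suc[OF lim_1_over_n])
  qed
  then show "u \<in> W1p_0 \<Omega> p"
    using u \<phi>(1) by (auto simp: W1p_0_def W1p_norm_tendsto_0_iff)
qed

lemma W1p_0_W1p: "u \<in> W1p_0 \<Omega> p \<Longrightarrow> u \<in> W1p \<Omega> p"
  by (simp add: W1p_0_def)

lemma W1p_0_closed:
  assumes w: "w \<in> W1p \<Omega> p" and ap: "\<And>e. 0 < e \<Longrightarrow> \<exists>v\<in>W1p_0 \<Omega> p. modular (\<lambda>x. w x - v x) < e"
  shows "w \<in> W1p_0 \<Omega> p"
  unfolding W1p_0_iff
proof (intro conjI w allI impI)
  fix e :: real assume "0 < e"
  define d where "d = e / (2 * 2 powr p)"
  have d: "0 < d"
    using \<open>0 < e\<close> by (simp add: d_def)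
  obtain v where v: "v \<in> W1p_0 \<Omega> p" "modular (\<lambda>x. w x - v x) < d"
    using ap[OF d] by blast
  obtain \<phi> where \<phi>: "\<phi> \<in> C1_0 \<Omega>" "modular (\<lambda>x. v x - \<phi> x) < d"
    using v(1) d unfolding W1p_0_iff by blast
  have "modular (\<lambda>x. w x - \<phi> x) \<le> 2 powr p * (modular (\<lambda>x. w x - v x) + modular (\<lambda>x. v x - \<phi> x))"
    using modular_add[OF W1p_diff(1)[OF w W1p_0_W1p[OF v(1)]] W1p_diff(1)[OF W1p_0_W1p[OF v(1)] C1_0_W1p[OF \<phi>(1)]]]
    by simp
  also have "\<dots> < 2 powr p * (d + d)"
    using v(2) \<phi>(2) by (intro mult_strict_left_mono add_strict_mono) auto
  also have "\<dots> = e"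
    by (simp add: d_def field_simps)
  finally show "\<exists>\<phi>\<in>C1_0 \<Omega>. modular (\<lambda>x. w x - \<phi> x) < e"
    using \<phi>(1) by blast
qed

lemma C1_0_W1p_0:
  assumes "\<phi> \<in> C1_0 \<Omega>"
  shows "\<phi> \<in> W1p_0 \<Omega> p"
  unfolding W1p_0_iff
proof (intro conjI allI impI C1_0_W1p assms)
  fix e :: real assume "0 < e"
  have "modular (\<lambda>x. 0 * \<phi> x) = 0"
    using modular_scale[OF C1_0_W1p[OF assms], of 0] p_pos by simp
  then show "\<exists>\<psi>\<in>C1_0 \<Omega>. modular (\<lambda>x. \<phi> x - \<psi> x) < e"
    using assms \<open>0 < e\<close> by (intro bexI[of _ \<phi>]) auto
qed

lemma W1p_0_add:
  assumes u: "u \<in> W1p_0 \<Omega> p" and v: "v \<in> W1p_0 \<Omega> p"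
  shows "(\<lambda>x. u x + v x) \<in> W1p_0 \<Omega> p"
proof (rule W1p_0_closed)
  note W = W1p_0_W1p[OF u] W1p_0_W1p[OF v]
  show "(\<lambda>x. u x + v x) \<in> W1p \<Omega> p"
    using W by (rule W1p_add)
  fix e :: real assume "0 < e"
  define d where "d = e / (2 * 2 powr p)"
  have d: "0 < d"
    using \<open>0 < e\<close> by (simp add: d_def)
  obtain \<phi> where \<phi>: "\<phi> \<in> C1_0 \<Omega>" "modular (\<lambda>x. u x - \<phi> x) < d"
    using u d unfolding W1p_0_iff by blast
  obtain \<psi> where \<psi>: "\<psi> \<in> C1_0 \<Omega>" "modular (\<lambda>x. v x - \<psi> x) < d"
    using v d unfolding W1p_0_iff by blast
  have "modular (\<lambda>x. u x + v x - (\<phi> x + \<psi> x)) \<le> 2 powr p * (modular (\<lambda>x. u x - \<phi> x) + modular (\<lambda>x. v x - \<psi> x))"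
    using modular_add[OF W1p_diff(1)[OF W(1) C1_0_W1p[OF \<phi>(1)]] W1p_diff(1)[OF W(2) C1_0_W1p[OF \<psi>(1)]]]
    by (simp add: algebra_simps)
  also have "\<dots> < 2 powr p * (d + d)"
    using \<phi>(2) \<psi>(2) by (intro mult_strict_left_mono add_strict_mono) auto
  also have "\<dots> = e"
    by (simp add: d_def field_simps)
  finally show "\<exists>z\<in>W1p_0 \<Omega> p. modular (\<lambda>x. u x + v x - z x) < e"
    using C1_0_W1p_0[OF C1_0_add[OF \<phi>(1) \<psi>(1)]] by (intro bexI) auto
qed

lemma W1p_0_scale:
  assumes u: "u \<in> W1p_0 \<Omega> p"
  shows "(\<lambda>x. c * u x) \<in> W1p_0 \<Omega> p"
proof (rule W1p_0_closed)
  note W = W1p_0_W1p[OF u]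
  show "(\<lambda>x. c * u x) \<in> W1p \<Omega> p"
    using W by (rule W1p_scale)
  fix e :: real assume "0 < e"
  define d where "d = e / (\<bar>c\<bar> powr p + 1)"
  have d: "0 < d"
    using \<open>0 < e\<close> by (simp add: d_def add_nonneg_pos)
  obtain \<phi> where \<phi>: "\<phi> \<in> C1_0 \<Omega>" "modular (\<lambda>x. u x - \<phi> x) < d"
    using u d unfolding W1p_0_iff by blast
  have "modular (\<lambda>x. c * u x - c * \<phi> x) = \<bar>c\<bar> powr p * modular (\<lambda>x. u x - \<phi> x)"
    using modular_scale[OF W1p_diff(1)[OF W C1_0_W1p[OF \<phi>(1)]], of c]
    by (simp add: right_diff_distrib)
  also have "\<dots> \<le> \<bar>c\<bar> powr p * d"
    using \<phi>(2) by (intro mult_left_mono) auto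
  also have "\<dots> < (\<bar>c\<bar> powr p + 1) * d"
    using d by simp
  also have "\<dots> = e"
    using powr_ge_zero[of "\<bar>c\<bar>" p] by (simp add: d_def add_nonneg_eq_0_iff)
  finally show "\<exists>z\<in>W1p_0 \<Omega> p. modular (\<lambda>x. c * u x - z x) < e"
    using C1_0_W1p_0[OF C1_0_const_mult[OF \<phi>(1)]] by (intro bexI) auto
qed

lemma W1p_0_diff:
  assumes u: "u \<in> W1p_0 \<Omega> p" and v: "v \<in> W1p_0 \<Omega> p"
  shows "(\<lambda>x. u x - v x) \<in> W1p_0 \<Omega> p"
  using W1p_0_add[OF u W1p_0_scale[OF v, of "-1"]] by simp

lemma zero_W1p_0: "(\<lambda>x. 0) \<in> W1p_0 \<Omega> p"
proof (rule C1_0_W1p_0)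
  show "(\<lambda>x. 0) \<in> C1_0 \<Omega>"
    by (rule C1_0I[OF C1_fun_const, of "{}"]) auto
qed

text \<open>The inequality for test functions passes to their closure, because both sides are continuous for
  \<open>modular\<close> up to the factor \<open>2 powr p\<close> of its triangle inequality.\<close>

lemma Poincare:
  obtains C where "0 \<le> C"
    "\<And>w. w \<in> W1p_0 \<Omega> p \<Longrightarrow> (LINT x|M. \<bar>w x\<bar> powr p) \<le> C * (LINT x|M. norm (D w x) powr p)"
proof -
  obtain R where R: "0 < R" "\<And>x. x \<in> \<Omega> \<Longrightarrow> norm x \<le> R"
    using bounded_\<Omega> by (auto simp: bounded_pos)
  define C1 where "C1 = (2 * p * R) powr p"
  define C2 where "C2 = (2::real) powr p"
  have C: "0 \<le> C1" "0 \<le> C2"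
    by (auto simp: C1_def C2_def)
  show ?thesis
  proof (rule that[of "C2 * (C1 * C2)"])
    show "0 \<le> C2 * (C1 * C2)"
      using C by simp
    fix w assume w: "w \<in> W1p_0 \<Omega> p"
    note W = W1p_0_W1p[OF w]
    define I where "I = (LINT x|M. norm (D w x) powr p)"
    have "(LINT x|M. \<bar>w x\<bar> powr p) \<le> C2 * (C1 * C2) * I + e" if "0 < e" for e
    proof -
      define d where "d = e / (C2 * (C1 * C2) + C2 + 1)"
      have pos: "0 < C2 * (C1 * C2) + C2 + 1"
        using C by (simp add: add_nonneg_pos)
      then have d: "0 < d"
        using that by (simp add: d_def)
      obtain \<phi> where \<phi>: "\<phi> \<in> C1_0 \<Omega>" "modular (\<lambda>x. w x - \<phi> x) < d"
        using w d unfolding W1p_0_iff by blast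
      obtain g K where g: "continuous_on UNIV g" "\<And>x. GDERIV \<phi> x :> g x" "continuous_on UNIV \<phi>"
        "compact K" "K \<subseteq> \<Omega>" "\<And>x. x \<notin> K \<Longrightarrow> \<phi> x = 0" "\<And>x. x \<notin> K \<Longrightarrow> g x = 0"
        by (rule C1_0E[OF \<phi>(1)]) (rule that)
      note P = C1_0_W1p[OF \<phi>(1)]
      note WP = W1p_diff[OF W P]
      have le_d: "(LINT x|M. \<bar>w x - \<phi> x\<bar> powr p) \<le> d" "(LINT x|M. norm (D (\<lambda>x. w x - \<phi> x) x) powr p) \<le> d"
        using \<phi>(2) unfolding modular_def by (smt (verit) Bochner_Integration.integral_nonneg powr_ge_zero)+
      have D\<phi>: "AE x in M. D \<phi> x = g x"
        by (rule weak_grad_AE[OF open_\<Omega> C1_0_has_weak_grad[OF sets_\<Omega> \<phi>(1) g(1,2)]])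
      have "(LINT x|M. norm (D \<phi> x) powr p) = (LINT x|M. norm (D w x + (-1) *\<^sub>R D (\<lambda>x. w x - \<phi> x) x) powr p)"
      proof (rule LINT_norm_powr_cong[OF W1p_D_measurable[OF P]])
        show "AE x in M. D \<phi> x = D w x + (-1) *\<^sub>R D (\<lambda>x. w x - \<phi> x) x"
          using WP(2) by eventually_elim simp
      qed
      also have "\<dots> \<le> C2 * (I + (LINT x|M. norm ((-1) *\<^sub>R D (\<lambda>x. w x - \<phi> x) x) powr p))"
        unfolding C2_def I_def using W WP(1) p_pos by (intro Lp_on_add(2) Lp_on_scaleR(1) W1pD) auto
      also have "\<dots> \<le> C2 * (I + d)"
        using C le_d(2) by (intro mult_left_mono add_left_mono) auto
      finally have 1: "(LINT x|M. norm (D \<phi> x) powr p) \<le> C2 * (I + d)" .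
      have "(LINT x|M. \<bar>\<phi> x\<bar> powr p) \<le> C1 * (LINT x|M. norm (g x) powr p)"
        unfolding C1_def by (rule Poincare_C1[OF sets_\<Omega> R(2) R(1) p_pos(4) \<phi>(1) g(1,2)])
      also have "(LINT x|M. norm (g x) powr p) = (LINT x|M. norm (D \<phi> x) powr p)"
        by (rule LINT_norm_powr_cong[OF W1p_D_measurable[OF P] D\<phi>, symmetric])
      also have "C1 * \<dots> \<le> C1 * (C2 * (I + d))"
        using C 1 by (intro mult_left_mono)
      finally have 2: "(LINT x|M. \<bar>\<phi> x\<bar> powr p) \<le> C1 * (C2 * (I + d))" .
      have "(LINT x|M. norm ((w x - \<phi> x) + \<phi> x) powr p)
          \<le> C2 * ((LINT x|M. norm (w x - \<phi> x) powr p) + (LINT x|M. norm (\<phi> x) powr p))"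
        unfolding C2_def using WP(1) P p_pos by (intro Lp_on_add(2) W1pD) auto
      also have "\<dots> \<le> C2 * (d + C1 * (C2 * (I + d)))"
        using C le_d(1) 2 by (intro mult_left_mono add_mono) auto
      also have "\<dots> = C2 * (C1 * C2) * I + (C2 * (C1 * C2) + C2) * d"
        by (simp add: algebra_simps)
      also have "\<dots> \<le> C2 * (C1 * C2) * I + (C2 * (C1 * C2) + C2 + 1) * d"
        using d by (simp add: algebra_simps)
      also have "(C2 * (C1 * C2) + C2 + 1) * d = e"
        using pos by (simp add: d_def)
      finally show ?thesis by simp
    qed
    then show "(LINT x|M. \<bar>w x\<bar> powr p) \<le> C2 * (C1 * C2) * (LINT x|M. norm (D w x) powr p)"
      unfolding I_def by (rule field_le_epsilon)
  qed
qed

text \<open>Convergence of the gradients in \<open>L\<^sup>p\<close> suffices inside a coset of \<open>W1p_0\<close>, because the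
  Poincare inequality then controls the functions themselves.\<close>

lemma coset_complete:
  assumes u: "\<And>k. u k \<in> W1p \<Omega> p" and u0: "\<And>k. (\<lambda>x. u k x - f x) \<in> W1p_0 \<Omega> p" and f: "f \<in> W1p \<Omega> p"
    and Cauchy: "\<And>e. 0 < e \<Longrightarrow> \<exists>N. \<forall>k\<ge>N. \<forall>l\<ge>N. (LINT x|M. norm (D (u k) x - D (u l) x) powr p) < e"
  obtains v r where "v \<in> W1p \<Omega> p" "(\<lambda>x. v x - f x) \<in> W1p_0 \<Omega> p"
    "strict_mono (r :: nat \<Rightarrow> nat)" "AE x in M. (\<lambda>k. D (u (r k)) x) \<longlonglongrightarrow> D v x"
proof -
  obtain z r where z: "z \<in> Lp_on p M" "(\<lambda>k. LINT x|M. norm (D (u k) x - z x) powr p) \<longlonglongrightarrow> 0"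
    and r: "strict_mono (r :: nat \<Rightarrow> nat)" "AE x in M. (\<lambda>k. D (u (r k)) x) \<longlonglongrightarrow> z x"
    by (rule Lp_on_complete[OF p_pos(1) W1pD(3)[OF u] Cauchy]) (assumption, rule that)
  obtain C where C: "0 \<le> C"
    "\<And>w. w \<in> W1p_0 \<Omega> p \<Longrightarrow> (LINT x|M. \<bar>w x\<bar> powr p) \<le> C * (LINT x|M. norm (D w x) powr p)"
    by (rule Poincare) (rule that)
  have uCauchy: "\<exists>N. \<forall>k\<ge>N. \<forall>l\<ge>N. (LINT x|M. norm (u k x - u l x) powr p) < e" if e: "0 < e" for e
  proof -
    obtain N where N: "\<forall>k\<ge>N. \<forall>l\<ge>N. (LINT x|M. norm (D (u k) x - D (u l) x) powr p) < e / (C + 1)"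
      using Cauchy[of "e / (C + 1)"] e C(1) by auto
    have "(LINT x|M. norm (u k x - u l x) powr p) < e" if kl: "k \<ge> N" "l \<ge> N" for k l
    proof -
      have "(\<lambda>x. u k x - u l x) \<in> W1p_0 \<Omega> p"
        using W1p_0_diff[OF u0[of k] u0[of l]] by simp
      from C(2)[OF this] have "(LINT x|M. \<bar>u k x - u l x\<bar> powr p)
          \<le> C * (LINT x|M. norm (D (\<lambda>x. u k x - u l x) x) powr p)" .
      also have "(LINT x|M. norm (D (\<lambda>x. u k x - u l x) x) powr p) = (LINT x|M. norm (D (u k) x - D (u l) x) powr p)"
        using W1p_diff[OF u u] by (intro LINT_norm_powr_cong W1p_D_measurable) auto
      also have "C * \<dots> \<le> C * (e / (C + 1))"
        using N kl C(1) by (intro mult_left_mono[OF less_imp_le]) auto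
      also have "\<dots> < e"
        using e C(1) by (simp add: field_simps)
      finally show ?thesis by simp
    qed
    then show ?thesis by blast
  qed
  obtain v s where v: "v \<in> Lp_on p M" "(\<lambda>k. LINT x|M. norm (u k x - v x) powr p) \<longlonglongrightarrow> 0"
    and s: "strict_mono (s :: nat \<Rightarrow> nat)" "AE x in M. (\<lambda>k. u (s k) x) \<longlonglongrightarrow> v x"
    by (rule Lp_on_complete[OF p_pos(1) W1pD(1)[OF u] uCauchy]) (assumption, rule that)
  have wg: "has_weak_grad \<Omega> v z"
  proof (rule has_weak_grad_limit[OF sets_\<Omega> W1pD(2)[OF u]])
    show "integrable M (u k)" "integrable M (D (u k))" "integrable M v" "integrable M z" for k
      using v(1) z(1) W1pD[OF u] by (auto intro!: Lp_on_imp_integrable[OF finite_M _ p_pos(3)])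
    show "(\<lambda>k. LINT x|M. norm (u k x - v x)) \<longlonglongrightarrow> 0"
      by (rule Lp_tendsto_imp_L1_tendsto[OF finite_M Lp_on_diff[OF W1pD(1)[OF u] v(1) p_pos(2)] p_pos(3) v(2)])
    show "(\<lambda>k. LINT x|M. norm (D (u k) x - z x)) \<longlonglongrightarrow> 0"
      by (rule Lp_tendsto_imp_L1_tendsto[OF finite_M Lp_on_diff[OF W1pD(3)[OF u] z(1) p_pos(2)] p_pos(3) z(2)])
  qed
  have vW: "v \<in> W1p \<Omega> p"
    using v(1) wg z(1) by (rule W1pI)
  have Dv: "AE x in M. D v x = z x"
    by (rule weak_grad_AE[OF open_\<Omega> wg])
  have "modular (\<lambda>x. v x - u k x) = (LINT x|M. norm (u k x - v x) powr p) + (LINT x|M. norm (D (u k) x - z x) powr p)" for k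
  proof -
    have "(LINT x|M. norm (D (\<lambda>x. u k x - v x) x) powr p) = (LINT x|M. norm (D (u k) x - z x) powr p)"
    proof (rule LINT_norm_powr_cong[OF W1p_D_measurable[OF W1p_diff(1)[OF u vW]]])
      show "AE x in M. D (\<lambda>x. u k x - v x) x = D (u k) x - z x"
        using W1p_diff(2)[OF u vW] Dv by eventually_elim simp
    qed
    then show ?thesis
      using modular_minus_commute[OF vW u] by (simp add: modular_def)
  qed
  then have mod: "(\<lambda>k. modular (\<lambda>x. v x - u k x)) \<longlonglongrightarrow> 0"
    using tendsto_add[OF v(2) z(2)] by simp
  have v0: "(\<lambda>x. v x - f x) \<in> W1p_0 \<Omega> p"
  proof (rule W1p_0_closed)
    show "(\<lambda>x. v x - f x) \<in> W1p \<Omega> p"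
      using vW f by (rule W1p_diff)
    fix e :: real assume "0 < e"
    from order_tendstoD(2)[OF mod this] obtain k where "modular (\<lambda>x. v x - u k x) < e"
      by (auto simp: eventually_sequentially)
    then have "modular (\<lambda>x. v x - f x - (u k x - f x)) < e"
      by simp
    then show "\<exists>w\<in>W1p_0 \<Omega> p. modular (\<lambda>x. v x - f x - w x) < e"
      using u0[of k] by (intro bexI[of _ "\<lambda>x. u k x - f x"])
  qed
  have "AE x in M. (\<lambda>k. D (u (r k)) x) \<longlonglongrightarrow> D v x"
    using r(2) Dv by eventually_elim simp
  with vW v0 r(1) show ?thesis
    by (rule that)
qed

end


section \<open>The constitutive law at a point\<close>

definition flux :: "(real \<Rightarrow> real) \<Rightarrow> 'a::real_normed_vector \<Rightarrow> 'a" where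
  "flux s a = s (norm a) *\<^sub>R a"

locale monotone_law =
  fixes s :: "real \<Rightarrow> real"
  assumes mono: "\<And>a b. 0 \<le> a \<Longrightarrow> a \<le> b \<Longrightarrow> s a * a \<le> s b * b"
    and cont: "continuous_on {0..} s"
    and nonneg: "\<And>E. 0 \<le> E \<Longrightarrow> 0 \<le> s E"
begin

abbreviation Q :: "real \<Rightarrow> real" where
  "Q E \<equiv> integral {0..E} (\<lambda>\<xi>. s \<xi> * \<xi>)"

lemma integrable_law:
  assumes "0 \<le> a"
  shows "(\<lambda>\<xi>. s \<xi> * \<xi>) integrable_on {a..b}"
proof (rule integrable_continuous_real)
  have "continuous_on {a..b} s"
    using cont by (rule continuous_on_subset) (use assms in auto)
  then show "continuous_on {a..b} (\<lambda>\<xi>. s \<xi> * \<xi>)"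
    by (intro continuous_intros)
qed

lemma Q_diff:
  assumes "0 \<le> t" "t \<le> r"
  shows "Q r - Q t = integral {t..r} (\<lambda>\<xi>. s \<xi> * \<xi>)"
  using Henstock_Kurzweil_Integration.integral_combine[OF assms integrable_law[of 0 r]] by simp

lemma Q_subgradient_real:
  assumes "0 \<le> t" "0 \<le> r"
  shows "s t * t * (r - t) \<le> Q r - Q t"
proof (cases "t \<le> r")
  case True
  have "integral {t..r} (\<lambda>\<xi>. s t * t) \<le> integral {t..r} (\<lambda>\<xi>. s \<xi> * \<xi>)"
    using assms mono by (intro integral_le integrable_law) auto
  then show ?thesis
    using True assms Q_diff[of t r] by (simp add: algebra_simps)
next
  case False
  have "integral {r..t} (\<lambda>\<xi>. s \<xi> * \<xi>) \<le> integral {r..t} (\<lambda>\<xi>. s t * t)"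
    using assms mono by (intro integral_le integrable_law) auto
  then show ?thesis
    using False assms Q_diff[of r t] by (simp add: algebra_simps)
qed

text \<open>The Cauchy-Schwarz inequality reduces the vector case to the radial one.\<close>

lemma Q_subgradient:
  fixes a b :: "'a::real_inner"
  shows "flux s a \<bullet> (b - a) \<le> Q (norm b) - Q (norm a)"
proof -
  have "flux s a \<bullet> (b - a) = s (norm a) * (a \<bullet> b) - s (norm a) * norm a * norm a"
    by (simp add: flux_def inner_diff_right dot_square_norm power2_eq_square right_diff_distrib)
  also have "\<dots> \<le> s (norm a) * (norm a * norm b) - s (norm a) * norm a * norm a"
    by (intro diff_right_mono mult_left_mono norm_cauchy_schwarz nonneg) auto
  also have "\<dots> = s (norm a) * norm a * (norm b - norm a)"
    by (simp add: algebra_simps)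
  also have "\<dots> \<le> Q (norm b) - Q (norm a)"
    by (rule Q_subgradient_real) auto
  finally show ?thesis .
qed

lemma Q_nonneg: "0 \<le> E \<Longrightarrow> 0 \<le> Q E"
  using Q_subgradient_real[of 0 E] by simp

lemma Q_le: "0 \<le> E \<Longrightarrow> Q E \<le> s E * E * E"
  using Q_subgradient_real[of E 0] by simp

text \<open>Passing from the midpoint \<open>m\<close> to an endpoint in two steps of the subgradient inequality gains the
  increment of the flux over the first step, which strong monotonicity bounds from below.\<close>

lemma Q_midpoint_convex:
  fixes a b :: "'a::real_inner"
  assumes strong: "\<And>x y::'a. c * norm (y - x) powr p \<le> (flux s y - flux s x) \<bullet> (y - x)"
  shows "2 * c * (norm (b - a) / 4) powr p + 2 * Q (norm ((1/2) *\<^sub>R (a + b))) \<le> Q (norm a) + Q (norm b)"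
proof -
  have step: "flux s m \<bullet> (y - m) + c * (norm (y - m) / 2) powr p \<le> Q (norm y) - Q (norm m)" for m y :: 'a
  proof -
    define d where "d = (1/2) *\<^sub>R (y - m)"
    have "y - m = d + d"
      by (simp add: d_def flip: scaleR_add_left)
    then have 1: "y = (m + d) + d"
      by (simp add: algebra_simps)
    have "flux s (m + d) \<bullet> d \<le> Q (norm y) - Q (norm (m + d))"
      using Q_subgradient[of "m + d" y] 1 by simp
    moreover have "flux s m \<bullet> d \<le> Q (norm (m + d)) - Q (norm m)"
      using Q_subgradient[of m "m + d"] by simp
    moreover have "c * norm d powr p \<le> (flux s (m + d) - flux s m) \<bullet> d"
      using strong[of "m + d" m] by simp
    moreover have "norm d = norm (y - m) / 2"
      by (simp add: d_def)
    moreover have "flux s m \<bullet> (y - m) = 2 * (flux s m \<bullet> d)"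
      by (simp add: d_def)
    ultimately show ?thesis
      by (simp add: inner_diff_left)
  qed
  define m where "m = (1/2) *\<^sub>R (a + b)"
  have bm: "b - m = (1/2) *\<^sub>R (b - a)"
    by (simp add: m_def algebra_simps) (simp flip: scaleR_add_left)
  then have am: "a - m = - (b - m)"
    by (simp add: m_def algebra_simps flip: scaleR_add_left)
  have "flux s m \<bullet> (b - m) + c * (norm (b - a) / 4) powr p \<le> Q (norm b) - Q (norm m)"
    using step[of m b] by (simp add: bm)
  moreover have "- (flux s m \<bullet> (b - m)) + c * (norm (b - a) / 4) powr p \<le> Q (norm a) - Q (norm m)"
    using step[of m a] unfolding am by (simp add: bm)
  ultimately show ?thesis
    by (simp flip: m_def)
qed

lemma Q_tendsto:
  assumes r: "r \<longlonglongrightarrow> t" and r0: "\<And>k::nat. 0 \<le> r k" and t: "0 \<le> t"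
  shows "(\<lambda>k. Q (r k)) \<longlonglongrightarrow> Q t"
proof (rule continuous_on_tendsto_compose[OF _ r])
  show "continuous_on {0..t + 1} Q"
    using integrable_law[of 0 "t + 1"] by (intro indefinite_integral_continuous_1) auto
  show "t \<in> {0..t + 1}"
    using t by simp
  have "\<forall>\<^sub>F k in sequentially. r k < t + 1"
    using r by (rule order_tendstoD) simp
  then show "\<forall>\<^sub>F k in sequentially. r k \<in> {0..t + 1}"
    by eventually_elim (use r0 in \<open>auto simp: less_imp_le\<close>)
qed

lemma law_tendsto:
  assumes "r \<longlonglongrightarrow> t" "\<And>k::nat. 0 \<le> r k" "0 \<le> t"
  shows "(\<lambda>k. s (r k)) \<longlonglongrightarrow> s t"
  using continuous_on_tendsto_compose[OF cont assms(1)] assms(2,3) by simp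

lemma flux_tendsto:
  fixes a :: "'a::real_normed_vector"
  assumes "r \<longlonglongrightarrow> a"
  shows "(\<lambda>k::nat. flux s (r k)) \<longlonglongrightarrow> flux s a"
  unfolding flux_def using assms law_tendsto[OF tendsto_norm[OF assms]]
  by (intro tendsto_scaleR) auto

text \<open>The subgradient inequality at both ends of a subinterval squeezes the integral over it between
  the two endpoint values of the integrand; the differences telescope.\<close>

lemma Q_Riemann_sums:
  assumes E: "0 \<le> E"
  shows "(\<lambda>n. \<Sum>j<Suc n. s (real j * E / real (Suc n)) * (real j * E / real (Suc n)) * (E / real (Suc n))) \<longlonglongrightarrow> Q E"
proof -
  define t where "t n j = real j * E / real (Suc n)" for n j
  define S where "S n = (\<Sum>j<Suc n. s (t n j) * t n j * (E / real (Suc n)))" for n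
  have t0: "0 \<le> t n j" for n j
    using E by (simp add: t_def)
  have dt: "t n (Suc j) - t n j = E / real (Suc n)" for n j
    by (simp add: t_def diff_divide_distrib[symmetric] algebra_simps)
  have Q: "Q E = (\<Sum>j<Suc n. Q (t n (Suc j)) - Q (t n j))" for n
    by (subst sum_lessThan_telescope) (simp add: t_def)
  have lower: "S n \<le> Q E" for n
    unfolding S_def Q[of n]
  proof (rule sum_mono)
    fix j
    show "s (t n j) * t n j * (E / real (Suc n)) \<le> Q (t n (Suc j)) - Q (t n j)"
      using Q_subgradient_real[OF t0[of n j] t0[of n "Suc j"]] unfolding dt .
  qed
  have upper: "Q E \<le> S n + s E * E * E / real (Suc n)" for n
  proof -
    have "Q E - S n \<le> (\<Sum>j<Suc n. (s (t n (Suc j)) * t n (Suc j) - s (t n j) * t n j) * (E / real (Suc n)))"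
      unfolding S_def Q[of n] sum_subtractf[symmetric]
    proof (rule sum_mono)
      fix j
      have "s (t n (Suc j)) * t n (Suc j) * (- (E / real (Suc n))) \<le> Q (t n j) - Q (t n (Suc j))"
        using Q_subgradient_real[OF t0[of n "Suc j"] t0[of n j]] unfolding minus_diff_eq[of "t n (Suc j)" "t n j", symmetric] dt .
      then show "Q (t n (Suc j)) - Q (t n j) - s (t n j) * t n j * (E / real (Suc n))
          \<le> (s (t n (Suc j)) * t n (Suc j) - s (t n j) * t n j) * (E / real (Suc n))"
        by (simp only: left_diff_distrib mult_minus_right)
    qed
    also have "\<dots> = (\<Sum>j<Suc n. s (t n (Suc j)) * t n (Suc j) - s (t n j) * t n j) * (E / real (Suc n))"
      by (simp only: sum_distrib_right)
    also have "(\<Sum>j<Suc n. s (t n (Suc j)) * t n (Suc j) - s (t n j) * t n j) = s E * E"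
      by (subst sum_lessThan_telescope) (simp add: t_def)
    finally show ?thesis by simp
  qed
  have "(\<lambda>n. s E * E * E / real (Suc n)) \<longlonglongrightarrow> 0"
    using LIMSEQ_Suc[OF lim_const_over_n[of "s E * E * E"]] by simp
  then have "(\<lambda>n. Q E - s E * E * E / real (Suc n)) \<longlonglongrightarrow> Q E - 0"
    by (intro tendsto_intros)
  then have "S \<longlonglongrightarrow> Q E"
    by (intro tendsto_sandwich[of "\<lambda>n. Q E - s E * E * E / real (Suc n)" S _ "\<lambda>n. Q E"] always_eventually)
      (use lower upper in \<open>auto simp: diff_le_eq\<close>)
  then show ?thesis
    by (simp only: S_def[abs_def] t_def)
qed

end


section \<open>Energy and flux of a vector field\<close>

locale dirichlet_problem = bounded_open \<Omega> p for \<Omega> :: "(real^'n) set" and p :: real +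
  fixes \<sigma> :: "real^'n \<Rightarrow> real \<Rightarrow> real" and c C :: real
  assumes measurable_\<sigma>: "\<And>E. 0 \<le> E \<Longrightarrow> (\<lambda>x. \<sigma> x E) \<in> borel_measurable M"
    and law: "AE x in M. monotone_law (\<sigma> x)"
    and growth: "AE x in M. \<forall>E\<ge>0. \<sigma> x E \<le> C * (1 + E) powr (p - 2)"
    and C_nonneg: "0 \<le> C"
    and c_pos: "0 < c"
    and strongly_monotone: "AE x in M. \<forall>a b::real^'n.
          c * norm (b - a) powr p \<le> (flux (\<sigma> x) b - flux (\<sigma> x) a) \<bullet> (b - a)"
begin

lemma borel_measurable_AE_LIMSEQ:
  fixes f :: "nat \<Rightarrow> real^'n \<Rightarrow> real"
  assumes [measurable]: "\<And>n. f n \<in> borel_measurable M" and lim: "AE x in M. (\<lambda>n. f n x) \<longlonglongrightarrow> g x"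
  shows "g \<in> borel_measurable M"
proof (rule lebesgue_on_measurable_AE[OF _ _ sets_\<Omega>])
  show "(\<lambda>x. lim (\<lambda>n. f n x)) \<in> borel_measurable M"
    by measurable
  show "AE x in M. lim (\<lambda>n. f n x) = g x"
    using lim by eventually_elim (rule limI)
qed

text \<open>The arguments are rounded down to multiples of \<open>1 / (n + 1)\<close>, which leaves countably many
  measurable sections of the law; continuity in the second argument gives the limit.\<close>

lemma borel_measurable_law:
  assumes [measurable]: "g \<in> borel_measurable M" and g: "\<And>x. 0 \<le> g x"
  shows "(\<lambda>x. \<sigma> x (g x)) \<in> borel_measurable M"
proof (rule borel_measurable_AE_LIMSEQ)
  define q where "q n x = nat \<lfloor>real (Suc n) * g x\<rfloor>" for n x
  show "(\<lambda>x. \<sigma> x (real (q n x) / real (Suc n))) \<in> borel_measurable M" for n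
  proof (rule measurable_compose_countable[where f="\<lambda>i x. \<sigma> x (real i / real (Suc n))"])
    show "(\<lambda>x. \<sigma> x (real i / real (Suc n))) \<in> borel_measurable M" for i :: nat
      by (rule measurable_\<sigma>) simp
    show "q n \<in> measurable M (count_space UNIV)"
      unfolding q_def by measurable
  qed
  have lim: "(\<lambda>n. real (q n x) / real (Suc n)) \<longlonglongrightarrow> g x" for x
  proof (rule tendsto_sandwich[where f="\<lambda>n. g x - 1 / real (Suc n)" and h="\<lambda>n. g x"])
    have q: "real (q n x) \<le> real (Suc n) * g x" "real (Suc n) * g x - 1 \<le> real (q n x)" for n
      using g[of x] by (auto simp: q_def of_nat_nat simp del: of_nat_Suc)
    show "\<forall>\<^sub>F n in sequentially. real (q n x) / real (Suc n) \<le> g x"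
      using q(1) by (intro always_eventually) (simp add: pos_divide_le_eq mult.commute del: of_nat_Suc)
    show "\<forall>\<^sub>F n in sequentially. g x - 1 / real (Suc n) \<le> real (q n x) / real (Suc n)"
    proof (intro always_eventually allI)
      fix n
      have "g x - 1 / real (Suc n) = (real (Suc n) * g x - 1) / real (Suc n)"
        by (simp add: diff_divide_distrib del: of_nat_Suc)
      also have "\<dots> \<le> real (q n x) / real (Suc n)"
        using q(2) by (intro divide_right_mono) auto
      finally show "g x - 1 / real (Suc n) \<le> real (q n x) / real (Suc n)" .
    qed
    have "(\<lambda>n. g x - 1 / real (Suc n)) \<longlonglongrightarrow> g x - 0"
      by (intro tendsto_intros LIMSEQ_Suc[OF lim_1_over_n])
    then show "(\<lambda>n. g x - 1 / real (Suc n)) \<longlonglongrightarrow> g x"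
      by simp
  qed simp
  show "AE x in M. (\<lambda>n. \<sigma> x (real (q n x) / real (Suc n))) \<longlonglongrightarrow> \<sigma> x (g x)"
    using law
  proof eventually_elim
    case (elim x)
    show ?case
      by (rule monotone_law.law_tendsto[OF elim lim]) (use g in auto)
  qed
qed

lemma borel_measurable_flux:
  fixes v :: "real^'n \<Rightarrow> real^'n"
  assumes [measurable]: "v \<in> borel_measurable M"
  shows "(\<lambda>x. flux (\<sigma> x) (v x)) \<in> borel_measurable M"
proof -
  have "(\<lambda>x. \<sigma> x (norm (v x))) \<in> borel_measurable M"
    by (rule borel_measurable_law) auto
  then show ?thesis
    unfolding flux_def using assms by (rule borel_measurable_scaleR)
qed

text \<open>The energy density is a pointwise limit of Riemann sums, whose terms are values of the law at measurable
  arguments.\<close>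

lemma borel_measurable_Q:
  assumes [measurable]: "g \<in> borel_measurable M" and g: "\<And>x. 0 \<le> g x"
  shows "(\<lambda>x. Q_density \<sigma> x (g x)) \<in> borel_measurable M"
proof (rule borel_measurable_AE_LIMSEQ)
  fix n
  have [measurable]: "(\<lambda>x. \<sigma> x (real j * g x / real (Suc n))) \<in> borel_measurable M" for j
    using g by (intro borel_measurable_law) auto
  show "(\<lambda>x. \<Sum>j<Suc n. \<sigma> x (real j * g x / real (Suc n)) * (real j * g x / real (Suc n)) * (g x / real (Suc n)))
      \<in> borel_measurable M"
    by measurable
next
  show "AE x in M. (\<lambda>n. \<Sum>j<Suc n. \<sigma> x (real j * g x / real (Suc n)) * (real j * g x / real (Suc n)) * (g x / real (Suc n)))
      \<longlonglongrightarrow> Q_density \<sigma> x (g x)"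
    using law
  proof eventually_elim
    case (elim x)
    show ?case
      unfolding Q_density_def by (rule monotone_law.Q_Riemann_sums[OF elim g])
  qed
qed

lemma flux_inner_bound:
  assumes "monotone_law (\<sigma> x)" "\<forall>E\<ge>0. \<sigma> x E \<le> C * (1 + E) powr (p - 2)"
    and "norm a \<le> m" "norm b \<le> m"
  shows "\<bar>flux (\<sigma> x) a \<bullet> b\<bar> \<le> C * (1 + m) powr p"
proof -
  have m: "0 \<le> m"
    using assms(3) norm_ge_zero order_trans by blast
  have s: "0 \<le> \<sigma> x (norm a)"
    using monotone_law.nonneg[OF assms(1)] by simp
  have "\<bar>flux (\<sigma> x) a \<bullet> b\<bar> \<le> norm (flux (\<sigma> x) a) * norm b"
    by (rule Cauchy_Schwarz_ineq2)
  also have "\<dots> = \<sigma> x (norm a) * (norm a * norm b)"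
    using s by (simp add: flux_def)
  also have "\<dots> \<le> C * (1 + norm a) powr (p - 2) * ((1 + m) * (1 + m))"
    using assms(2-4) m s C_nonneg by (intro mult_mono) auto
  also have "\<dots> \<le> C * (1 + m) powr (p - 2) * ((1 + m) * (1 + m))"
    using assms(3) m C_nonneg p_ge_2 by (intro mult_right_mono mult_left_mono powr_mono2) auto
  also have "\<dots> = C * ((1 + m) powr (p - 2) * (1 + m) powr 2)"
    using m by (simp add: power2_eq_square)
  also have "\<dots> = C * (1 + m) powr p"
    by (simp flip: powr_add)
  finally show ?thesis .
qed

lemma Q_bound:
  assumes "monotone_law (\<sigma> x)" "\<forall>E\<ge>0. \<sigma> x E \<le> C * (1 + E) powr (p - 2)"
  shows "0 \<le> Q_density \<sigma> x (norm (a::real^'n))" "Q_density \<sigma> x (norm a) \<le> C * (1 + norm a) powr p"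
proof -
  show "0 \<le> Q_density \<sigma> x (norm a)"
    unfolding Q_density_def by (rule monotone_law.Q_nonneg[OF assms(1)]) simp
  have "Q_density \<sigma> x (norm a) \<le> flux (\<sigma> x) a \<bullet> a"
    unfolding Q_density_def using monotone_law.Q_le[OF assms(1), of "norm a"]
    by (simp add: flux_def dot_square_norm power2_eq_square mult.assoc)
  also have "\<dots> \<le> \<bar>flux (\<sigma> x) a \<bullet> a\<bar>"
    by simp
  also have "\<dots> \<le> C * (1 + norm a) powr p"
    by (rule flux_inner_bound[OF assms]) auto
  finally show "Q_density \<sigma> x (norm a) \<le> C * (1 + norm a) powr p" .
qed

lemma integrable_majorant:
  fixes v w :: "real^'n \<Rightarrow> real^'n"
  assumes v: "v \<in> Lp_on p M" and w: "w \<in> Lp_on p M" and B: "0 \<le> B"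
  shows "integrable M (\<lambda>x. C * (1 + (norm (v x) + B * norm (w x))) powr p)"
proof -
  have one: "(\<lambda>x. 1::real) \<in> Lp_on p M"
    using finite_measure.integrable_const[OF finite_M] by (auto simp: Lp_on_def)
  have nv: "(\<lambda>x. norm (v x)) \<in> Lp_on p M"
    using v by (auto simp: Lp_on_def)
  have nw: "(\<lambda>x. B *\<^sub>R norm (w x)) \<in> Lp_on p M"
    by (rule Lp_on_scaleR) (use w in \<open>auto simp: Lp_on_def\<close>)
  have "integrable M (\<lambda>x. norm (1 + (norm (v x) + B *\<^sub>R norm (w x))) powr p)"
    using p_pos(2) by (intro Lp_on_integrable Lp_on_add one nv nw)
  moreover have "norm (1 + (norm (v x) + B *\<^sub>R norm (w x))) = 1 + (norm (v x) + B * norm (w x))" for x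
    using B by simp
  ultimately show ?thesis
    by simp
qed

lemma integrable_flux_inner:
  fixes v w :: "real^'n \<Rightarrow> real^'n"
  assumes v: "v \<in> Lp_on p M" and w: "w \<in> Lp_on p M"
  shows "integrable M (\<lambda>x. flux (\<sigma> x) (v x) \<bullet> w x)"
proof (rule Bochner_Integration.integrable_bound[OF integrable_majorant[OF v w, of 1]])
  show "(\<lambda>x. flux (\<sigma> x) (v x) \<bullet> w x) \<in> borel_measurable M"
    using borel_measurable_flux[OF Lp_on_measurable[OF v]] Lp_on_measurable[OF w] by measurable
  show "AE x in M. norm (flux (\<sigma> x) (v x) \<bullet> w x) \<le> norm (C * (1 + (norm (v x) + 1 * norm (w x))) powr p)"
    using law growth
  proof eventually_elim
    case (elim x)
    have "\<bar>flux (\<sigma> x) (v x) \<bullet> w x\<bar> \<le> C * (1 + (norm (v x) + norm (w x))) powr p"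
      by (rule flux_inner_bound[OF elim]) auto
    then show ?case
      using C_nonneg by simp
  qed
qed simp

lemma integrable_Q:
  fixes v :: "real^'n \<Rightarrow> real^'n"
  assumes v: "v \<in> Lp_on p M"
  shows "integrable M (\<lambda>x. Q_density \<sigma> x (norm (v x)))"
proof (rule Bochner_Integration.integrable_bound[OF integrable_majorant[OF v v, of 0]])
  note [measurable] = Lp_on_measurable[OF v]
  show "(\<lambda>x. Q_density \<sigma> x (norm (v x))) \<in> borel_measurable M"
    by (rule borel_measurable_Q) auto
  show "AE x in M. norm (Q_density \<sigma> x (norm (v x))) \<le> norm (C * (1 + (norm (v x) + 0 * norm (v x))) powr p)"
    using law growth
  proof eventually_elim
    case (elim x)
    then show ?case
      using Q_bound[OF elim, of "v x"] C_nonneg by simp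
  qed
qed simp

lemma flux_inner_tendsto:
  fixes v w :: "real^'n \<Rightarrow> real^'n"
  assumes v: "v \<in> Lp_on p M" and w: "w \<in> Lp_on p M"
  shows "((\<lambda>\<epsilon>. LINT x|M. flux (\<sigma> x) (v x + \<epsilon> *\<^sub>R w x) \<bullet> w x) \<longlongrightarrow> (LINT x|M. flux (\<sigma> x) (v x) \<bullet> w x)) (at 0)"
  unfolding tendsto_at_iff_sequentially comp_def
proof (intro allI impI)
  fix X :: "nat \<Rightarrow> real" assume "\<forall>i. X i \<in> UNIV - {0}" and X: "X \<longlonglongrightarrow> 0"
  then obtain B where B: "0 < B" "\<And>k. \<bar>X k\<bar> \<le> B"
    using Bseq_def[of X] convergent_imp_Bseq[OF convergentI[OF X]] by auto
  note [measurable] = Lp_on_measurable[OF v] Lp_on_measurable[OF w]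
  have [measurable]: "(\<lambda>x. flux (\<sigma> x) (v x + \<epsilon> *\<^sub>R w x)) \<in> borel_measurable M" for \<epsilon>
    by (rule borel_measurable_flux) measurable
  have [measurable]: "(\<lambda>x. flux (\<sigma> x) (v x)) \<in> borel_measurable M"
    by (rule borel_measurable_flux) measurable
  show "(\<lambda>k. LINT x|M. flux (\<sigma> x) (v x + X k *\<^sub>R w x) \<bullet> w x) \<longlonglongrightarrow> (LINT x|M. flux (\<sigma> x) (v x) \<bullet> w x)"
  proof (rule integral_dominated_convergence)
    show "integrable M (\<lambda>x. C * (1 + (norm (v x) + (B + 1) * norm (w x))) powr p)"
      using B by (intro integrable_majorant v w) simp
    show "AE x in M. (\<lambda>k. flux (\<sigma> x) (v x + X k *\<^sub>R w x) \<bullet> w x) \<longlonglongrightarrow> flux (\<sigma> x) (v x) \<bullet> w x"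
      using law
    proof eventually_elim
      case (elim x)
      have "(\<lambda>k. v x + X k *\<^sub>R w x) \<longlonglongrightarrow> v x + 0 *\<^sub>R w x"
        by (intro tendsto_intros X)
      then have "(\<lambda>k. flux (\<sigma> x) (v x + X k *\<^sub>R w x)) \<longlonglongrightarrow> flux (\<sigma> x) (v x)"
        by (intro monotone_law.flux_tendsto[OF elim]) simp
      then show ?case
        by (intro tendsto_intros)
    qed
    show "AE x in M. norm (flux (\<sigma> x) (v x + X k *\<^sub>R w x) \<bullet> w x) \<le> C * (1 + (norm (v x) + (B + 1) * norm (w x))) powr p" for k
      using law growth
    proof eventually_elim
      case (elim x)
      have "norm (v x + X k *\<^sub>R w x) \<le> norm (v x) + \<bar>X k\<bar> * norm (w x)"
        using norm_triangle_ineq[of "v x" "X k *\<^sub>R w x"] by simp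
      also have "\<dots> \<le> norm (v x) + (B + 1) * norm (w x)"
        using B(2)[of k] by (intro add_left_mono mult_right_mono) auto
      finally have "norm (v x + X k *\<^sub>R w x) \<le> norm (v x) + (B + 1) * norm (w x)" .
      moreover have "norm (w x) \<le> norm (v x) + (B + 1) * norm (w x)"
        using B(1) by (simp add: distrib_right add_increasing)
      ultimately show ?case
        unfolding real_norm_def by (rule flux_inner_bound[OF elim])
    qed
  qed auto
qed

end


context bounded_open
begin

section \<open>Boundary classes\<close>

lemma trace_class_iff: "u \<in> trace_class \<Omega> p f \<longleftrightarrow> u \<in> W1p \<Omega> p \<and> (\<lambda>x. u x - f x) \<in> W1p_0 \<Omega> p"
  by (simp add: trace_class_def)

lemma trace_class_self: "f \<in> W1p \<Omega> p \<Longrightarrow> f \<in> trace_class \<Omega> p f"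
  using zero_W1p_0 by (simp add: trace_class_iff)

lemma trace_class_diff:
  assumes "u \<in> trace_class \<Omega> p f" "v \<in> trace_class \<Omega> p f"
  shows "(\<lambda>x. u x - v x) \<in> W1p_0 \<Omega> p"
  using W1p_0_diff[of "\<lambda>x. u x - f x" "\<lambda>x. v x - f x"] assms by (simp add: trace_class_iff)

lemma trace_class_add_W1p_0:
  assumes "u \<in> trace_class \<Omega> p f" "w \<in> W1p_0 \<Omega> p"
  shows "(\<lambda>x. u x + w x) \<in> trace_class \<Omega> p f"
  using W1p_0_add[of "\<lambda>x. u x - f x" w] assms W1p_add(1)[of u w] W1p_0_W1p[of w]
  by (simp add: trace_class_iff algebra_simps)

lemma trace_class_add:
  assumes "u \<in> trace_class \<Omega> p f" "v \<in> trace_class \<Omega> p g"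
  shows "(\<lambda>x. u x + v x) \<in> trace_class \<Omega> p (\<lambda>x. f x + g x)"
  using W1p_0_add[of "\<lambda>x. u x - f x" "\<lambda>x. v x - g x"] assms W1p_add(1)[of u v]
  by (simp add: trace_class_iff algebra_simps)

lemma trace_class_scale:
  assumes "u \<in> trace_class \<Omega> p f"
  shows "(\<lambda>x. a * u x) \<in> trace_class \<Omega> p (\<lambda>x. a * f x)"
  using W1p_0_scale[of "\<lambda>x. u x - f x" a] assms W1p_scale(1)[of u a]
  by (simp add: trace_class_iff algebra_simps)

lemma trace_add_class:
  assumes "f \<in> W1p \<Omega> p" "g \<in> W1p \<Omega> p"
  shows "trace_add (trace_class \<Omega> p f) (trace_class \<Omega> p g) = trace_class \<Omega> p (\<lambda>x. f x + g x)"
proof (intro equalityI subsetI)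
  fix z assume "z \<in> trace_add (trace_class \<Omega> p f) (trace_class \<Omega> p g)"
  then show "z \<in> trace_class \<Omega> p (\<lambda>x. f x + g x)"
    by (auto simp: trace_add_def intro: trace_class_add)
next
  fix z assume z: "z \<in> trace_class \<Omega> p (\<lambda>x. f x + g x)"
  then have "(\<lambda>x. z x - g x) \<in> trace_class \<Omega> p f"
    using W1p_diff(1)[of z g] assms by (simp add: trace_class_iff algebra_simps)
  moreover have "z = (\<lambda>x. (z x - g x) + g x)"
    by simp
  ultimately show "z \<in> trace_add (trace_class \<Omega> p f) (trace_class \<Omega> p g)"
    unfolding trace_add_def using trace_class_self[OF assms(2)]
    by (intro CollectI exI[of _ "\<lambda>x. z x - g x"] exI[of _ g] conjI)
qed

lemma trace_scale_class:
  assumes "f \<in> W1p \<Omega> p"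
  shows "trace_scale \<Omega> p a (trace_class \<Omega> p f) = trace_class \<Omega> p (\<lambda>x. a * f x)"
proof (intro equalityI subsetI)
  fix z assume "z \<in> trace_scale \<Omega> p a (trace_class \<Omega> p f)"
  then show "z \<in> trace_class \<Omega> p (\<lambda>x. a * f x)"
    by (auto simp: trace_scale_def intro!: trace_class_add_W1p_0 trace_class_scale)
next
  fix z assume "z \<in> trace_class \<Omega> p (\<lambda>x. a * f x)"
  then have "(\<lambda>x. z x - a * f x) \<in> W1p_0 \<Omega> p"
    by (simp add: trace_class_iff)
  moreover have "z = (\<lambda>x. a * f x + (z x - a * f x))"
    by simp
  ultimately show "z \<in> trace_scale \<Omega> p a (trace_class \<Omega> p f)"
    unfolding trace_scale_def using trace_class_self[OF assms]
    by (intro CollectI exI[of _ f] exI[of _ "\<lambda>x. z x - a * f x"] conjI)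
qed

end


section \<open>The minimizer and its Euler-Lagrange equation\<close>

context dirichlet_problem
begin

abbreviation energy :: "(real^'n \<Rightarrow> real) \<Rightarrow> real" where
  "energy \<equiv> dirichlet_energy \<Omega> \<sigma>"

abbreviation minimizer :: "(real^'n \<Rightarrow> real) \<Rightarrow> real^'n \<Rightarrow> real" where
  "minimizer f \<equiv> energy_minimizer \<Omega> \<sigma> (trace_class \<Omega> p f)"

text \<open>For \<open>v = D u\<close> this is the weak form of \<open>- div (\<sigma> (x, \<bar>\<nabla>u\<bar>) \<nabla>u)\<close>. The field stays separate from the
  test function because the functional is linear only in the latter.\<close>

definition flux_pairing :: "(real^'n \<Rightarrow> real^'n) \<Rightarrow> (real^'n \<Rightarrow> real) \<Rightarrow> real" where
  "flux_pairing v w = (LINT x|M. flux (\<sigma> x) (v x) \<bullet> D w x)"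

lemma flux_pairing_cong:
  assumes v: "v \<in> Lp_on p M" and w: "w \<in> W1p \<Omega> p" and z: "z \<in> Lp_on p M" and eq: "AE x in M. D w x = z x"
  shows "flux_pairing v w = (LINT x|M. flux (\<sigma> x) (v x) \<bullet> z x)"
  unfolding flux_pairing_def
proof (rule integral_cong_AE)
  show "(\<lambda>x. flux (\<sigma> x) (v x) \<bullet> D w x) \<in> borel_measurable M" "(\<lambda>x. flux (\<sigma> x) (v x) \<bullet> z x) \<in> borel_measurable M"
    using integrable_flux_inner[OF v W1pD(3)[OF w]] integrable_flux_inner[OF v z] by auto
  show "AE x in M. flux (\<sigma> x) (v x) \<bullet> D w x = flux (\<sigma> x) (v x) \<bullet> z x"
    using eq by eventually_elim simp
qed

lemma flux_pairing_add:
  assumes v: "v \<in> Lp_on p M" and w: "w \<in> W1p \<Omega> p" and z: "z \<in> W1p \<Omega> p"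
  shows "flux_pairing v (\<lambda>x. w x + z x) = flux_pairing v w + flux_pairing v z"
proof -
  have "flux_pairing v (\<lambda>x. w x + z x) = (LINT x|M. flux (\<sigma> x) (v x) \<bullet> (D w x + D z x))"
    using v w z p_pos(2) by (intro flux_pairing_cong W1p_add Lp_on_add(1) W1pD)
  also have "\<dots> = flux_pairing v w + flux_pairing v z"
    using integrable_flux_inner[OF v W1pD(3)[OF w]] integrable_flux_inner[OF v W1pD(3)[OF z]]
    by (simp add: inner_add_right flux_pairing_def)
  finally show ?thesis .
qed

lemma flux_pairing_scale:
  assumes v: "v \<in> Lp_on p M" and w: "w \<in> W1p \<Omega> p"
  shows "flux_pairing v (\<lambda>x. a * w x) = a * flux_pairing v w"
proof -
  have "flux_pairing v (\<lambda>x. a * w x) = (LINT x|M. flux (\<sigma> x) (v x) \<bullet> (a *\<^sub>R D w x))"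
    using v w by (intro flux_pairing_cong W1p_scale Lp_on_scaleR(1) W1pD)
  also have "\<dots> = a * flux_pairing v w"
    by (simp add: flux_pairing_def)
  finally show ?thesis .
qed

lemma energy_eq:
  assumes u: "u \<in> W1p \<Omega> p" and v: "v \<in> Lp_on p M" and eq: "AE x in M. D u x = v x"
  shows "energy u = (LINT x|M. Q_density \<sigma> x (norm (v x)))"
  unfolding dirichlet_energy_def
proof (rule integral_cong_AE)
  show "(\<lambda>x. Q_density \<sigma> x (norm (D u x))) \<in> borel_measurable M" "(\<lambda>x. Q_density \<sigma> x (norm (v x))) \<in> borel_measurable M"
    using integrable_Q[OF W1pD(3)[OF u]] integrable_Q[OF v] by auto
  show "AE x in M. Q_density \<sigma> x (norm (D u x)) = Q_density \<sigma> x (norm (v x))"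
    using eq by eventually_elim simp
qed

lemma energy_nonneg: "0 \<le> energy u"
  unfolding dirichlet_energy_def
proof (rule integral_nonneg_AE)
  show "AE x in M. 0 \<le> Q_density \<sigma> x (norm (D u x))"
    using law growth by eventually_elim (rule Q_bound)
qed

lemma Q_subgradient_integral:
  assumes v: "v \<in> Lp_on p M" and w: "w \<in> Lp_on p M"
  shows "(LINT x|M. flux (\<sigma> x) (v x) \<bullet> (w x - v x))
      \<le> (LINT x|M. Q_density \<sigma> x (norm (w x))) - (LINT x|M. Q_density \<sigma> x (norm ((v::real^'n \<Rightarrow> real^'n) x)))"
proof -
  have "(LINT x|M. flux (\<sigma> x) (v x) \<bullet> (w x - v x)) \<le> (LINT x|M. Q_density \<sigma> x (norm (w x)) - Q_density \<sigma> x (norm (v x)))"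
  proof (rule integral_mono_AE)
    show "integrable M (\<lambda>x. flux (\<sigma> x) (v x) \<bullet> (w x - v x))"
      using v w p_pos(2) by (intro integrable_flux_inner Lp_on_diff)
    show "AE x in M. flux (\<sigma> x) (v x) \<bullet> (w x - v x) \<le> Q_density \<sigma> x (norm (w x)) - Q_density \<sigma> x (norm (v x))"
      using law unfolding Q_density_def by eventually_elim (rule monotone_law.Q_subgradient)
  qed (intro Bochner_Integration.integrable_diff integrable_Q v w)
  then show ?thesis
    using integrable_Q[OF v] integrable_Q[OF w] by simp
qed

lemma energy_subgradient:
  assumes u: "u \<in> W1p \<Omega> p" and v: "v \<in> W1p \<Omega> p"
  shows "flux_pairing (D u) (\<lambda>x. v x - u x) \<le> energy v - energy u"
proof -
  have "flux_pairing (D u) (\<lambda>x. v x - u x) = (LINT x|M. flux (\<sigma> x) (D u x) \<bullet> (D v x - D u x))"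
    using u v p_pos(2) by (intro flux_pairing_cong W1p_diff Lp_on_diff W1pD)
  with Q_subgradient_integral[OF W1pD(3)[OF u] W1pD(3)[OF v]] show ?thesis
    by (simp add: dirichlet_energy_def)
qed

text \<open>Here the subgradient is taken at the far end \<open>u + \<epsilon> w\<close> of the segment, which bounds the increment
  from above.\<close>

lemma energy_line_le:
  assumes u: "u \<in> W1p \<Omega> p" and w: "w \<in> W1p \<Omega> p"
  shows "energy (\<lambda>x. u x + \<epsilon> * w x) - energy u \<le> \<epsilon> * flux_pairing (\<lambda>x. D u x + \<epsilon> *\<^sub>R D w x) w"
proof -
  define v where "v x = D u x + \<epsilon> *\<^sub>R D w x" for x
  have v: "v \<in> Lp_on p M"
    unfolding v_def using u w p_pos(2) by (intro Lp_on_add(1) Lp_on_scaleR(1) W1pD)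
  have eq: "AE x in M. D (\<lambda>x. u x + \<epsilon> * w x) x = v x"
    using W1p_add(2)[OF u W1p_scale(1)[OF w, of \<epsilon>]] W1p_scale(2)[OF w, of \<epsilon>]
    unfolding v_def by eventually_elim simp
  have "energy (\<lambda>x. u x + \<epsilon> * w x) = (LINT x|M. Q_density \<sigma> x (norm (v x)))"
    by (rule energy_eq[OF W1p_add(1)[OF u W1p_scale(1)[OF w]] v eq])
  moreover have "(LINT x|M. flux (\<sigma> x) (v x) \<bullet> (D u x - v x)) = - (\<epsilon> * flux_pairing v w)"
    by (simp add: v_def flux_pairing_def)
  moreover have "(\<lambda>x. D u x + \<epsilon> *\<^sub>R D w x) = v"
    by (simp add: v_def[abs_def])
  ultimately show ?thesis
    using Q_subgradient_integral[OF v W1pD(3)[OF u]]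
    by (simp add: dirichlet_energy_def[of \<Omega> \<sigma> u])
qed

lemma flux_pairing_tendsto:
  assumes u: "u \<in> W1p \<Omega> p" and w: "w \<in> W1p \<Omega> p"
  shows "((\<lambda>\<epsilon>. flux_pairing (\<lambda>x. D u x + \<epsilon> *\<^sub>R D w x) w) \<longlongrightarrow> flux_pairing (D u) w) (at 0)"
  unfolding flux_pairing_def by (rule flux_inner_tendsto[OF W1pD(3)[OF u] W1pD(3)[OF w]])

lemma energy_midpoint_convex:
  assumes u: "u \<in> W1p \<Omega> p" and v: "v \<in> W1p \<Omega> p"
  shows "2 * c / 4 powr p * (LINT x|M. norm (D u x - D v x) powr p) + 2 * energy (\<lambda>x. 1/2 * (u x + v x))
      \<le> energy u + energy v"
proof -
  define m where "m x = (1/2) *\<^sub>R (D u x + D v x)" for x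
  have m: "m \<in> Lp_on p M"
    unfolding m_def using u v p_pos(2) by (intro Lp_on_add(1) Lp_on_scaleR(1) W1pD)
  have d: "(\<lambda>x. D u x - D v x) \<in> Lp_on p M"
    using u v p_pos(2) by (intro Lp_on_diff W1pD)
  have "AE x in M. D (\<lambda>x. 1/2 * (u x + v x)) x = m x"
    using W1p_scale(2)[OF W1p_add(1)[OF u v], of "1/2"] W1p_add(2)[OF u v]
    unfolding m_def by eventually_elim simp
  then have "energy (\<lambda>x. 1/2 * (u x + v x)) = (LINT x|M. Q_density \<sigma> x (norm (m x)))"
    by (rule energy_eq[OF W1p_scale(1)[OF W1p_add(1)[OF u v]] m])
  then have "2 * c / 4 powr p * (LINT x|M. norm (D u x - D v x) powr p) + 2 * energy (\<lambda>x. 1/2 * (u x + v x))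
      = (LINT x|M. 2 * c / 4 powr p * norm (D u x - D v x) powr p + 2 * Q_density \<sigma> x (norm (m x)))"
    using Lp_on_integrable[OF d] integrable_Q[OF m] by simp
  also have "\<dots> \<le> (LINT x|M. Q_density \<sigma> x (norm (D u x)) + Q_density \<sigma> x (norm (D v x)))"
  proof (rule integral_mono_AE)
    show "AE x in M. 2 * c / 4 powr p * norm (D u x - D v x) powr p + 2 * Q_density \<sigma> x (norm (m x))
        \<le> Q_density \<sigma> x (norm (D u x)) + Q_density \<sigma> x (norm (D v x))"
      using law strongly_monotone
    proof eventually_elim
      case (elim x)
      have "2 * c * (norm (D u x - D v x) / 4) powr p + 2 * Q_density \<sigma> x (norm ((1/2) *\<^sub>R (D v x + D u x)))
          \<le> Q_density \<sigma> x (norm (D v x)) + Q_density \<sigma> x (norm (D u x))"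
        unfolding Q_density_def by (rule monotone_law.Q_midpoint_convex[OF elim(1)]) (use elim(2) in blast)
      then show ?case
        by (simp add: m_def powr_divide add.commute)
    qed
  qed (use Lp_on_integrable[OF d] integrable_Q[OF m] integrable_Q[OF W1pD(3)[OF u]] integrable_Q[OF W1pD(3)[OF v]] in auto)
  also have "\<dots> = energy u + energy v"
    using integrable_Q[OF W1pD(3)[OF u]] integrable_Q[OF W1pD(3)[OF v]]
    by (simp add: dirichlet_energy_def)
  finally show ?thesis .
qed

text \<open>Strong convexity makes the gradients of a minimizing sequence Cauchy in \<open>L\<^sup>p\<close>, and Fatou's
  lemma shows that the energy of their limit is not above the infimum.\<close>

lemma minimizer_exists:
  assumes f: "f \<in> W1p \<Omega> p"
  shows "\<exists>u. u \<in> trace_class \<Omega> p f \<and> (\<forall>v\<in>trace_class \<Omega> p f. energy u \<le> energy v)"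
proof -
  define A where "A = trace_class \<Omega> p f"
  define I where "I = Inf (energy ` A)"
  have ne: "A \<noteq> {}"
    using trace_class_self[OF f] by (auto simp: A_def)
  have bdd: "bdd_below (energy ` A)"
    by (rule bdd_belowI2[of _ 0]) (rule energy_nonneg)
  have I_le: "I \<le> energy v" if "v \<in> A" for v
    unfolding I_def using bdd that by (intro cInf_lower) auto
  have "\<exists>u\<in>A. energy u < I + 1 / real (Suc k)" for k
    using cInf_lessD[of "energy ` A" "I + 1 / real (Suc k)"] ne by (auto simp: I_def)
  then obtain u where uA: "\<And>k. u k \<in> A" and uI: "\<And>k. energy (u k) < I + 1 / real (Suc k)"
    by metis
  have u: "u k \<in> W1p \<Omega> p" "(\<lambda>x. u k x - f x) \<in> W1p_0 \<Omega> p" for k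
    using uA[of k] by (auto simp: A_def trace_class_iff)
  have Cauchy: "\<exists>N. \<forall>k\<ge>N. \<forall>l\<ge>N. (LINT x|M. norm (D (u k) x - D (u l) x) powr p) < e" if e: "0 < e" for e
  proof -
    define d where "d = c / 4 powr p * e"
    have "0 < d"
      using c_pos e by (simp add: d_def)
    then obtain N where N: "1 / real (Suc N) < d"
      using nat_approx_posE by blast
    have "(LINT x|M. norm (D (u k) x - D (u l) x) powr p) < e" if kl: "k \<ge> N" "l \<ge> N" for k l
    proof -
      have "(\<lambda>x. 1/2 * (u k x + u l x)) \<in> trace_class \<Omega> p (\<lambda>x. 1/2 * (f x + f x))"
        using uA unfolding A_def by (intro trace_class_scale trace_class_add)
      then have "I \<le> energy (\<lambda>x. 1/2 * (u k x + u l x))"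
        by (intro I_le) (simp add: A_def)
      then have "2 * (c / 4 powr p * (LINT x|M. norm (D (u k) x - D (u l) x) powr p)) \<le> energy (u k) + energy (u l) - 2 * I"
        using energy_midpoint_convex[OF u(1)[of k] u(1)[of l]] by simp
      also have "\<dots> < 1 / real (Suc k) + 1 / real (Suc l)"
        using uI[of k] uI[of l] by simp
      also have "\<dots> \<le> 1 / real (Suc N) + 1 / real (Suc N)"
        using kl by (intro add_mono divide_left_mono) auto
      also have "\<dots> < 2 * d"
        using N by simp
      finally have "c / 4 powr p * (LINT x|M. norm (D (u k) x - D (u l) x) powr p) < c / 4 powr p * e"
        unfolding d_def by linarith
      then show ?thesis
        by (rule mult_left_less_imp_less) (use c_pos in simp)
    qed
    then show ?thesis by blast
  qed
  obtain v r where v: "v \<in> W1p \<Omega> p" "(\<lambda>x. v x - f x) \<in> W1p_0 \<Omega> p"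
    and r: "strict_mono (r :: nat \<Rightarrow> nat)" "AE x in M. (\<lambda>k. D (u (r k)) x) \<longlonglongrightarrow> D v x"
    by (rule coset_complete[OF u f Cauchy]) (assumption, rule that)
  have eI: "(\<lambda>k. energy (u (r k))) \<longlonglongrightarrow> I"
  proof (rule tendsto_sandwich[where f="\<lambda>k. I" and h="\<lambda>k. I + 1 / real (Suc (r k))"])
    have "(\<lambda>k. I + 1 / real (Suc k)) \<longlonglongrightarrow> I + 0"
      by (intro tendsto_intros LIMSEQ_Suc[OF lim_1_over_n])
    from LIMSEQ_subseq_LIMSEQ[OF this r(1)] show "(\<lambda>k. I + 1 / real (Suc (r k))) \<longlonglongrightarrow> I"
      by (simp add: comp_def)
  qed (use I_le[OF uA] uI in \<open>auto intro!: always_eventually less_imp_le\<close>)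
  have nn: "(\<integral>\<^sup>+x. ennreal (Q_density \<sigma> x (norm (D w x))) \<partial>M) = ennreal (energy w)" if "w \<in> W1p \<Omega> p" for w
    unfolding dirichlet_energy_def
  proof (rule nn_integral_eq_integral[OF integrable_Q[OF W1pD(3)[OF that]]])
    show "AE x in M. 0 \<le> Q_density \<sigma> x (norm (D w x))"
      using law growth by eventually_elim (rule Q_bound)
  qed
  have "ennreal (energy v) = (\<integral>\<^sup>+x. liminf (\<lambda>k. ennreal (Q_density \<sigma> x (norm (D (u (r k)) x)))) \<partial>M)"
    unfolding nn[OF v(1), symmetric]
  proof (rule nn_integral_cong_AE, use law r(2) in eventually_elim)
    case (elim x)
    have "(\<lambda>k. Q_density \<sigma> x (norm (D (u (r k)) x))) \<longlonglongrightarrow> Q_density \<sigma> x (norm (D v x))"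
      unfolding Q_density_def using elim by (intro monotone_law.Q_tendsto tendsto_norm) auto
    then have "(\<lambda>k. ennreal (Q_density \<sigma> x (norm (D (u (r k)) x)))) \<longlonglongrightarrow> ennreal (Q_density \<sigma> x (norm (D v x)))"
      by (rule tendsto_ennrealI)
    then show ?case
      by (rule lim_imp_Liminf[OF sequentially_bot, symmetric])
  qed
  also have "\<dots> \<le> liminf (\<lambda>k. \<integral>\<^sup>+x. ennreal (Q_density \<sigma> x (norm (D (u (r k)) x))) \<partial>M)"
    using integrable_Q[OF W1pD(3)[OF u(1)]]
    by (intro nn_integral_liminf measurable_compose[OF _ measurable_ennreal] borel_measurable_integrable)
  also have "\<dots> = liminf (\<lambda>k. ennreal (energy (u (r k))))"
    by (simp only: nn[OF u(1)])
  also have "\<dots> = ennreal I"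
    by (intro lim_imp_Liminf[OF sequentially_bot] tendsto_ennrealI eI)
  finally have "ennreal (energy v) \<le> ennreal I" .
  moreover have "0 \<le> I"
    unfolding I_def by (rule cInf_greatest) (use ne energy_nonneg in auto)
  ultimately have "energy v \<le> I"
    by (simp add: ennreal_le_iff)
  then have "energy v \<le> energy w" if "w \<in> trace_class \<Omega> p f" for w
    by (rule order_trans) (rule I_le[unfolded A_def, OF that])
  moreover have "v \<in> trace_class \<Omega> p f"
    using v by (simp add: trace_class_iff)
  ultimately show ?thesis
    by blast
qed

lemma minimizer:
  assumes f: "f \<in> W1p \<Omega> p"
  shows "minimizer f \<in> trace_class \<Omega> p f" "minimizer f \<in> W1p \<Omega> p"
    "\<And>v. v \<in> trace_class \<Omega> p f \<Longrightarrow> energy (minimizer f) \<le> energy v"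
proof -
  have "minimizer f \<in> trace_class \<Omega> p f \<and> (\<forall>v\<in>trace_class \<Omega> p f. energy (minimizer f) \<le> energy v)"
    unfolding energy_minimizer_def by (rule someI_ex[OF minimizer_exists[OF f]])
  then show "minimizer f \<in> trace_class \<Omega> p f" "minimizer f \<in> W1p \<Omega> p"
    "\<And>v. v \<in> trace_class \<Omega> p f \<Longrightarrow> energy (minimizer f) \<le> energy v"
    by (auto simp: trace_class_iff)
qed

text \<open>By minimality \<open>\<epsilon> J(\<epsilon>)\<close> is nonnegative, where \<open>J(\<epsilon>)\<close> is the pairing at \<open>u + \<epsilon> w\<close>; so the limit of \<open>J\<close> at
  \<open>0\<close> is nonnegative from the right and nonpositive from the left.\<close>

lemma Euler_Lagrange:
  assumes f: "f \<in> W1p \<Omega> p" and w: "w \<in> W1p_0 \<Omega> p"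
  shows "flux_pairing (D (minimizer f)) w = 0"
proof -
  define u where "u = minimizer f"
  define J where "J \<epsilon> = flux_pairing (\<lambda>x. D u x + \<epsilon> *\<^sub>R D w x) w" for \<epsilon>
  note W = W1p_0_W1p[OF w]
  have u: "u \<in> trace_class \<Omega> p f" "u \<in> W1p \<Omega> p" "\<And>v. v \<in> trace_class \<Omega> p f \<Longrightarrow> energy u \<le> energy v"
    using minimizer[OF f] by (auto simp: u_def)
  have J: "(J \<longlongrightarrow> flux_pairing (D u) w) (at 0)"
    unfolding J_def by (rule flux_pairing_tendsto[OF u(2) W])
  have pos: "0 \<le> \<epsilon> * J \<epsilon>" for \<epsilon>
  proof -
    have "energy u \<le> energy (\<lambda>x. u x + \<epsilon> * w x)"
      by (intro u(3) trace_class_add_W1p_0 u(1) W1p_0_scale w)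
    then show ?thesis
      using energy_line_le[OF u(2) W, of \<epsilon>] by (simp add: J_def)
  qed
  have "(J \<longlongrightarrow> flux_pairing (D u) w) (at_right 0)" "(J \<longlongrightarrow> flux_pairing (D u) w) (at_left 0)"
    using J by (auto simp: filterlim_at_split)
  moreover have "\<forall>\<^sub>F \<epsilon> in at_right 0. 0 \<le> J \<epsilon>"
    using eventually_at_right_less[of "0::real"]
  proof eventually_elim
    case (elim y)
    then show "0 \<le> J y"
      using pos[of y] by (simp add: zero_le_mult_iff)
  qed
  moreover have "\<forall>\<^sub>F \<epsilon> in at_left 0. J \<epsilon> \<le> 0"
    unfolding eventually_at_left_field
  proof (intro exI[of _ "-1"] conjI allI impI)
    fix y :: real assume "y < 0"
    then show "J y \<le> 0"
      using pos[of y] by (simp add: zero_le_mult_iff)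
  qed simp
  ultimately have "0 \<le> flux_pairing (D u) w" "flux_pairing (D u) w \<le> 0"
    by (auto intro: tendsto_lowerbound tendsto_upperbound)
  then show ?thesis
    by (simp add: u_def)
qed


section \<open>The Dirichlet-to-Neumann operator is the derivative\<close>

text \<open>Representatives differ by an element of \<open>W1p_0\<close>, on which the pairing vanishes by the
  Euler-Lagrange equation.\<close>

lemma DtN_eq:
  assumes f: "f \<in> W1p \<Omega> p" and g: "g \<in> W1p \<Omega> p" and \<psi>: "\<psi> \<in> trace_class \<Omega> p g"
  shows "DtN \<Omega> \<sigma> (trace_class \<Omega> p f) (trace_class \<Omega> p g) = flux_pairing (D (minimizer f)) \<psi>"
proof -
  define \<phi> where "\<phi> = (SOME \<phi>. \<phi> \<in> trace_class \<Omega> p g)"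
  have \<phi>: "\<phi> \<in> trace_class \<Omega> p g"
    unfolding \<phi>_def using \<psi> by (rule someI[where P="\<lambda>\<phi>. \<phi> \<in> trace_class \<Omega> p g"])
  have W: "\<phi> \<in> W1p \<Omega> p" "\<psi> \<in> W1p \<Omega> p"
    using \<phi> \<psi> by (auto simp: trace_class_iff)
  have d: "(\<lambda>x. \<phi> x - \<psi> x) \<in> W1p_0 \<Omega> p"
    by (rule trace_class_diff[OF \<phi> \<psi>])
  have Du: "D (minimizer f) \<in> Lp_on p M"
    by (rule W1pD(3)[OF minimizer(2)[OF f]])
  have "DtN \<Omega> \<sigma> (trace_class \<Omega> p f) (trace_class \<Omega> p g) = flux_pairing (D (minimizer f)) \<phi>"
    by (simp add: DtN_def flux_pairing_def flux_def Let_def flip: \<phi>_def)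
  also have "\<dots> = flux_pairing (D (minimizer f)) (\<lambda>x. \<psi> x + (\<phi> x - \<psi> x))"
    by simp
  also have "\<dots> = flux_pairing (D (minimizer f)) \<psi>"
    using flux_pairing_add[OF Du W(2) W1p_0_W1p[OF d]] Euler_Lagrange[OF f d] by simp
  finally show ?thesis .
qed

text \<open>The difference quotient lies between \<open>L\<close>, the pairing at \<open>u\<close>, and \<open>J(\<epsilon>)\<close>, the pairing at \<open>u + \<epsilon> g\<close>; their order
  depends on the sign of \<open>\<epsilon>\<close>.\<close>

lemma energy_minimizer_derivative:
  assumes f: "f \<in> W1p \<Omega> p" and g: "g \<in> W1p \<Omega> p"
  shows "((\<lambda>\<epsilon>. (energy (minimizer (\<lambda>x. f x + \<epsilon> * g x)) - energy (minimizer f)) / \<epsilon>)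
           \<longlongrightarrow> flux_pairing (D (minimizer f)) g) (at 0)"
proof -
  define u where "u = minimizer f"
  define J where "J \<epsilon> = flux_pairing (\<lambda>x. D u x + \<epsilon> *\<^sub>R D g x) g" for \<epsilon>
  define L where "L = flux_pairing (D u) g"
  define h where "h \<epsilon> = energy (minimizer (\<lambda>x. f x + \<epsilon> * g x))" for \<epsilon>
  have u: "u \<in> trace_class \<Omega> p f" "u \<in> W1p \<Omega> p"
    using minimizer[OF f] by (auto simp: u_def)
  have upper: "h \<epsilon> - energy u \<le> \<epsilon> * J \<epsilon>" and lower: "\<epsilon> * L \<le> h \<epsilon> - energy u" for \<epsilon>
  proof -
    define z where "z = minimizer (\<lambda>x. f x + \<epsilon> * g x)"
    note eg = W1p_scale(1)[OF g, of \<epsilon>]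
    note feg = W1p_add(1)[OF f eg]
    have z: "z \<in> trace_class \<Omega> p (\<lambda>x. f x + \<epsilon> * g x)" "z \<in> W1p \<Omega> p"
      "\<And>v. v \<in> trace_class \<Omega> p (\<lambda>x. f x + \<epsilon> * g x) \<Longrightarrow> energy z \<le> energy v"
      using minimizer[OF feg] by (auto simp: z_def)
    have ueg: "(\<lambda>x. u x + \<epsilon> * g x) \<in> trace_class \<Omega> p (\<lambda>x. f x + \<epsilon> * g x)"
      by (intro trace_class_add u(1) trace_class_self eg)
    have "energy z \<le> energy (\<lambda>x. u x + \<epsilon> * g x)"
      by (rule z(3)[OF ueg])
    then show "h \<epsilon> - energy u \<le> \<epsilon> * J \<epsilon>"
      using energy_line_le[OF u(2) g, of \<epsilon>] by (simp add: h_def J_def z_def)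
    define w where "w x = z x - (u x + \<epsilon> * g x)" for x
    have w: "w \<in> W1p_0 \<Omega> p"
      unfolding w_def by (rule trace_class_diff[OF z(1) ueg])
    have "flux_pairing (D u) (\<lambda>x. z x - u x) = flux_pairing (D u) (\<lambda>x. \<epsilon> * g x + w x)"
      by (simp add: w_def)
    also have "\<dots> = flux_pairing (D u) (\<lambda>x. \<epsilon> * g x) + flux_pairing (D u) w"
      by (rule flux_pairing_add[OF W1pD(3)[OF u(2)] eg W1p_0_W1p[OF w]])
    also have "\<dots> = \<epsilon> * L"
      using flux_pairing_scale[OF W1pD(3)[OF u(2)] g, of \<epsilon>] Euler_Lagrange[OF f w] by (simp add: L_def u_def)
    finally show "\<epsilon> * L \<le> h \<epsilon> - energy u"
      using energy_subgradient[OF u(2) z(2)] by (simp add: h_def z_def)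
  qed
  have "(J \<longlongrightarrow> L) (at 0)"
    unfolding J_def L_def by (rule flux_pairing_tendsto[OF u(2) g])
  then have J: "((\<lambda>\<epsilon>. \<bar>J \<epsilon> - L\<bar>) \<longlongrightarrow> 0) (at 0)"
    by (simp add: LIM_zero tendsto_rabs_zero)
  have "((\<lambda>\<epsilon>. (h \<epsilon> - energy u) / \<epsilon> - L) \<longlongrightarrow> 0) (at 0)"
  proof (rule Lim_null_comparison[OF _ J])
    have "norm ((h \<epsilon> - energy u) / \<epsilon> - L) \<le> \<bar>J \<epsilon> - L\<bar>" if "\<epsilon> \<noteq> 0" for \<epsilon>
    proof (cases "0 < \<epsilon>")
      case True
      then have "L \<le> (h \<epsilon> - energy u) / \<epsilon>" "(h \<epsilon> - energy u) / \<epsilon> \<le> J \<epsilon>"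
        using upper[of \<epsilon>] lower[of \<epsilon>] by (simp_all add: field_simps)
      then show ?thesis by simp
    next
      case False
      with that have "\<epsilon> < 0" by simp
      then have "(h \<epsilon> - energy u) / \<epsilon> \<le> L" "J \<epsilon> \<le> (h \<epsilon> - energy u) / \<epsilon>"
        using upper[of \<epsilon>] lower[of \<epsilon>] by (simp_all add: field_simps)
      then show ?thesis by simp
    qed
    then show "\<forall>\<^sub>F \<epsilon> in at 0. norm ((h \<epsilon> - energy u) / \<epsilon> - L) \<le> \<bar>J \<epsilon> - L\<bar>"
      by (simp add: eventually_at_filter)
  qed
  then show ?thesis
    unfolding h_def u_def L_def by (rule LIM_zero_cancel)
qed

text \<open>The growth condition bounds the functional on the unit ball of the Sobolev norm, and
  homogeneity extends the bound to all functions.\<close>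

lemma flux_pairing_bounded:
  assumes v: "v \<in> Lp_on p M"
  obtains K where "0 < K" "\<And>w. w \<in> W1p \<Omega> p \<Longrightarrow> \<bar>flux_pairing v w\<bar> \<le> K * W1p_norm \<Omega> p w"
proof -
  define K0 where "K0 = (LINT x|M. C * (2 powr p * (1 + norm (v x)) powr p))"
  define K1 where "K1 = C * 2 powr p"
  have K: "0 \<le> K0" "0 \<le> K1"
    using C_nonneg by (auto simp: K0_def K1_def intro!: Bochner_Integration.integral_nonneg)
  have int: "integrable M (\<lambda>x. C * (2 powr p * (1 + norm (v x)) powr p))"
    using integrable_mult_right[OF integrable_majorant[OF v v order.refl], of "2 powr p"]
    by (simp add: mult.left_commute)
  have bound: "\<bar>flux_pairing v w\<bar> \<le> K0 + K1 * modular w" if w: "w \<in> W1p \<Omega> p" for w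
  proof -
    note Dw = W1pD(3)[OF w]
    have "\<bar>flux_pairing v w\<bar> \<le> (LINT x|M. \<bar>flux (\<sigma> x) (v x) \<bullet> D w x\<bar>)"
      unfolding flux_pairing_def by (rule integral_abs_bound)
    also have "\<dots> \<le> (LINT x|M. C * (2 powr p * (1 + norm (v x)) powr p) + K1 * norm (D w x) powr p)"
    proof (rule integral_mono_AE)
      show "AE x in M. \<bar>flux (\<sigma> x) (v x) \<bullet> D w x\<bar> \<le> C * (2 powr p * (1 + norm (v x)) powr p) + K1 * norm (D w x) powr p"
        using law growth
      proof eventually_elim
        case (elim x)
        have "\<bar>flux (\<sigma> x) (v x) \<bullet> D w x\<bar> \<le> C * (1 + (norm (v x) + norm (D w x))) powr p"
          by (rule flux_inner_bound[OF elim]) auto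
        also have "\<dots> \<le> C * (2 powr p * ((1 + norm (v x)) powr p + norm (D w x) powr p))"
          using powr_add_le[of "1 + norm (v x)" "norm (D w x)" p] C_nonneg p_pos(2)
          by (intro mult_left_mono) (auto simp: add.assoc)
        finally show ?case
          by (simp add: K1_def algebra_simps)
      qed
      show "integrable M (\<lambda>x. C * (2 powr p * (1 + norm (v x)) powr p) + K1 * norm (D w x) powr p)"
        using int Lp_on_integrable[OF Dw] by simp
      show "integrable M (\<lambda>x. \<bar>flux (\<sigma> x) (v x) \<bullet> D w x\<bar>)"
        using integrable_flux_inner[OF v Dw] by simp
    qed
    also have "\<dots> = K0 + K1 * (LINT x|M. norm (D w x) powr p)"
      using int Lp_on_integrable[OF Dw] unfolding K0_def by simp
    also have "\<dots> \<le> K0 + K1 * modular w"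
      using K(2) by (intro add_left_mono mult_left_mono) (auto simp: modular_def)
    finally show ?thesis .
  qed
  show ?thesis
  proof (rule that[of "K0 + K1 + 1"])
    show "0 < K0 + K1 + 1"
      using K by simp
    fix w assume w: "w \<in> W1p \<Omega> p"
    define N where "N = W1p_norm \<Omega> p w"
    have N: "N powr p = modular w" "0 \<le> N"
      using p_pos by (simp_all add: N_def W1p_norm_eq powr_powr modular_nonneg)
    have hom: "\<bar>t\<bar> * \<bar>flux_pairing v w\<bar> \<le> K0 + K1 * (\<bar>t\<bar> powr p * modular w)" for t
      using bound[OF W1p_scale(1)[OF w, of t]] flux_pairing_scale[OF v w, of t] modular_scale[OF w, of t]
      by (simp add: abs_mult)
    show "\<bar>flux_pairing v w\<bar> \<le> (K0 + K1 + 1) * W1p_norm \<Omega> p w"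
    proof (cases "N = 0")
      case True
      then have "modular w = 0"
        using N(1) p_pos by simp
      have "\<bar>flux_pairing v w\<bar> = 0"
      proof (rule ccontr)
        assume F: "\<bar>flux_pairing v w\<bar> \<noteq> 0"
        \<comment> \<open>This multiple of \<open>w\<close> has \<open>modular\<close> zero, but the absolute value of the pairing is \<open>K0 + 1\<close> there.\<close>
        then show False
          using hom[of "(K0 + 1) / \<bar>flux_pairing v w\<bar>"] K \<open>modular w = 0\<close> by simp
      qed
      then show ?thesis
        using True by (simp add: N_def)
    next
      case False
      then have "0 < N"
        using N(2) by simp
      have "(1 / N) powr p * modular w = 1"
        using \<open>0 < N\<close> by (simp add: powr_divide flip: N(1))
      then have "\<bar>flux_pairing v w\<bar> / N \<le> K0 + K1"
        using hom[of "1 / N"] \<open>0 < N\<close> by simp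
      then have "\<bar>flux_pairing v w\<bar> \<le> (K0 + K1) * N"
        using \<open>0 < N\<close> by (simp add: divide_le_eq)
      also have "\<dots> \<le> (K0 + K1 + 1) * N"
        using \<open>0 < N\<close> by simp
      finally show ?thesis
        by (simp add: N_def)
    qed
  qed
qed

theorem has_gateaux_derivative_energy_minimizer:
  assumes V: "V \<subseteq> trace_space \<Omega> p" and f: "f \<in> V"
  shows "has_gateaux_derivative V trace_add (trace_scale \<Omega> p) (trace_norm \<Omega> p)
           (energy \<circ> energy_minimizer \<Omega> \<sigma>) f (DtN \<Omega> \<sigma> f)"
proof -
  obtain f0 where f0: "f = trace_class \<Omega> p f0" "f0 \<in> W1p \<Omega> p"
    using V f by (auto simp: trace_space_def)
  have rep: "\<exists>g\<in>W1p \<Omega> p. \<phi> = trace_class \<Omega> p g" if "\<phi> \<in> V" for \<phi>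
    using V that by (auto simp: trace_space_def)
  define L where "L = flux_pairing (D (minimizer f0))"
  have Du: "D (minimizer f0) \<in> Lp_on p M"
    by (rule W1pD(3)[OF minimizer(2)[OF f0(2)]])
  have DtN: "DtN \<Omega> \<sigma> f (trace_class \<Omega> p g) = L g" if "g \<in> W1p \<Omega> p" for g
    unfolding f0(1) L_def by (rule DtN_eq[OF f0(2) that trace_class_self[OF that]])
  obtain K where "0 < K" "\<And>w. w \<in> W1p \<Omega> p \<Longrightarrow> \<bar>flux_pairing (D (minimizer f0)) w\<bar> \<le> K * W1p_norm \<Omega> p w"
    by (rule flux_pairing_bounded[OF Du]) (rule that)
  note K = this(1) this(2)[folded L_def]
  show ?thesis
    unfolding has_gateaux_derivative_def
  proof (intro conjI ballI allI exI[of _ K])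
    fix \<phi> assume "\<phi> \<in> V"
    then obtain g where g: "g \<in> W1p \<Omega> p" "\<phi> = trace_class \<Omega> p g"
      using rep by blast
    have line: "trace_add f (trace_scale \<Omega> p \<epsilon> \<phi>) = trace_class \<Omega> p (\<lambda>x. f0 x + \<epsilon> * g x)" for \<epsilon>
      using trace_add_class[OF f0(2) W1p_scale(1)[OF g(1)], of \<epsilon>] trace_scale_class[OF g(1), of \<epsilon>]
      by (simp add: f0(1) g(2))
    show "((\<lambda>\<epsilon>. ((energy \<circ> energy_minimizer \<Omega> \<sigma>) (trace_add f (trace_scale \<Omega> p \<epsilon> \<phi>))
              - (energy \<circ> energy_minimizer \<Omega> \<sigma>) f) / \<epsilon>) \<longlongrightarrow> DtN \<Omega> \<sigma> f \<phi>) (at 0)"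
      unfolding comp_def line
      using energy_minimizer_derivative[OF f0(2) g(1)] DtN[OF g(1)]
      by (simp add: f0(1) g(2) L_def)
    \<comment> \<open>The bound holds with every representative on the right, hence with the infimum.\<close>
    have "\<bar>DtN \<Omega> \<sigma> f \<phi>\<bar> / K \<le> trace_norm \<Omega> p \<phi>"
      unfolding trace_norm_def
    proof (rule cINF_greatest)
      show "\<phi> \<noteq> {}"
        using trace_class_self[OF g(1)] g(2) by auto
      fix u assume u: "u \<in> \<phi>"
      then have "DtN \<Omega> \<sigma> f \<phi> = L u"
        unfolding f0(1) g(2) L_def by (intro DtN_eq f0(2) g(1))
      moreover have "u \<in> W1p \<Omega> p"
        using u g(2) by (simp add: trace_class_iff)
      ultimately show "\<bar>DtN \<Omega> \<sigma> f \<phi>\<bar> / K \<le> W1p_norm \<Omega> p u"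
        using K by (simp add: divide_le_eq mult.commute)
    qed
    then show "\<bar>DtN \<Omega> \<sigma> f \<phi>\<bar> \<le> K * trace_norm \<Omega> p \<phi>"
      using K(1) by (simp add: divide_le_eq mult.commute)
  next
    fix \<phi> \<psi> assume "\<phi> \<in> V" "\<psi> \<in> V"
    then obtain g h where g: "g \<in> W1p \<Omega> p" "\<phi> = trace_class \<Omega> p g" and h: "h \<in> W1p \<Omega> p" "\<psi> = trace_class \<Omega> p h"
      using rep by blast
    show "DtN \<Omega> \<sigma> f (trace_add \<phi> \<psi>) = DtN \<Omega> \<sigma> f \<phi> + DtN \<Omega> \<sigma> f \<psi>"
      using DtN[OF g(1)] DtN[OF h(1)] DtN[OF W1p_add(1)[OF g(1) h(1)]] flux_pairing_add[OF Du g(1) h(1)]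
      by (simp add: g(2) h(2) trace_add_class[OF g(1) h(1)] L_def)
  next
    fix a \<phi> assume "\<phi> \<in> V"
    then obtain g where g: "g \<in> W1p \<Omega> p" "\<phi> = trace_class \<Omega> p g"
      using rep by blast
    show "DtN \<Omega> \<sigma> f (trace_scale \<Omega> p a \<phi>) = a * DtN \<Omega> \<sigma> f \<phi>"
      using DtN[OF g(1)] DtN[OF W1p_scale(1)[OF g(1), of a]] flux_pairing_scale[OF Du g(1), of a]
      by (simp add: g(2) trace_scale_class[OF g(1)] L_def)
  qed
qed

end


section \<open>The hypotheses on the conductivity\<close>

text \<open>The inequalities for positive arguments extend to \<open>0\<close> by continuity. Replacing the maximum in the upper
  bound by a power of \<open>1 + E\<close> merges its two cases.\<close>

lemma monotone_lawI:
  fixes s :: "real \<Rightarrow> real"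
  assumes mono: "strict_mono_on {0<..} (\<lambda>E. s E * E)" and cont: "continuous_on {0..} s"
    and bounds: "\<And>E. 0 < E \<Longrightarrow> lo * (E / E0) powr (p - 2) \<le> s E \<and> s E \<le> up * max 1 ((E / E0) powr (p - 2))"
    and const: "0 < lo" "lo \<le> up" "0 < E0" "2 \<le> p"
  shows "monotone_law s" "\<And>E. 0 \<le> E \<Longrightarrow> s E \<le> up * max 1 (1 / E0 powr (p - 2)) * (1 + E) powr (p - 2)"
proof -
  let ?C = "up * max 1 (1 / E0 powr (p - 2))"
  have lim: "(\<lambda>k. 1 / real (Suc k)) \<longlonglongrightarrow> 0"
    by (rule LIMSEQ_Suc[OF lim_1_over_n])
  have s0: "(\<lambda>k. s (1 / real (Suc k))) \<longlonglongrightarrow> s 0"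
    by (rule continuous_on_tendsto_compose[OF cont lim]) auto
  have pos: "0 \<le> s E" if "0 < E" for E
  proof -
    have "0 \<le> lo * (E / E0) powr (p - 2)"
      using const by simp
    also have "\<dots> \<le> s E"
      using bounds[OF that] by simp
    finally show ?thesis .
  qed
  have nonneg: "0 \<le> s E" if "0 \<le> E" for E
  proof (cases "E = 0")
    case True
    have "0 \<le> s 0"
      by (rule LIMSEQ_le_const[OF s0]) (intro exI allI impI pos, simp)
    with True show ?thesis by simp
  qed (use that pos in auto)
  have le: "s E \<le> ?C * (1 + E) powr (p - 2)" if "0 < E" for E
  proof -
    have "(E / E0) powr (p - 2) \<le> 1 / E0 powr (p - 2) * (1 + E) powr (p - 2)"
      using that const by (simp add: powr_divide divide_right_mono powr_mono2)
    also have "\<dots> \<le> max 1 (1 / E0 powr (p - 2)) * (1 + E) powr (p - 2)"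
      by (intro mult_right_mono) auto
    finally have 1: "(E / E0) powr (p - 2) \<le> max 1 (1 / E0 powr (p - 2)) * (1 + E) powr (p - 2)" .
    have "1 * 1 \<le> max 1 (1 / E0 powr (p - 2)) * (1 + E) powr (p - 2)"
      using that const by (intro mult_mono ge_one_powr_ge_zero) auto
    with 1 have "max 1 ((E / E0) powr (p - 2)) \<le> max 1 (1 / E0 powr (p - 2)) * (1 + E) powr (p - 2)"
      by simp
    then have "up * max 1 ((E / E0) powr (p - 2)) \<le> up * (max 1 (1 / E0 powr (p - 2)) * (1 + E) powr (p - 2))"
      using const by (intro mult_left_mono) auto
    with bounds[OF that] show ?thesis
      by (simp add: mult.assoc)
  qed
  show "s E \<le> ?C * (1 + E) powr (p - 2)" if "0 \<le> E" for E
  proof (cases "E = 0")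
    case True
    have "(\<lambda>k. ?C * (1 + 1 / real (Suc k)) powr (p - 2)) \<longlonglongrightarrow> ?C * (1 + 0) powr (p - 2)"
      by (intro tendsto_intros lim) auto
    then have "s 0 \<le> ?C * (1 + 0) powr (p - 2)"
      by (rule LIMSEQ_le[OF s0]) (auto intro!: le)
    with True show ?thesis by simp
  qed (use that le in auto)
  show "monotone_law s"
  proof
    fix a b :: real assume ab: "0 \<le> a" "a \<le> b"
    show "s a * a \<le> s b * b"
    proof (cases "a = 0 \<or> a = b")
      case True
      then show ?thesis
        using ab mult_nonneg_nonneg[OF nonneg[of b], of b] by (elim disjE) simp_all
    next
      case False
      then show ?thesis
        using ab strict_mono_onD[OF mono, of a b] by auto
    qed
  qed (use cont nonneg in auto)
qed

lemma AE_lebesgue_on_subset: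
  assumes "AE x in lebesgue_on S. P x" "T \<subseteq> S" "S \<in> sets lebesgue" "T \<in> sets lebesgue"
  shows "AE x in lebesgue_on T. P x"
proof -
  have "AE x in lebesgue. x \<in> S \<longrightarrow> P x"
    using assms by (simp add: AE_restrict_space_iff)
  then have "AE x in lebesgue. x \<in> T \<longrightarrow> P x"
    by eventually_elim (use assms(2) in blast)
  then show ?thesis
    using assms(4) by (simp add: AE_restrict_space_iff)
qed

theorem proposition3p4:
  fixes \<Omega> :: "(real^'n) set"
    and p :: real
    and \<sigma> :: "real^'n \<Rightarrow> real \<Rightarrow> real"
    and f :: "(real^'n \<Rightarrow> real) set"
  assumes n: "CARD('n) \<ge> 2"
    and dom: "lipschitz_domain \<Omega>"
    and p: "p \<ge> 2"
    and H1: "\<And>E. E \<ge> 0 \<Longrightarrow> (\<lambda>x. \<sigma> x E) \<in> borel_measurable (lebesgue_on (closure \<Omega>))"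
    and H2: "AE x in lebesgue_on (closure \<Omega>). strict_mono_on {0<..} (\<lambda>E. \<sigma> x E * E)"
    and H3: "AE x in lebesgue_on (closure \<Omega>). continuous_on {0..} (\<sigma> x)"
    and H4: "\<exists>\<sigma>_lo \<sigma>_up E0. 0 < \<sigma>_lo \<and> \<sigma>_lo \<le> \<sigma>_up \<and> 0 < E0 \<and>
               (AE x in lebesgue_on (closure \<Omega>). \<forall>E>0.
                  \<sigma>_lo * (E / E0) powr (p - 2) \<le> \<sigma> x E \<and>
                  \<sigma> x E \<le> \<sigma>_up * max 1 ((E / E0) powr (p - 2)))"
    and H5: "\<exists>c>0. AE x in lebesgue_on (closure \<Omega>). \<forall>E1 E2 :: real^'n.
               (\<sigma> x (norm E2) *\<^sub>R E2 - \<sigma> x (norm E1) *\<^sub>R E1) \<bullet> (E2 - E1)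
                 \<ge> c * norm (E2 - E1) powr p"
    and f: "f \<in> trace_space_diamond \<Omega> p"
  shows "has_gateaux_derivative (trace_space_diamond \<Omega> p) trace_add (trace_scale \<Omega> p)
           (trace_norm \<Omega> p) (dirichlet_energy \<Omega> \<sigma> \<circ> energy_minimizer \<Omega> \<sigma>) f (DtN \<Omega> \<sigma> f)"
proof -
  have \<Omega>: "open \<Omega>" "bounded \<Omega>"
    using dom by (auto simp: lipschitz_domain_def)
  have sets: "\<Omega> \<in> sets lebesgue" "closure \<Omega> \<in> sets lebesgue"
    using \<Omega>(1) by (auto simp: lebesgue_openin)
  note sub = AE_lebesgue_on_subset[OF _ closure_subset sets(2,1)]
  obtain lo up E0 where const: "0 < lo" "lo \<le> up" "0 < E0" and
    bounds: "AE x in lebesgue_on (closure \<Omega>). \<forall>E>0. lo * (E / E0) powr (p - 2) \<le> \<sigma> x E \<and>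
               \<sigma> x E \<le> up * max 1 ((E / E0) powr (p - 2))"
    using H4 by blast
  obtain c where c: "0 < c" "AE x in lebesgue_on (closure \<Omega>). \<forall>E1 E2 :: real^'n.
      (\<sigma> x (norm E2) *\<^sub>R E2 - \<sigma> x (norm E1) *\<^sub>R E1) \<bullet> (E2 - E1) \<ge> c * norm (E2 - E1) powr p"
    using H5 by blast
  define C where "C = up * max 1 (1 / E0 powr (p - 2))"
  interpret dirichlet_problem \<Omega> p \<sigma> c C
  proof
    show "open \<Omega>" "bounded \<Omega>" "2 \<le> p" "0 < c"
      using \<Omega> p c(1) by auto
    show "0 \<le> C"
      using const by (simp add: C_def)
    show "(\<lambda>x. \<sigma> x E) \<in> borel_measurable (lebesgue_on \<Omega>)" if "0 \<le> E" for E
      using H1[OF that] closure_subset by (rule measurable_restrict_mono)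
    show "AE x in lebesgue_on \<Omega>. monotone_law (\<sigma> x)"
      using sub[OF H2] sub[OF H3] sub[OF bounds]
    proof eventually_elim
      case (elim x)
      show ?case
        by (rule monotone_lawI(1)[OF elim(1,2) _ const p]) (use elim(3) in simp)
    qed
    show "AE x in lebesgue_on \<Omega>. \<forall>E\<ge>0. \<sigma> x E \<le> C * (1 + E) powr (p - 2)"
      using sub[OF H2] sub[OF H3] sub[OF bounds]
    proof eventually_elim
      case (elim x)
      have "\<sigma> x E \<le> C * (1 + E) powr (p - 2)" if "0 \<le> E" for E
        unfolding C_def by (rule monotone_lawI(2)[OF elim(1,2) _ const p that]) (use elim(3) in simp)
      then show ?case by blast
    qed
    show "AE x in lebesgue_on \<Omega>. \<forall>a b::real^'n.
        c * norm (b - a) powr p \<le> (flux (\<sigma> x) b - flux (\<sigma> x) a) \<bullet> (b - a)"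
      using sub[OF c(2)] by (simp add: flux_def)
  qed
  show ?thesis
    by (rule has_gateaux_derivative_energy_minimizer[OF _ f]) (auto simp: trace_space_diamond_def)
qed

end
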